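(* Let $G$ be a group with a conjugation-closed generating set $X$ and let $g\in\mathrm{Mon}(X)$. Let $\mathbf v\in\mathcal F(G,g,\mathbf I)$ with $\rho(\mathbf v)=h$ and let $h'\in[1,g]$ be the element with $hh'=g$. Then the upper set ${\uparrow}(\mathbf v)=\{\mathbf u\in\mathcal F(G,g,\mathbf I):\mathbf v\subseteq\mathbf u\}$ is isomorphic to the topological poset $\mathcal F(G,h',\mathbf I)$. As a consequence, the maximal elements in ${\uparrow}(\mathbf v)$ form a subspace homeomorphic to the order complex $O_{h'}$ of the interval $[1,h']$.
   Context: $\mathrm{Mon}(X)$ is the generated submonoid; $\ell(x)$ is the minimal length of a product of elements of $X$ equal to $x$; $x\le y$ if there is $x'\in\mathrm{Mon}(X)$ with $xx'=y$ and $\ell(x)+\ell(x')=\ell(y)$; $[1,g]=\{x:x\le g\}$. $O_{h'}$ is the order complex of $[1,h']$ with each maximal simplex (maximal chain $x_0<\cdots<x_n$) metrized as the standard orthoscheme $\{0\le y_1\le\cdots\le y_n\le1\}\subset\mathbb R^n$ with $x_i$ at the vertex whose last $i$ coordinates are $1$. A linear factorization of $x$ is $[x_L\ x_1\cdots x_k\ x_R]$ with entries in $\mathrm{Mon}(X)$, $x_1,\dots,x_k\ne1$, lengths summing to $\ell(x)$, product $x$. A weighted linear factorization of $x$ is a function $\mathbf u\colon[0,1]\to G$, trivial at all but finitely many points, such that with $0<s_1<\dots<s_k<1$ the points of $(0,1)$ where $\mathbf u$ is nontrivial, $P(\mathbf u)=[\mathbf u(0)\ \mathbf u(s_1)\cdots\mathbf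 u(s_k)\ \mathbf u(1)]$ is a linear factorization of $x$. The set $\mathrm{WFact}(G,x,\mathbf I)$ of these is a piecewise-Euclidean complex: each cell $\{\mathbf u:P(\mathbf u)=\mathbf x\}$ gets, via $\mathbf u\mapsto\ell\circ\mathbf u$, the metric of an open face of the orthoscheme $\{0\le y_1\le\dots\le y_n\le1\}$, $n=\ell(x)$, in which a multiset of $n$ points of $[0,1]$ listed nondecreasingly is a point. $\mathcal F(G,g,\mathbf I)$ is the topological disjoint union $\bigsqcup_{x\in[1,g]}\mathrm{WFact}(G,x,\mathbf I)$, ordered by $\mathbf v\subseteq\mathbf u$ iff $\mathbf v(r)\le\mathbf u(r)$ for all $r\in[0,1]$. For $\mathbf u\in\mathcal F(G,g,\mathbf I)$, $\rho(\mathbf u)=\prod_{r\in[0,1]}\mathbf u(r)$, the factors ordered left to right by increasing $r$. An isomorphism of topological posets is an order isomorphism that is a homeomorphism. *)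

theory Defs
  imports "HOL-Analysis.Analysis" "HOL-Algebra.Generated_Groups"
begin

definition lprod :: "('a, 'b) monoid_scheme \<Rightarrow> 'a list \<Rightarrow> 'a" where
  "lprod G xs = foldr (\<lambda>a b. a \<otimes>\<^bsub>G\<^esub> b) xs \<one>\<^bsub>G\<^esub>"

definition Mon :: "('a, 'b) monoid_scheme \<Rightarrow> 'a set \<Rightarrow> 'a set" where
  "Mon G X = {lprod G xs | xs. set xs \<subseteq> X}"

definition wlen :: "('a, 'b) monoid_scheme \<Rightarrow> 'a set \<Rightarrow> 'a \<Rightarrow> nat" where
  "wlen G X x = (LEAST n. \<exists>xs. set xs \<subseteq> X \<and> length xs = n \<and> lprod G xs = x)"

definition pref :: "('a, 'b) monoid_scheme \<Rightarrow> 'a set \<Rightarrow> 'a \<Rightarrow> 'a \<Rightarrow> bool" where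
  "pref G X x y \<longleftrightarrow> x \<in> Mon G X \<and> y \<in> Mon G X \<and>
     (\<exists>x' \<in> Mon G X. x \<otimes>\<^bsub>G\<^esub> x' = y \<and> wlen G X x + wlen G X x' = wlen G X y)"

definition intv :: "('a, 'b) monoid_scheme \<Rightarrow> 'a set \<Rightarrow> 'a \<Rightarrow> 'a set" where
  "intv G X g = {x. pref G X x g}"

definition is_linfact :: "('a, 'b) monoid_scheme \<Rightarrow> 'a set \<Rightarrow> 'a \<Rightarrow> 'a \<Rightarrow> 'a list \<Rightarrow> 'a \<Rightarrow> bool" where
  "is_linfact G X x xL xs xR \<longleftrightarrow>
     xL \<in> Mon G X \<and> xR \<in> Mon G X \<and> set xs \<subseteq> Mon G X \<and> (\<forall>y \<in> set xs. y \<noteq> \<one>\<^bsub>G\<^esub>) \<and>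
     wlen G X xL + sum_list (map (wlen G X) xs) + wlen G X xR = wlen G X x \<and>
     xL \<otimes>\<^bsub>G\<^esub> lprod G xs \<otimes>\<^bsub>G\<^esub> xR = x"

text \<open>Points of (0,1) where a function u : [0,1] -> G is nontrivial.
  Functions [0,1] -> G are represented as functions real -> G that are trivial
  outside [0,1].\<close>
definition supp :: "('a, 'b) monoid_scheme \<Rightarrow> (real \<Rightarrow> 'a) \<Rightarrow> real set" where
  "supp G u = {r \<in> {0<..<1}. u r \<noteq> \<one>\<^bsub>G\<^esub>}"

definition Pl :: "('a, 'b) monoid_scheme \<Rightarrow> (real \<Rightarrow> 'a) \<Rightarrow> 'a list" where
  "Pl G u = map u (sorted_list_of_set (supp G u))"

definition wfact :: "('a, 'b) monoid_scheme \<Rightarrow> 'a set \<Rightarrow> 'a \<Rightarrow> (real \<Rightarrow> 'a) \<Rightarrow> bool" where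
  "wfact G X x u \<longleftrightarrow> (\<forall>r. r \<notin> {0..1} \<longrightarrow> u r = \<one>\<^bsub>G\<^esub>) \<and> finite (supp G u) \<and>
     is_linfact G X x (u 0) (Pl G u) (u 1)"

definition rho :: "('a, 'b) monoid_scheme \<Rightarrow> (real \<Rightarrow> 'a) \<Rightarrow> 'a" where
  "rho G u = lprod G ([u 0] @ Pl G u @ [u 1])"

definition Fset :: "('a, 'b) monoid_scheme \<Rightarrow> 'a set \<Rightarrow> 'a \<Rightarrow> (real \<Rightarrow> 'a) set" where
  "Fset G X g = {u. \<exists>x \<in> intv G X g. wfact G X x u}"

definition subwf :: "('a, 'b) monoid_scheme \<Rightarrow> 'a set \<Rightarrow> (real \<Rightarrow> 'a) \<Rightarrow> (real \<Rightarrow> 'a) \<Rightarrow> bool" where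
  "subwf G X v u \<longleftrightarrow> (\<forall>r \<in> {0..1}. pref G X (v r) (u r))"

definition simplex_param :: "nat \<Rightarrow> (nat \<Rightarrow> real) \<Rightarrow> bool" where
  "simplex_param k t \<longleftrightarrow> (\<forall>i<k. 0 \<le> t i \<and> t i \<le> 1) \<and> (\<forall>i j. i \<le> j \<and> j < k \<longrightarrow> t i \<le> t j)"

text \<open>Characteristic map of the closed cell of a linear factorization [xL xs xR]:
  x_i is placed at position t_i; coinciding factors are multiplied in order.\<close>
definition charpt :: "('a, 'b) monoid_scheme \<Rightarrow> 'a \<Rightarrow> 'a list \<Rightarrow> 'a \<Rightarrow> (nat \<Rightarrow> real) \<Rightarrow> real \<Rightarrow> 'a" where
  "charpt G xL xs xR t = (\<lambda>r. if r \<in> {0..1} then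
      lprod G ((if r = 0 then [xL] else []) @ [xs ! i. i \<leftarrow> [0..<length xs], t i = r] @
               (if r = 1 then [xR] else []))
    else \<one>\<^bsub>G\<^esub>)"

definition common_cell :: "('a, 'b) monoid_scheme \<Rightarrow> 'a set \<Rightarrow> 'a \<Rightarrow> (real \<Rightarrow> 'a) \<Rightarrow> (real \<Rightarrow> 'a) \<Rightarrow> bool" where
  "common_cell G X x u w \<longleftrightarrow> (\<exists>xL xs xR t t'. is_linfact G X x xL xs xR \<and>
      simplex_param (length xs) t \<and> simplex_param (length xs) t' \<and>
      u = charpt G xL xs xR t \<and> w = charpt G xL xs xR t')"

text \<open>Orthoscheme coordinates: the multiset of n = ell(x) points of [0,1] where r has
  multiplicity ell(u(r)), listed nondecreasingly.\<close>
definition ocoord :: "('a, 'b) monoid_scheme \<Rightarrow> 'a set \<Rightarrow> (real \<Rightarrow> 'a) \<Rightarrow> real list" where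
  "ocoord G X u = concat (map (\<lambda>r. replicate (wlen G X (u r)) r)
      ([0] @ sorted_list_of_set (supp G u) @ [1]))"

definition ldist :: "real list \<Rightarrow> real list \<Rightarrow> real" where
  "ldist a b = sqrt (\<Sum>(y, z) \<leftarrow> zip a b. (y - z)\<^sup>2)"

text \<open>There is a string u = w_0, ..., w_m = w of consecutive points in common closed
  cells whose total length is < eps (i.e. intrinsic pseudo-distance < eps).\<close>
definition wf_near :: "('a, 'b) monoid_scheme \<Rightarrow> 'a set \<Rightarrow> 'a \<Rightarrow> (real \<Rightarrow> 'a) \<Rightarrow> (real \<Rightarrow> 'a) \<Rightarrow> real \<Rightarrow> bool" where
  "wf_near G X x u w eps \<longleftrightarrow> (\<exists>ws. ws \<noteq> [] \<and> hd ws = u \<and> last ws = w \<and>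
      (\<forall>i. Suc i < length ws \<longrightarrow> common_cell G X x (ws ! i) (ws ! Suc i)) \<and>
      (\<Sum>i < length ws - 1. ldist (ocoord G X (ws ! i)) (ocoord G X (ws ! Suc i))) < eps)"

definition nbhd_open :: "'p set \<Rightarrow> ('p \<Rightarrow> 'p \<Rightarrow> real \<Rightarrow> bool) \<Rightarrow> 'p set \<Rightarrow> bool" where
  "nbhd_open S R U \<longleftrightarrow> U \<subseteq> S \<and>
     (\<forall>u \<in> U. \<exists>e > 0. \<forall>d. 0 < d \<and> d \<le> e \<longrightarrow> (\<forall>w \<in> S. R u w d \<longrightarrow> w \<in> U))"

lemma istopology_nbhd_open: "istopology (nbhd_open S R)"
  unfolding istopology_def
proof (intro conjI allI impI)
  fix U V assume h1: "nbhd_open S R U" and h2: "nbhd_open S R V"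
  note h = conjI[OF h1 h2]
  show "nbhd_open S R (U \<inter> V)"
    unfolding nbhd_open_def
  proof (intro conjI ballI)
    show "U \<inter> V \<subseteq> S" using h by (auto simp: nbhd_open_def)
  next
    fix u assume u: "u \<in> U \<inter> V"
    then obtain e1 where e1: "e1 > 0" "\<forall>d. 0 < d \<and> d \<le> e1 \<longrightarrow> (\<forall>w \<in> S. R u w d \<longrightarrow> w \<in> U)"
      using h by (auto simp: nbhd_open_def)
    obtain e2 where e2: "e2 > 0" "\<forall>d. 0 < d \<and> d \<le> e2 \<longrightarrow> (\<forall>w \<in> S. R u w d \<longrightarrow> w \<in> V)"
      using h u by (auto simp: nbhd_open_def)
    show "\<exists>e > 0. \<forall>d. 0 < d \<and> d \<le> e \<longrightarrow> (\<forall>w \<in> S. R u w d \<longrightarrow> w \<in> U \<inter> V)"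
      using e1 e2 by (intro exI[of _ "min e1 e2"]) auto
  qed
next
  fix K assume h: "\<forall>U\<in>K. nbhd_open S R U"
  show "nbhd_open S R (\<Union>K)"
    unfolding nbhd_open_def
  proof (intro conjI ballI)
    show "\<Union>K \<subseteq> S" using h by (auto simp: nbhd_open_def)
  next
    fix u assume "u \<in> \<Union>K"
    then obtain U where U: "U \<in> K" "u \<in> U" by blast
    have "nbhd_open S R U" using h U(1) by blast
    then obtain e where "e > 0" "\<forall>d. 0 < d \<and> d \<le> e \<longrightarrow> (\<forall>w \<in> S. R u w d \<longrightarrow> w \<in> U)"
      using U(2) unfolding nbhd_open_def by blast
    then show "\<exists>e > 0. \<forall>d. 0 < d \<and> d \<le> e \<longrightarrow> (\<forall>w \<in> S. R u w d \<longrightarrow> w \<in> \<Union>K)"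
      using U by blast
  qed
qed

definition nbhd_topology :: "'p set \<Rightarrow> ('p \<Rightarrow> 'p \<Rightarrow> real \<Rightarrow> bool) \<Rightarrow> 'p topology" where
  "nbhd_topology S R = topology (nbhd_open S R)"

lemma openin_nbhd_topology: "openin (nbhd_topology S R) = nbhd_open S R"
  unfolding nbhd_topology_def by (rule topology_inverse'[OF istopology_nbhd_open])

text \<open>F(G,g,I) as a topological space: the disjoint union over x in [1,g] of the
  piecewise Euclidean complexes WFact(G,x,I) with their intrinsic (pseudo)metric topology.\<close>
definition Ftop :: "('a, 'b) monoid_scheme \<Rightarrow> 'a set \<Rightarrow> 'a \<Rightarrow> (real \<Rightarrow> 'a) topology" where
  "Ftop G X g = nbhd_topology (Fset G X g) (\<lambda>u w e. wf_near G X (rho G u) u w e)"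

definition is_chain :: "('a, 'b) monoid_scheme \<Rightarrow> 'a set \<Rightarrow> 'a \<Rightarrow> 'a set \<Rightarrow> bool" where
  "is_chain G X h C \<longleftrightarrow> C \<subseteq> intv G X h \<and> (\<forall>a \<in> C. \<forall>b \<in> C. pref G X a b \<or> pref G X b a)"

definition maxchain :: "('a, 'b) monoid_scheme \<Rightarrow> 'a set \<Rightarrow> 'a \<Rightarrow> 'a list \<Rightarrow> bool" where
  "maxchain G X h c \<longleftrightarrow> sorted_wrt (\<lambda>a b. pref G X a b \<and> a \<noteq> b) c \<and> is_chain G X h (set c) \<and>
     (\<forall>C. is_chain G X h C \<and> set c \<subseteq> C \<longrightarrow> C = set c)"

text \<open>Points of the geometric realization: barycentric weights supported on a finite
  nonempty chain of [1,h].\<close>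
definition opoints :: "('a, 'b) monoid_scheme \<Rightarrow> 'a set \<Rightarrow> 'a \<Rightarrow> ('a \<Rightarrow> real) set" where
  "opoints G X h = {p. finite {z. p z \<noteq> 0} \<and> (\<forall>z. 0 \<le> p z) \<and> sum p {z. p z \<noteq> 0} = 1 \<and>
      is_chain G X h {z. p z \<noteq> 0}}"

text \<open>Orthoscheme coordinates (y_1,...,y_n) of p in the maximal simplex of the chain
  c = [x_0,...,x_n]: vertex x_i is the point whose last i coordinates are 1.\<close>
definition orth_coord :: "'a list \<Rightarrow> ('a \<Rightarrow> real) \<Rightarrow> real list" where
  "orth_coord c p = (let n = length c - 1 in
      map (\<lambda>j. \<Sum>i \<in> {n + 1 - j..n}. p (c ! i)) [1..<n + 1])"

definition ostep :: "('a, 'b) monoid_scheme \<Rightarrow> 'a set \<Rightarrow> 'a \<Rightarrow> ('a \<Rightarrow> real) \<Rightarrow> ('a \<Rightarrow> real) \<Rightarrow> real \<Rightarrow> bool" where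
  "ostep G X h p q d \<longleftrightarrow> (\<exists>c. maxchain G X h c \<and> {z. p z \<noteq> 0} \<subseteq> set c \<and> {z. q z \<noteq> 0} \<subseteq> set c \<and>
      d = ldist (orth_coord c p) (orth_coord c q))"

definition o_near :: "('a, 'b) monoid_scheme \<Rightarrow> 'a set \<Rightarrow> 'a \<Rightarrow> ('a \<Rightarrow> real) \<Rightarrow> ('a \<Rightarrow> real) \<Rightarrow> real \<Rightarrow> bool" where
  "o_near G X h p q e \<longleftrightarrow> (\<exists>ps ds. ps \<noteq> [] \<and> hd ps = p \<and> last ps = q \<and> length ds = length ps - 1 \<and>
      (\<forall>i < length ds. ostep G X h (ps ! i) (ps ! Suc i) (ds ! i)) \<and> sum_list ds < e)"

definition Otop :: "('a, 'b) monoid_scheme \<Rightarrow> 'a set \<Rightarrow> 'a \<Rightarrow> ('a \<Rightarrow> real) topology" where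
  "Otop G X h = nbhd_topology (opoints G X h) (o_near G X h)"

definition upset :: "('a, 'b) monoid_scheme \<Rightarrow> 'a set \<Rightarrow> 'a \<Rightarrow> (real \<Rightarrow> 'a) \<Rightarrow> (real \<Rightarrow> 'a) set" where
  "upset G X g v = {u \<in> Fset G X g. subwf G X v u}"

definition maximals :: "('a, 'b) monoid_scheme \<Rightarrow> 'a set \<Rightarrow> (real \<Rightarrow> 'a) set \<Rightarrow> (real \<Rightarrow> 'a) set" where
  "maximals G X A = {u \<in> A. \<forall>w \<in> A. subwf G X u w \<longrightarrow> w = u}"

definition topposet_iso :: "'p topology \<Rightarrow> ('p \<Rightarrow> 'p \<Rightarrow> bool) \<Rightarrow> 'q topology \<Rightarrow> ('q \<Rightarrow> 'q \<Rightarrow> bool) \<Rightarrow> ('p \<Rightarrow> 'q) \<Rightarrow> bool" where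
  "topposet_iso S le1 T le2 f \<longleftrightarrow> homeomorphic_map S T f \<and>
     (\<forall>a \<in> topspace S. \<forall>b \<in> topspace S. le1 a b \<longleftrightarrow> le2 (f a) (f b))"

end

theory Submission
  imports Defs
begin

text \<open>
  A weighted factorization \<open>u\<close> is encoded by its partial products \<open>U(r)\<close>, the product of the
  \<open>u(s)\<close> with \<open>s \<le> r\<close>; this is a step function increasing along a chain of \<open>[1, g]\<close>. The measure
  of the set where two such step functions differ is a metric, and it induces the topology of
  \<open>F(G, g, I)\<close>: within one closed cell it is comparable to the Euclidean distance of the
  orthoscheme coordinates, and a step function close enough to \<open>U\<close> takes all values of \<open>U\<close>, hence
  lies in a common closed cell with \<open>u\<close>.

  If \<open>v \<subseteq> u\<close>, pulling the factors of \<open>v\<close> out of the product \<open>\<rho>(u)\<close> to the left conjugates the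
  complementary factors \<open>v(r)\<inverse> u(r)\<close>. The conjugates form a weighted factorization with partial
  products \<open>h\<inverse> U(r) V(r)\<inverse> h\<close>, which for different \<open>u\<close> agree exactly where the \<open>U\<close> agree; so the
  bijection from the upper set of \<open>v\<close> to \<open>F(G, h', I)\<close> is an isometry. It preserves the order
  because conjugation preserves lengths.

  The maximal elements of \<open>F(G, h', I)\<close> are the factorizations of \<open>h'\<close> itself. Giving each
  \<open>z \<in> [1, h']\<close> the measure of the level set \<open>U = z\<close> in \<open>[0, 1)\<close> as barycentric weight maps them
  onto the order complex.
\<close>

subsection \<open>Topologies generated by proximity relations\<close>

text \<open>The bijection does not respect closed cells. When a factor of \<open>u\<close> moves
  past a point where \<open>v\<close> is nontrivial, it is conjugated by the factor of
  \<open>v\<close>, and \<open>u\<close> passes through a common face into another cell, while the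
  corresponding factor in F(G, h', I) keeps its label. A cell of the target may thus be cut into
  pieces, so the topology is first described without cells. Moreover, [1, g] may be infinite, and
  neither local finiteness nor compactness is available. What replaces them is that the length
  bounds every chain, so that the estimates have factors in \<open>len x\<close> only. From strings
  of cells to the metric they are global, since distances add up along a string. Elsewhere they are
  local, with a radius that depends on how long the finitely many values of the step function at the
  centre are held; this is enough because openness is tested point by point. Lengths are handled by
  one recurring argument: the length of a product is at most the sum of the lengths of its factors,
  so if the total is attained, every intermediate estimate is an equality.\<close>

lemma topspace_nbhd_topology [simp]: "topspace (nbhd_topology S R) = S"
proof -
  have "openin (nbhd_topology S R) S"
    unfolding openin_nbhd_topology nbhd_open_def by (auto intro: exI[of _ 1])
  moreover have "U \<subseteq> S" if "openin (nbhd_topology S R) U" for U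
    using that unfolding openin_nbhd_topology nbhd_open_def by blast
  ultimately show ?thesis unfolding topspace_def by blast
qed

lemma nbhd_openE:
  assumes "nbhd_open S R U" "a \<in> U"
  obtains e where "e > 0" "\<forall>b\<in>S. R a b e \<longrightarrow> b \<in> U"
  using assms unfolding nbhd_open_def by (meson order_refl)

text \<open>Openness is tested at each point separately, so it suffices to compare the two relations
  around one centre \<open>a\<close>, with a radius that may depend on \<open>a\<close>. This form
  covers the string relations \<open>wf_near\<close> and \<open>o_near\<close> as well as
  metrics.\<close>

lemma homeomorphic_map_nbhd_topology:
  assumes bij: "bij_betw F S T"
    and R_mono: "\<And>a b d e. R a b d \<Longrightarrow> d \<le> e \<Longrightarrow> R a b e"
    and Q_mono: "\<And>a b d e. Q a b d \<Longrightarrow> d \<le> e \<Longrightarrow> Q a b e"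
    and RQ: "\<And>a e. a \<in> S \<Longrightarrow> 0 < e \<Longrightarrow> \<exists>d>0. \<forall>b\<in>S. R a b d \<longrightarrow> Q (F a) (F b) e"
    and QR: "\<And>a e. a \<in> S \<Longrightarrow> 0 < e \<Longrightarrow> \<exists>d>0. \<forall>b\<in>S. Q (F a) (F b) d \<longrightarrow> R a b e"
  shows "homeomorphic_map (nbhd_topology S R) (nbhd_topology T Q) F"
proof -
  have inj: "inj_on F S" and im: "F ` S = T"
    using bij by (auto simp: bij_betw_def)
  have *: "nbhd_open S R U \<longleftrightarrow> nbhd_open T Q (F ` U)" if US: "U \<subseteq> S" for U
  proof
    assume h: "nbhd_open S R U"
    show "nbhd_open T Q (F ` U)"
      unfolding nbhd_open_def
    proof (intro conjI ballI)
      show "F ` U \<subseteq> T" using that im by blast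
    next
      fix q assume "q \<in> F ` U"
      then obtain a where a: "a \<in> U" "q = F a" by blast
      obtain e where e: "e > 0" "\<forall>b\<in>S. R a b e \<longrightarrow> b \<in> U"
        using h a(1) by (rule nbhd_openE)
      obtain d where d: "d > 0" "\<forall>b\<in>S. Q (F a) (F b) d \<longrightarrow> R a b e"
        using QR[OF _ e(1), of a] a(1) US by blast
      show "\<exists>e>0. \<forall>d. 0 < d \<and> d \<le> e \<longrightarrow> (\<forall>w\<in>T. Q q w d \<longrightarrow> w \<in> F ` U)"
      proof (intro exI conjI allI impI ballI)
        show "d > 0" by fact
      next
        fix d' w assume d': "0 < d' \<and> d' \<le> d" and w: "w \<in> T" "Q q w d'"
        from w(1) im obtain b where b: "b \<in> S" "w = F b" by blast
        have "Q (F a) (F b) d" using Q_mono[of q w d' d] w(2) a(2) b(2) d' by simp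
        then show "w \<in> F ` U" using b d e by blast
      qed
    qed
  next
    assume h: "nbhd_open T Q (F ` U)"
    show "nbhd_open S R U"
      unfolding nbhd_open_def
    proof (intro conjI ballI)
      show "U \<subseteq> S" by fact
    next
      fix a assume a: "a \<in> U"
      obtain e where e: "e > 0" "\<forall>w\<in>T. Q (F a) w e \<longrightarrow> w \<in> F ` U"
        using h imageI[OF a] by (rule nbhd_openE)
      obtain d where d: "d > 0" "\<forall>b\<in>S. R a b d \<longrightarrow> Q (F a) (F b) e"
        using RQ[OF _ e(1), of a] a US by blast
      show "\<exists>e>0. \<forall>d. 0 < d \<and> d \<le> e \<longrightarrow> (\<forall>w\<in>S. R a w d \<longrightarrow> w \<in> U)"
      proof (intro exI conjI allI impI ballI)
        show "d > 0" by fact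
      next
        fix d' b assume d': "0 < d' \<and> d' \<le> d" and b: "b \<in> S" "R a b d'"
        have "Q (F a) (F b) e" using R_mono[of a b d' d] b d' d by simp
        moreover have "F b \<in> T" using b im by blast
        ultimately have "F b \<in> F ` U" using e by blast
        then show "b \<in> U" using inj b(1) that by (auto dest: inj_onD)
      qed
    qed
  qed
  show ?thesis
  proof (rule bijective_open_imp_homeomorphic_map)
    show "continuous_map (nbhd_topology S R) (nbhd_topology T Q) F"
      unfolding continuous_map_def topspace_nbhd_topology openin_nbhd_topology
    proof (intro conjI allI impI)
      fix V assume V: "nbhd_open T Q V"
      then have "F ` {x \<in> S. F x \<in> V} = V" using im unfolding nbhd_open_def by blast
      then show "nbhd_open S R {x \<in> S. F x \<in> V}" using V by (subst *) auto
    qed (use im in auto)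
    show "open_map (nbhd_topology S R) (nbhd_topology T Q) F"
      unfolding open_map_def openin_nbhd_topology using * by (auto simp: nbhd_open_def[of S R])
  qed (use im inj in auto)
qed

text \<open>The triangle inequality makes a union of balls open in \<open>S\<close>, which is how a
  relatively open subset of \<open>A\<close> is extended.\<close>

lemma subtopology_nbhd_topology_metric:
  fixes D :: "'p \<Rightarrow> 'p \<Rightarrow> real"
  assumes AS: "A \<subseteq> S"
    and refl: "\<And>a. a \<in> S \<Longrightarrow> D a a = 0"
    and tri: "\<And>a b c. a \<in> S \<Longrightarrow> b \<in> S \<Longrightarrow> c \<in> S \<Longrightarrow> D a c \<le> D a b + D b c"
  shows "subtopology (nbhd_topology S (\<lambda>a b e. D a b < e)) A = nbhd_topology A (\<lambda>a b e. D a b < e)"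
    (is "subtopology ?TS A = ?TA")
  unfolding topology_eq
proof (intro allI iffI)
  fix U assume "openin (subtopology ?TS A) U"
  then obtain T where T: "nbhd_open S (\<lambda>a b e. D a b < e) T" "U = T \<inter> A"
    unfolding openin_subtopology openin_nbhd_topology by blast
  show "openin ?TA U"
    unfolding openin_nbhd_topology nbhd_open_def
  proof (intro conjI ballI)
    fix u assume "u \<in> U"
    then obtain e where "e > 0" "\<forall>d. 0 < d \<and> d \<le> e \<longrightarrow> (\<forall>w \<in> S. D u w < d \<longrightarrow> w \<in> T)"
      using T unfolding nbhd_open_def by blast
    then show "\<exists>e>0. \<forall>d. 0 < d \<and> d \<le> e \<longrightarrow> (\<forall>w\<in>A. D u w < d \<longrightarrow> w \<in> U)"
      using T AS by blast
  qed (use T in blast)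
next
  fix U assume U: "openin ?TA U"
  then have UA: "U \<subseteq> A" unfolding openin_nbhd_topology nbhd_open_def by blast
  have "\<forall>u\<in>U. \<exists>e>0. \<forall>w\<in>A. D u w < e \<longrightarrow> w \<in> U"
    using U unfolding openin_nbhd_topology by (meson nbhd_openE)
  then obtain e where e: "\<And>u. u \<in> U \<Longrightarrow> e u > 0" "\<And>u w. u \<in> U \<Longrightarrow> w \<in> A \<Longrightarrow> D u w < e u \<Longrightarrow> w \<in> U"
    by metis
  \<comment> \<open>The radii come from openness in \<open>A\<close>, but the balls are taken in
    \<open>S\<close>.\<close>
  define T where "T = {w \<in> S. \<exists>u\<in>U. D u w < e u}"
  have "openin ?TS T"
    unfolding openin_nbhd_topology nbhd_open_def
  proof (intro conjI ballI)
    fix w assume "w \<in> T"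
    then obtain u where u: "w \<in> S" "u \<in> U" "D u w < e u" unfolding T_def by blast
    have "b \<in> T" if "b \<in> S" "D w b < e u - D u w" for b
    proof -
      have "D u b < e u" using tri[of u w b] u that UA AS by auto
      then show ?thesis using that(1) u(2) unfolding T_def by blast
    qed
    then show "\<exists>e>0. \<forall>d. 0 < d \<and> d \<le> e \<longrightarrow> (\<forall>b\<in>S. D w b < d \<longrightarrow> b \<in> T)"
      using u(3) by (intro exI[of _ "e u - D u w"]) auto
  qed (auto simp: T_def)
  moreover have "U = T \<inter> A"
  proof
    show "U \<subseteq> T \<inter> A"
    proof
      fix u assume u: "u \<in> U"
      then have "D u u < e u" using e(1)[OF u] refl[of u] UA AS by auto
      then show "u \<in> T \<inter> A" using u UA AS unfolding T_def by blast
    qed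
    show "T \<inter> A \<subseteq> U" using e(2) unfolding T_def by blast
  qed
  ultimately show "openin (subtopology ?TS A) U"
    unfolding openin_subtopology by blast
qed

subsection \<open>Length and prefix order\<close>

locale conj_closed_group = group G for G :: "('a, 'b) monoid_scheme" (structure) +
  fixes X :: "'a set"
  assumes X_carrier: "X \<subseteq> carrier G"
    and X_conj: "x \<in> X \<Longrightarrow> a \<in> carrier G \<Longrightarrow> a \<otimes> x \<otimes> inv a \<in> X"
begin

abbreviation M :: "'a set" where "M \<equiv> Mon G X"
abbreviation len :: "'a \<Rightarrow> nat" where "len \<equiv> wlen G X"
abbreviation le :: "'a \<Rightarrow> 'a \<Rightarrow> bool" (infix \<open>\<preceq>\<close> 50) where "le \<equiv> pref G X"

lemma lprod_Nil [simp]: "lprod G [] = \<one>"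
  and lprod_Cons [simp]: "lprod G (x # xs) = x \<otimes> lprod G xs"
  by (auto simp: lprod_def)

lemma lprod_closed [simp, intro]: "set xs \<subseteq> carrier G \<Longrightarrow> lprod G xs \<in> carrier G"
  by (induction xs) auto

lemma lprod_append: "set xs \<subseteq> carrier G \<Longrightarrow> set ys \<subseteq> carrier G \<Longrightarrow> lprod G (xs @ ys) = lprod G xs \<otimes> lprod G ys"
  by (induction xs) (auto simp: m_assoc)

lemma mult_inv_cancel [simp]:
  assumes "a \<in> carrier G" "x \<in> carrier G"
  shows "a \<otimes> (inv a \<otimes> x) = x" "inv a \<otimes> (a \<otimes> x) = x"
  using assms by (simp_all add: m_assoc[symmetric])

lemma lprod_conj:
  assumes "a \<in> carrier G" "set xs \<subseteq> carrier G"
  shows "lprod G (map (\<lambda>x. a \<otimes> x \<otimes> inv a) xs) = a \<otimes> lprod G xs \<otimes> inv a"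
  using assms(2)
proof (induction xs)
  case Nil then show ?case using assms(1) by simp
next
  case (Cons x xs)
  then show ?case using assms(1) by (simp add: m_assoc)
qed

lemma M_carrier: "x \<in> M \<Longrightarrow> x \<in> carrier G"
  using X_carrier by (auto simp: Mon_def)

lemma M_subset [intro]: "M \<subseteq> carrier G"
  using M_carrier by blast

lemma M_one [simp, intro]: "\<one> \<in> M"
  unfolding Mon_def by (auto intro!: exI[of _ "[]"])

lemma M_mult [intro]: "x \<in> M \<Longrightarrow> y \<in> M \<Longrightarrow> x \<otimes> y \<in> M"
proof -
  assume "x \<in> M" "y \<in> M"
  then obtain xs ys where xs: "set xs \<subseteq> X" "x = lprod G xs" and ys: "set ys \<subseteq> X" "y = lprod G ys"
    unfolding Mon_def by blast
  have "x \<otimes> y = lprod G (xs @ ys)" "set (xs @ ys) \<subseteq> X"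
    using xs ys X_carrier lprod_append[of xs ys] by auto
  then show "x \<otimes> y \<in> M" unfolding Mon_def by blast
qed

lemma M_lprod [intro]: "set xs \<subseteq> M \<Longrightarrow> lprod G xs \<in> M"
  by (induction xs) auto

lemma len_le: "set xs \<subseteq> X \<Longrightarrow> len (lprod G xs) \<le> length xs"
  unfolding wlen_def by (rule Least_le) blast

lemma len_witness:
  assumes "x \<in> M"
  obtains xs where "set xs \<subseteq> X" "length xs = len x" "lprod G xs = x"
proof -
  have "\<exists>n xs. set xs \<subseteq> X \<and> length xs = n \<and> lprod G xs = x"
    using assms unfolding Mon_def by blast
  then have "\<exists>xs. set xs \<subseteq> X \<and> length xs = len x \<and> lprod G xs = x"
    unfolding wlen_def by (rule LeastI_ex)
  then show thesis using that by blast
qed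

lemma len_one [simp]: "len \<one> = 0"
  using len_le[of "[]"] by simp

lemma len_eq_0_iff: "x \<in> M \<Longrightarrow> len x = 0 \<longleftrightarrow> x = \<one>"
  by (metis len_one len_witness length_0_conv lprod_Nil)

lemma len_mult_le:
  assumes "x \<in> M" "y \<in> M"
  shows "len (x \<otimes> y) \<le> len x + len y"
proof -
  obtain xs where "set xs \<subseteq> X" "length xs = len x" "lprod G xs = x"
    using assms(1) by (rule len_witness)
  moreover obtain ys where "set ys \<subseteq> X" "length ys = len y" "lprod G ys = y"
    using assms(2) by (rule len_witness)
  ultimately show ?thesis
    using len_le[of "xs @ ys"] X_carrier lprod_append[of xs ys] by simp
qed

text \<open>A shortest word is conjugated letter by letter. Conjugating back turns the inequality
  into the equality \<open>len_conj\<close>.\<close>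

lemma M_conj_len:
  assumes "a \<in> carrier G" "x \<in> M"
  shows "a \<otimes> x \<otimes> inv a \<in> M \<and> len (a \<otimes> x \<otimes> inv a) \<le> len x"
proof -
  obtain xs where xs: "set xs \<subseteq> X" "length xs = len x" "lprod G xs = x"
    using assms(2) by (rule len_witness)
  let ?ys = "map (\<lambda>x. a \<otimes> x \<otimes> inv a) xs"
  have "set ?ys \<subseteq> X" using xs(1) X_conj assms(1) by auto
  moreover have "lprod G ?ys = a \<otimes> x \<otimes> inv a"
    using lprod_conj[of a xs] xs X_carrier assms(1) by auto
  ultimately show ?thesis
    using len_le[of ?ys] xs(2) unfolding Mon_def by (metis (mono_tags, lifting) length_map mem_Collect_eq)
qed

lemma M_conj: "a \<in> carrier G \<Longrightarrow> x \<in> M \<Longrightarrow> a \<otimes> x \<otimes> inv a \<in> M"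
  using M_conj_len by blast

lemma inv_conj:
  assumes "a \<in> carrier G" "x \<in> carrier G"
  shows "inv a \<otimes> (a \<otimes> x \<otimes> inv a) \<otimes> inv (inv a) = x"
  using assms by (simp add: m_assoc)

lemma len_conj:
  assumes "a \<in> carrier G" "x \<in> M"
  shows "len (a \<otimes> x \<otimes> inv a) = len x"
proof (rule antisym)
  show "len x \<le> len (a \<otimes> x \<otimes> inv a)"
    using M_conj_len[of "inv a" "a \<otimes> x \<otimes> inv a"] M_conj[of a x] assms inv_conj[of a x] M_carrier
    by simp
qed (use M_conj_len assms in blast)

text \<open>In a group the complement of \<open>x\<close> in \<open>y\<close> can only be
  \<open>inv x \<otimes> y\<close>; naming it removes the existential quantifier.\<close>

lemma pref_iff:
  "x \<preceq> y \<longleftrightarrow> x \<in> M \<and> y \<in> M \<and> inv x \<otimes> y \<in> M \<and> len x + len (inv x \<otimes> y) = len y"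
proof
  assume "x \<preceq> y"
  then obtain x' where "x \<in> M" "y \<in> M" "x' \<in> M" "x \<otimes> x' = y" "len x + len x' = len y"
    unfolding pref_def by blast
  moreover from this have "inv x \<otimes> y = x'"
    using M_carrier mult_inv_cancel(2) by metis
  ultimately show "x \<in> M \<and> y \<in> M \<and> inv x \<otimes> y \<in> M \<and> len x + len (inv x \<otimes> y) = len y" by simp
next
  assume h: "x \<in> M \<and> y \<in> M \<and> inv x \<otimes> y \<in> M \<and> len x + len (inv x \<otimes> y) = len y"
  then have "x \<otimes> (inv x \<otimes> y) = y"
    using M_carrier by simp
  with h show "x \<preceq> y" unfolding pref_def by blast
qed

lemma prefI: "x \<in> M \<Longrightarrow> x' \<in> M \<Longrightarrow> len x + len x' \<le> len (x \<otimes> x') \<Longrightarrow> x \<preceq> x \<otimes> x'"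
  unfolding pref_def using len_mult_le[of x x'] M_mult by (metis le_antisym)

lemma prefD_M: "x \<preceq> y \<Longrightarrow> x \<in> M" "x \<preceq> y \<Longrightarrow> y \<in> M"
  by (auto simp: pref_def)

lemma pref_refl: "x \<in> M \<Longrightarrow> x \<preceq> x"
  using M_carrier by (auto simp: pref_iff)

lemma one_pref: "x \<in> M \<Longrightarrow> \<one> \<preceq> x"
  using M_carrier by (auto simp: pref_iff)

lemma pref_len: "x \<preceq> y \<Longrightarrow> len x \<le> len y"
  by (auto simp: pref_iff)

text \<open>The complement has length 0, hence is \<open>\<one>\<close>. This serves as antisymmetry
  throughout.\<close>

lemma pref_len_eq: "x \<preceq> y \<Longrightarrow> len y \<le> len x \<Longrightarrow> x = y"
  unfolding pref_def by (metis M_carrier add_le_same_cancel1 le_zero_eq len_eq_0_iff r_one)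

lemma pref_conj:
  assumes "a \<in> carrier G" "x \<preceq> y"
  shows "a \<otimes> x \<otimes> inv a \<preceq> a \<otimes> y \<otimes> inv a"
proof -
  obtain b where b: "b \<in> M" "x \<otimes> b = y" "len x + len b = len y"
    using assms unfolding pref_def by blast
  have x: "x \<in> M" "x \<in> carrier G" "b \<in> carrier G" using assms b prefD_M M_carrier by blast+
  have *: "(a \<otimes> x \<otimes> inv a) \<otimes> (a \<otimes> b \<otimes> inv a) = a \<otimes> y \<otimes> inv a"
    using assms(1) x b(2)[symmetric] by (simp add: m_assoc)
  have "y \<in> M" using assms prefD_M by blast
  then show ?thesis
    using prefI[of "a \<otimes> x \<otimes> inv a" "a \<otimes> b \<otimes> inv a"] M_conj x b assms(1)
    unfolding * by (simp add: len_conj)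
qed

lemma pref_conj_iff:
  assumes "a \<in> carrier G" "x \<in> carrier G" "y \<in> carrier G"
  shows "a \<otimes> x \<otimes> inv a \<preceq> a \<otimes> y \<otimes> inv a \<longleftrightarrow> x \<preceq> y"
  using pref_conj[of a x y] pref_conj[of "inv a" "a \<otimes> x \<otimes> inv a" "a \<otimes> y \<otimes> inv a"] assms inv_conj
  by auto

end

subsection \<open>Ordered products\<close>

lemma sorted_list_of_set_Un:
  fixes S T :: "'l::linorder set"
  assumes "finite S" "finite T" "\<And>s t. s \<in> S \<Longrightarrow> t \<in> T \<Longrightarrow> s < t"
  shows "sorted_list_of_set (S \<union> T) = sorted_list_of_set S @ sorted_list_of_set T"
proof -
  let ?l = "sorted_list_of_set S @ sorted_list_of_set T"
  have "sorted ?l" "distinct ?l"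
    using assms by (auto simp: sorted_append intro: less_imp_le)
  moreover have "set ?l = S \<union> T" using assms by auto
  ultimately show ?thesis
    using sorted_list_of_set.idem_if_sorted_distinct[of ?l] by metis
qed

lemma finite_gap_left:
  fixes r :: real
  assumes "finite A" obtains q where "q < r" "A \<inter> {q<..<r} = {}"
proof
  let ?q = "Max (insert (r - 1) (A \<inter> {..<r}))"
  show "?q < r" using assms by (subst Max_less_iff) auto
  show "A \<inter> {?q<..<r} = {}"
  proof (rule ccontr)
    assume "A \<inter> {?q<..<r} \<noteq> {}"
    then obtain a where a: "a \<in> A" "?q < a" "a < r" by auto
    then have "a \<le> ?q" using assms by (intro Max_ge) auto
    with a show False by simp
  qed
qed

lemma finite_gap_right:
  fixes r :: real
  assumes "finite A" obtains q where "r < q" "A \<inter> {r<..<q} = {}"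
proof
  let ?q = "Min (insert (r + 1) (A \<inter> {r<..}))"
  show "r < ?q" using assms by (subst Min_gr_iff) auto
  show "A \<inter> {r<..<?q} = {}"
  proof (rule ccontr)
    assume "A \<inter> {r<..<?q} \<noteq> {}"
    then obtain a where a: "a \<in> A" "a < ?q" "r < a" by auto
    then have "?q \<le> a" using assms by (intro Min_le) auto
    with a show False by simp
  qed
qed

context conj_closed_group
begin

text \<open>Unlike \<open>rho\<close>, which is tied to \<open>supp\<close> and the two endpoints,
  this can be cut at any threshold. An infinite \<open>S\<close> gives
  \<open>\<one>\<close>.\<close>

definition oprod :: "(real \<Rightarrow> 'a) \<Rightarrow> real set \<Rightarrow> 'a" where
  "oprod u S = lprod G (map u (sorted_list_of_set S))"

lemma oprod_empty [simp]: "oprod u {} = \<one>"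
  by (simp add: oprod_def)

lemma oprod_closed [simp, intro]: "(\<And>r. u r \<in> carrier G) \<Longrightarrow> oprod u S \<in> carrier G"
  unfolding oprod_def by (intro lprod_closed) auto

lemma oprod_M [intro]: "(\<And>r. u r \<in> M) \<Longrightarrow> oprod u S \<in> M"
  unfolding oprod_def by (intro M_lprod) auto

lemma oprod_cong: "(\<And>r. r \<in> S \<Longrightarrow> u r = w r) \<Longrightarrow> oprod u S = oprod w S"
  unfolding oprod_def by (cases "finite S") (auto intro!: arg_cong[of _ _ "lprod G"])

lemma oprod_Un:
  assumes "\<And>r. u r \<in> carrier G" "finite S" "finite T" "\<And>s t. s \<in> S \<Longrightarrow> t \<in> T \<Longrightarrow> s < t"
  shows "oprod u (S \<union> T) = oprod u S \<otimes> oprod u T"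
  unfolding oprod_def using assms
  by (subst sorted_list_of_set_Un) (auto simp del: sorted_list_of_set.set_sorted_key_list_of_set intro!: lprod_append)

lemma oprod_singleton: "u b \<in> carrier G \<Longrightarrow> oprod u {b} = u b"
  by (simp add: oprod_def)

lemma oprod_insert_max:
  assumes "\<And>r. u r \<in> carrier G" "finite S" "\<And>s. s \<in> S \<Longrightarrow> s < b"
  shows "oprod u (insert b S) = oprod u S \<otimes> u b"
  using oprod_Un[of u S "{b}"] assms by (simp add: oprod_singleton)

text \<open>The largest element of \<open>T\<close> is either the last factor of both products or
  contributes \<open>\<one>\<close>. Thus products of different functions can be taken over a common
  index set.\<close>

lemma oprod_neutral:
  assumes u: "\<And>r. u r \<in> carrier G" and "finite T" "S \<subseteq> T" "\<And>r. r \<in> T - S \<Longrightarrow> u r = \<one>"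
  shows "oprod u S = oprod u T"
  using assms(2-)
proof (induction T arbitrary: S rule: finite_linorder_max_induct)
  case empty then show ?case by simp
next
  case (insert b T)
  show ?case
  proof (cases "b \<in> S")
    case True
    define S' where "S' = S - {b}"
    have S': "S = insert b S'" "S' \<subseteq> T" "finite S'"
      using True insert S'_def by (auto intro: finite_subset)
    have "oprod u S' = oprod u T"
      using insert.prems S' insert.hyps by (intro insert.IH) auto
    moreover have "oprod u (insert b S') = oprod u S' \<otimes> u b"
      using S' insert.hyps by (intro oprod_insert_max u) auto
    moreover have "oprod u (insert b T) = oprod u T \<otimes> u b"
      using insert.hyps by (intro oprod_insert_max u) auto
    ultimately show ?thesis using S'(1) by simp
  next
    case False
    then have "oprod u S = oprod u T"
      using insert.prems by (intro insert.IH) auto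
    then show ?thesis
      using False insert u by (auto simp: oprod_insert_max)
  qed
qed

lemma len_oprod_le:
  assumes u: "\<And>r. u r \<in> M" and "finite T"
  shows "len (oprod u T) \<le> (\<Sum>r\<in>T. len (u r))"
  using assms(2)
proof (induction T rule: finite_linorder_max_induct)
  case empty then show ?case by simp
next
  case (insert b T)
  have "oprod u (insert b T) = oprod u T \<otimes> u b"
    using insert u M_carrier by (intro oprod_insert_max) auto
  moreover have "len (oprod u T \<otimes> u b) \<le> len (oprod u T) + len (u b)"
    using u by (intro len_mult_le) auto
  ultimately show ?case using insert by (subst sum.insert) auto
qed

section \<open>Finitely supported labellings of the unit interval and their partial products\<close>

definition nontriv :: "(real \<Rightarrow> 'a) \<Rightarrow> real set" where
  "nontriv u = {r. u r \<noteq> \<one>}"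

text \<open>A weighted factorization without the condition on lengths: shifted functions have to be
  multiplied out before their lengths are known to add up.\<close>

definition labelling :: "(real \<Rightarrow> 'a) \<Rightarrow> bool" where
  "labelling u \<longleftrightarrow> (\<forall>r. u r \<in> M) \<and> finite (nontriv u) \<and> nontriv u \<subseteq> {0..1}"

text \<open>Taken at all real \<open>r\<close>: for a labelling it is \<open>\<one>\<close> before
  0, even if \<open>u 0\<close> is nontrivial, and \<open>rho G u\<close> from 1 on, so both always
  belong to its range.\<close>

definition cum :: "(real \<Rightarrow> 'a) \<Rightarrow> real \<Rightarrow> 'a" where
  "cum u r = oprod u (nontriv u \<inter> {..r})"

lemma labellingD:
  assumes "labelling u"
  shows "u r \<in> M" "u r \<in> carrier G" "finite (nontriv u)" "nontriv u \<subseteq> {0..1}"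
  using assms M_carrier by (auto simp: labelling_def)

lemma cum_eq_oprod:
  assumes "labelling u" "finite S" "nontriv u \<subseteq> S"
  shows "cum u r = oprod u (S \<inter> {..r})"
  unfolding cum_def using assms by (intro oprod_neutral) (auto simp: labellingD nontriv_def)

lemma cum_M: "labelling u \<Longrightarrow> cum u r \<in> M"
  unfolding cum_def by (auto simp: labellingD)

lemma cum_closed [simp]: "labelling u \<Longrightarrow> cum u r \<in> carrier G"
  using cum_M M_carrier by blast

lemma cum_neg: "labelling u \<Longrightarrow> r < 0 \<Longrightarrow> cum u r = \<one>"
proof -
  assume "labelling u" "r < 0"
  then have "nontriv u \<inter> {..r} = {}" using labellingD(4)[of u] by force
  then show "cum u r = \<one>" by (simp add: cum_def)
qed

lemma sorted_list_of_supp: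
  assumes "finite (supp G u)"
  shows "[0] @ sorted_list_of_set (supp G u) @ [1] = sorted_list_of_set ({0, 1} \<union> supp G u)"
proof -
  have "{0, 1} \<union> supp G u = {0} \<union> (supp G u \<union> {1})" by auto
  then show ?thesis
    using assms by (simp only:, subst sorted_list_of_set_Un; (subst sorted_list_of_set_Un)?)
      (auto simp: supp_def)
qed

lemma nontriv_supp:
  assumes "labelling u"
  shows "nontriv u \<subseteq> {0, 1} \<union> supp G u" "finite (supp G u)" "finite ({0, 1} \<union> supp G u)"
proof -
  show "nontriv u \<subseteq> {0, 1} \<union> supp G u"
    using labellingD(4)[OF assms] by (force simp: nontriv_def supp_def)
  show "finite (supp G u)"
    using labellingD(3)[OF assms] by (rule finite_subset[rotated]) (auto simp: nontriv_def supp_def)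
  then show "finite ({0, 1} \<union> supp G u)" by simp
qed

lemma rho_eq_oprod:
  assumes "labelling u" shows "rho G u = oprod u (nontriv u)"
proof -
  have "[u 0] @ Pl G u @ [u 1] = map u (sorted_list_of_set ({0, 1} \<union> supp G u))"
    unfolding Pl_def sorted_list_of_supp[OF nontriv_supp(2)[OF assms], symmetric] by simp
  then have "rho G u = oprod u ({0, 1} \<union> supp G u)"
    unfolding rho_def oprod_def by simp
  also have "\<dots> = oprod u (nontriv u)"
    using assms nontriv_supp[OF assms] by (intro oprod_neutral[symmetric]) (auto simp: labellingD nontriv_def)
  finally show ?thesis .
qed

lemma cum_ge_one: "labelling u \<Longrightarrow> 1 \<le> r \<Longrightarrow> cum u r = rho G u"
proof -
  assume "labelling u" "1 \<le> r"
  then have "nontriv u \<inter> {..r} = nontriv u" using labellingD(4)[of u] by force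
  then show ?thesis using \<open>labelling u\<close> by (simp add: cum_def rho_eq_oprod)
qed

definition efficient :: "(real \<Rightarrow> 'a) \<Rightarrow> bool" where
  "efficient u \<longleftrightarrow> labelling u \<and> (\<Sum>r\<in>nontriv u. len (u r)) = len (rho G u)"

text \<open>The list in \<open>is_linfact\<close> enumerates
  \<open>{0, 1} \<union> supp G u\<close>; passing to \<open>nontriv u\<close> only drops endpoints
  with value \<open>\<one>\<close>, of length 0.\<close>

lemma wfact_iff: "wfact G X x u \<longleftrightarrow> efficient u \<and> rho G u = x"
proof -
  have key: "(is_linfact G X x (u 0) (Pl G u) (u 1) \<longleftrightarrow> efficient u \<and> rho G u = x) \<and> labelling u"
    if labelling: "labelling u" for u
  proof -
    let ?S = "{0, 1} \<union> supp G u"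
    note S = nontriv_supp[OF labelling]
    have l: "[u 0] @ Pl G u @ [u 1] = map u (sorted_list_of_set ?S)"
      unfolding Pl_def sorted_list_of_supp[OF S(2), symmetric] by simp
    have "len (u 0) + sum_list (map len (Pl G u)) + len (u 1) = sum_list (map len ([u 0] @ Pl G u @ [u 1]))"
      by simp
    also have "\<dots> = sum_list (map (\<lambda>r. len (u r)) (sorted_list_of_set ?S))"
      unfolding l by (simp add: o_def)
    also have "\<dots> = (\<Sum>r\<in>?S. len (u r))"
      using S(3) sum.distinct_set_conv_list[of "sorted_list_of_set ?S" "\<lambda>r. len (u r)"]
      by (simp del: sorted_list_of_set_insert_remove insert_is_Un Un_insert_left)
    also have "\<dots> = (\<Sum>r\<in>nontriv u. len (u r))"
      using S by (intro sum.mono_neutral_right) (auto simp: nontriv_def)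
    finally have len: "len (u 0) + sum_list (map len (Pl G u)) + len (u 1) = (\<Sum>r\<in>nontriv u. len (u r))" .
    have sub: "set (Pl G u) \<subseteq> M" unfolding Pl_def using labellingD(1)[OF labelling] by auto
    then have "rho G u = u 0 \<otimes> lprod G (Pl G u) \<otimes> u 1"
      unfolding rho_def using labellingD[OF labelling] M_subset
      by (simp add: lprod_append m_assoc order_trans[OF sub])
    moreover have "\<forall>y\<in>set (Pl G u). y \<noteq> \<one>" unfolding Pl_def using S(2) by (auto simp: supp_def)
    ultimately show ?thesis
      using sub labelling len by (auto simp: is_linfact_def efficient_def labellingD)
  qed
  have "labelling u" if w: "wfact G X x u"
  proof -
    have sub: "nontriv u \<subseteq> {0, 1} \<union> supp G u"
    proof
      fix r assume r: "r \<in> nontriv u"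
      then have "r \<in> {0..1}" using w unfolding wfact_def nontriv_def by blast
      then show "r \<in> {0, 1} \<union> supp G u" using r unfolding supp_def nontriv_def by force
    qed
    have "u r \<in> M" for r
    proof (cases "r \<in> nontriv u")
      case True
      moreover have "u r \<in> M" if "r \<in> supp G u"
      proof -
        have "u r \<in> set (Pl G u)" using w that unfolding Pl_def wfact_def by simp
        then show ?thesis using w by (auto simp: wfact_def is_linfact_def)
      qed
      ultimately show ?thesis using sub w by (auto simp: wfact_def is_linfact_def)
    qed (auto simp: nontriv_def)
    moreover have "finite (nontriv u)" using sub w by (auto simp: wfact_def intro: finite_subset)
    ultimately show ?thesis using sub unfolding labelling_def by (auto simp: supp_def)
  qed
  moreover have "(\<forall>r. r \<notin> {0..1} \<longrightarrow> u r = \<one>) \<and> finite (supp G u)" if "labelling u"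
    using labellingD(4)[OF that] nontriv_supp[OF that] by (auto simp: nontriv_def)
  ultimately show ?thesis
    using key unfolding wfact_def efficient_def by blast
qed

lemma efficient_labelling: "efficient u \<Longrightarrow> labelling u"
  by (simp add: efficient_def)

lemma oprod_nontriv_split:
  assumes "labelling u" "r \<le> s"
  shows "oprod u (nontriv u \<inter> {..s}) = cum u r \<otimes> oprod u (nontriv u \<inter> {r<..s})"
proof -
  have "nontriv u \<inter> {..s} = (nontriv u \<inter> {..r}) \<union> (nontriv u \<inter> {r<..s})" using assms by auto
  then show ?thesis using assms
    by (simp only: cum_def) (intro oprod_Un, auto simp: labellingD)
qed

lemma sum_nontriv_split:
  fixes F :: "real \<Rightarrow> nat"
  assumes "labelling u" "r \<le> s"
  shows "sum F (nontriv u \<inter> {..s}) = sum F (nontriv u \<inter> {..r}) + sum F (nontriv u \<inter> {r<..s})"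
proof -
  have "nontriv u \<inter> {..s} = (nontriv u \<inter> {..r}) \<union> (nontriv u \<inter> {r<..s})" using assms by auto
  then show ?thesis using assms
    by (simp only:) (intro sum.union_disjoint, auto simp: labellingD)
qed

text \<open>Subadditivity bounds the lengths of the initial and the remaining product by their sums
  of factor lengths. The two bounds together are tight, so each of them is.\<close>

lemma len_cum:
  assumes "efficient u"
  shows "len (cum u r) = (\<Sum>s\<in>nontriv u \<inter> {..r}. len (u s))"
proof (rule antisym)
  note labelling = efficient_labelling[OF assms]
  \<comment> \<open>This endpoint lies beyond all nontrivial points and is at least
    \<open>r\<close>, also for \<open>r > 1\<close>.\<close>
  let ?m = "max r 1"
  show "len (cum u r) \<le> (\<Sum>s\<in>nontriv u \<inter> {..r}. len (u s))"
    unfolding cum_def using labelling by (intro len_oprod_le) (auto simp: labellingD)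
  have "nontriv u \<inter> {..?m} = nontriv u" using labellingD(4)[OF labelling] by force
  then have "(\<Sum>s\<in>nontriv u. len (u s)) = (\<Sum>s\<in>nontriv u \<inter> {..r}. len (u s)) + (\<Sum>s\<in>nontriv u \<inter> {r<..?m}. len (u s))"
    "rho G u = cum u r \<otimes> oprod u (nontriv u \<inter> {r<..?m})"
    using sum_nontriv_split[OF labelling, of r ?m "\<lambda>s. len (u s)"] oprod_nontriv_split[OF labelling, of r ?m] labelling
    by (auto simp: rho_eq_oprod)
  moreover have "len (oprod u (nontriv u \<inter> {r<..?m})) \<le> (\<Sum>s\<in>nontriv u \<inter> {r<..?m}. len (u s))"
    using labelling by (intro len_oprod_le) (auto simp: labellingD)
  moreover have "len (cum u r \<otimes> oprod u (nontriv u \<inter> {r<..?m})) \<le> len (cum u r) + len (oprod u (nontriv u \<inter> {r<..?m}))"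
    using labelling by (intro len_mult_le) (auto simp: labellingD cum_M)
  ultimately show "(\<Sum>s\<in>nontriv u \<inter> {..r}. len (u s)) \<le> len (cum u r)"
    using assms unfolding efficient_def by simp
qed

lemma cum_mono:
  assumes "efficient u" "r \<le> s" shows "cum u r \<preceq> cum u s"
proof -
  note labelling = efficient_labelling[OF assms(1)]
  have *: "cum u s = cum u r \<otimes> oprod u (nontriv u \<inter> {r<..s})"
    using oprod_nontriv_split[OF labelling assms(2)] by (simp add: cum_def)
  have "len (oprod u (nontriv u \<inter> {r<..s})) \<le> (\<Sum>s\<in>nontriv u \<inter> {r<..s}. len (u s))"
    using labelling by (intro len_oprod_le) (auto simp: labellingD)
  then have "len (cum u r) + len (oprod u (nontriv u \<inter> {r<..s})) \<le> len (cum u s)"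
    unfolding len_cum[OF assms(1)] sum_nontriv_split[OF labelling assms(2)] by simp
  then show ?thesis
    unfolding * using labelling by (intro prefI) (auto simp: labellingD cum_M)
qed

lemma cum_pref_rho: "efficient u \<Longrightarrow> cum u r \<preceq> rho G u"
  using cum_mono[of u r "max r 1"] cum_ge_one[of u "max r 1"] efficient_labelling by auto

lemma cum_left:
  assumes "labelling u"
  obtains q where "q < r" "\<And>s. q < s \<Longrightarrow> s < r \<Longrightarrow> cum u r = cum u s \<otimes> u r"
proof -
  obtain q where q: "q < r" "nontriv u \<inter> {q<..<r} = {}"
    using finite_gap_left[OF labellingD(3)[OF assms]] by blast
  have "cum u r = cum u s \<otimes> u r" if s: "q < s" "s < r" for s
  proof -
    have "oprod u (nontriv u \<inter> {s<..r}) = oprod u {r}"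
      using q s assms by (intro oprod_neutral) (auto simp: labellingD nontriv_def)
    then show ?thesis
      using oprod_nontriv_split[of u s r] s assms by (simp add: cum_def oprod_singleton labellingD)
  qed
  then show thesis using that q by blast
qed

lemma cum_right:
  assumes "labelling u"
  obtains q where "r < q" "\<And>s. r \<le> s \<Longrightarrow> s < q \<Longrightarrow> cum u s = cum u r"
proof -
  obtain q where q: "r < q" "nontriv u \<inter> {r<..<q} = {}"
    using finite_gap_right[OF labellingD(3)[OF assms]] by blast
  have "cum u s = cum u r" if s: "r \<le> s" "s < q" for s
  proof -
    have "nontriv u \<inter> {..s} = nontriv u \<inter> {..r}" using q s by force
    then show ?thesis by (simp add: cum_def)
  qed
  then show thesis using that q by blast
qed

text \<open>The factor at \<open>r\<close> is the jump at \<open>r\<close>: by finiteness some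
  \<open>s < r\<close> has no nontrivial point of \<open>u\<close> or \<open>w\<close> strictly
  between it and \<open>r\<close>.\<close>

lemma cum_inject:
  assumes "labelling u" "labelling w" "\<And>r. cum u r = cum w r"
  shows "u = w"
proof
  fix r
  obtain q where q: "q < r" "\<And>s. q < s \<Longrightarrow> s < r \<Longrightarrow> cum u r = cum u s \<otimes> u r"
    using cum_left[OF assms(1)] by blast
  obtain p where p: "p < r" "\<And>s. p < s \<Longrightarrow> s < r \<Longrightarrow> cum w r = cum w s \<otimes> w r"
    using cum_left[OF assms(2)] by blast
  obtain s where s: "max q p < s" "s < r" using dense[of "max q p" r] q p by auto
  then have "cum u s \<otimes> u r = cum u s \<otimes> w r"
    using q(2)[of s] p(2)[of s] assms(3) by auto
  then show "u r = w r" using assms labellingD by auto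
qed

end

subsection \<open>The distance between partial products\<close>

text \<open>\<open>S \<inter> {..r}\<close> is constant between consecutive points of
  \<open>S\<close>. The predicate is arbitrary because splitting off \<open>s\<close> replaces
  \<open>Q\<close> by \<open>Q\<close> after inserting \<open>s\<close>.\<close>

lemma borel_finite_threshold:
  fixes S :: "real set"
  assumes "finite S"
  shows "{r. Q (S \<inter> {..r})} \<in> sets borel"
  using assms
proof (induction S arbitrary: Q rule: finite_induct)
  case empty then show ?case by simp
next
  case (insert s S)
  have "{r. Q (insert s S \<inter> {..r})} =
      ({s..} \<inter> {r. Q (insert s (S \<inter> {..r}))}) \<union> ({..<s} \<inter> {r. Q (S \<inter> {..r})})"
    (is "?L = ?R")
  proof (rule Set.set_eqI)
    fix r show "r \<in> ?L \<longleftrightarrow> r \<in> ?R"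
      by (cases "s \<le> r") auto
  qed
  then show ?case
    using insert.IH[of "\<lambda>T. Q (insert s T)"] insert.IH[of Q] by simp
qed

lemma measure_le_cover:
  fixes a b :: "nat \<Rightarrow> real"
  assumes "A \<in> sets borel" "A \<subseteq> (\<Union>i<n. {a i..<b i})" "\<And>i. i < n \<Longrightarrow> a i \<le> b i"
  shows "measure lborel A \<le> (\<Sum>i<n. b i - a i)"
proof -
  have fin: "(\<Union>i<n. {a i..<b i}) \<in> fmeasurable lborel"
  proof (intro fmeasurable.finite_UN)
    show "{a i..<b i} \<in> fmeasurable lborel" for i
      using emeasure_bounded_finite[of "{a i..<b i}"] by (intro fmeasurableI) auto
  qed auto
  have "measure lborel A \<le> measure lborel (\<Union>i<n. {a i..<b i})"
    using assms fin by (intro measure_mono_fmeasurable) auto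
  also have "\<dots> \<le> (\<Sum>i<n. measure lborel {a i..<b i})"
    by (intro measure_UNION_le) auto
  also have "\<dots> = (\<Sum>i<n. b i - a i)"
    using assms(3) by (intro sum.cong) auto
  finally show ?thesis .
qed

text \<open>\<open>a\<close> and \<open>b\<close> count the thresholds that are at most
  \<open>r\<close>; the index \<open>min a b\<close> has been passed in exactly one of the two
  families.\<close>

lemma threshold_differ:
  fixes y z :: "nat \<Rightarrow> real"
  assumes "\<And>i. i < n \<Longrightarrow> y i \<le> r \<longleftrightarrow> i < a" "\<And>i. i < n \<Longrightarrow> z i \<le> r \<longleftrightarrow> i < b"
    and "a \<le> n" "b \<le> n" "a \<noteq> b"
  shows "\<exists>i<n. min (y i) (z i) \<le> r \<and> r < max (y i) (z i)"
proof -
  have "min a b < n" using assms(3-5) by auto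
  then show ?thesis
    using assms(1,2)[of "min a b"] assms(5) by (intro exI[of _ "min a b"]) (auto simp: min_def max_def split: if_splits)
qed

lemma length_concat_replicate: "length (concat (map (\<lambda>r. replicate (m r) r) xs)) = sum_list (map m xs)"
  by (induction xs) auto

lemma nth_concat_replicate_le_iff:
  fixes r :: "'l::linorder"
  assumes "sorted xs" "i < length (concat (map (\<lambda>r. replicate (m r) r) xs))"
  shows "concat (map (\<lambda>r. replicate (m r) r) xs) ! i \<le> r \<longleftrightarrow> i < sum_list (map m (filter (\<lambda>s. s \<le> r) xs))"
  using assms
proof (induction xs arbitrary: i)
  case Nil then show ?case by simp
next
  case (Cons a xs)
  let ?ys = "concat (map (\<lambda>r. replicate (m r) r) xs)"
  show ?case
  proof (cases "a \<le> r")
    case True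
    then show ?thesis
      using Cons.IH[of "i - m a"] Cons.prems by (auto simp: nth_append)
  next
    case False
    then have "filter (\<lambda>s. s \<le> r) (a # xs) = []" using Cons.prems(1) by (auto simp: filter_empty_conv)
    moreover have "concat (map (\<lambda>r. replicate (m r) r) (a # xs)) ! i \<in> set (a # xs)"
      using nth_mem[OF Cons.prems(2)] by (auto split: if_splits)
    ultimately show ?thesis using False Cons.prems(1) by auto
  qed
qed

lemma ldist_eq_L2_set:
  assumes "length a = n" "length b = n"
  shows "ldist a b = L2_set (\<lambda>i. a ! i - b ! i) {..<n}"
  using assms unfolding ldist_def L2_set_def
  by (simp add: sum_list_sum_nth atLeast0LessThan)

lemma ldist_le_sum:
  assumes "length a = n" "length b = n"
  shows "ldist a b \<le> (\<Sum>i<n. \<bar>a ! i - b ! i\<bar>)"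
  unfolding ldist_eq_L2_set[OF assms] by (rule L2_set_le_sum_abs)

lemma abs_nth_diff_le_ldist:
  assumes "length a = n" "length b = n" "i < n"
  shows "\<bar>a ! i - b ! i\<bar> \<le> ldist a b"
  using member_le_L2_set[of "{..<n}" i "\<lambda>i. \<bar>a ! i - b ! i\<bar>"] assms(3)
  unfolding ldist_eq_L2_set[OF assms(1,2)] by (simp add: L2_set_def)

lemma ldist_nonneg: "0 \<le> ldist a b"
  unfolding ldist_def by (auto intro!: sum_list_nonneg)

context conj_closed_group
begin

text \<open>The window reaches beyond 1, where the partial products equal \<open>\<rho>\<close>, so that
  factorizations of different elements have distance at least 1.\<close>
definition cdist :: "(real \<Rightarrow> 'a) \<Rightarrow> (real \<Rightarrow> 'a) \<Rightarrow> real" where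
  "cdist u w = measure lborel {r \<in> {0..2}. cum u r \<noteq> cum w r}"

text \<open>Both partial products depend on \<open>r\<close> only through
  \<open>(nontriv u \<union> nontriv w) \<inter> {..r}\<close>.\<close>

lemma cum_sets_borel:
  assumes "labelling u" "labelling w" shows "{r. P (cum u r) (cum w r)} \<in> sets borel"
proof -
  let ?Q = "\<lambda>T. P (oprod u (nontriv u \<inter> T)) (oprod w (nontriv w \<inter> T))"
  have "nontriv u \<inter> {..r} = nontriv u \<inter> ((nontriv u \<union> nontriv w) \<inter> {..r})"
    "nontriv w \<inter> {..r} = nontriv w \<inter> ((nontriv u \<union> nontriv w) \<inter> {..r})" for r
    by auto
  then have "{r. P (cum u r) (cum w r)} = {r. ?Q ((nontriv u \<union> nontriv w) \<inter> {..r})}"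
    unfolding cum_def by simp
  then show ?thesis using borel_finite_threshold[of "nontriv u \<union> nontriv w" ?Q] assms by (simp add: labellingD)
qed

lemma cdist_set_borel: "labelling u \<Longrightarrow> labelling w \<Longrightarrow> {r \<in> {0..2}. cum u r \<noteq> cum w r} \<in> sets borel"
  using cum_sets_borel[of u w "(\<noteq>)"] by (simp add: Collect_conj_eq sets.Int flip: atLeastAtMost_def)

lemma cdist_set_fmeasurable:
  assumes "labelling u" "labelling w" shows "{r \<in> {0..2}. cum u r \<noteq> cum w r} \<in> fmeasurable lborel"
proof (rule fmeasurableI2)
  show "{0..2::real} \<in> fmeasurable lborel"
    using emeasure_bounded_finite[of "{0..2::real}"] by (intro fmeasurableI) auto
qed (use cdist_set_borel[OF assms] in auto)

lemma cdist_self [simp]: "cdist u u = 0"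
  by (simp add: cdist_def)

lemma cdist_triangle:
  assumes "labelling u" "labelling v" "labelling w" shows "cdist u w \<le> cdist u v + cdist v w"
proof -
  let ?S = "\<lambda>u w. {r \<in> {0..2}. cum u r \<noteq> cum w r}"
  have f: "?S u v \<in> fmeasurable lborel" "?S v w \<in> fmeasurable lborel" "?S u w \<in> fmeasurable lborel"
    using cdist_set_fmeasurable assms by blast+
  have "measure lborel (?S u w) \<le> measure lborel (?S u v \<union> ?S v w)"
    by (rule measure_mono_fmeasurable[OF _ fmeasurableD[OF f(3)] fmeasurable.Un[OF f(1,2)]]) auto
  also have "\<dots> \<le> cdist u v + cdist v w"
    unfolding cdist_def by (rule measure_Un_le[OF fmeasurableD[OF f(1)] fmeasurableD[OF f(2)]])
  finally show ?thesis by (simp add: cdist_def)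
qed

lemma cdist_ge:
  assumes "labelling u" "labelling w" "0 \<le> a" "b \<le> 2" "\<And>r. a \<le> r \<Longrightarrow> r < b \<Longrightarrow> cum u r \<noteq> cum w r"
  shows "b - a \<le> cdist u w"
proof (cases "a \<le> b")
  case True
  then have "b - a = measure lborel {a..<b}" by simp
  also have "\<dots> \<le> cdist u w"
    unfolding cdist_def using assms cdist_set_fmeasurable
    by (intro measure_mono_fmeasurable) auto
  finally show ?thesis .
next
  case False
  moreover have "0 \<le> cdist u w" by (simp add: cdist_def)
  ultimately show ?thesis by linarith
qed

lemma rho_eq_of_cdist_less:
  assumes "labelling u" "labelling w" "cdist u w < 1" shows "rho G u = rho G w"
proof (rule ccontr)
  assume "rho G u \<noteq> rho G w"
  then have "2 - 1 \<le> cdist u w" using assms cum_ge_one by (intro cdist_ge) auto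
  with assms show False by simp
qed

text \<open>Where the partial products differ, so do the counts of passed thresholds, and then
  \<open>r\<close> lies between \<open>y i\<close> and \<open>z i\<close> for some \<open>i\<close>.
  These intervals cover the set measured by \<open>cdist\<close>.\<close>

lemma cdist_le_thresholds:
  fixes y z :: "nat \<Rightarrow> real"
  assumes "labelling u" "labelling w"
    and "\<And>i r. i < n \<Longrightarrow> y i \<le> r \<longleftrightarrow> i < a r" "\<And>i r. i < n \<Longrightarrow> z i \<le> r \<longleftrightarrow> i < b r"
    and "\<And>r. a r \<le> n" "\<And>r. b r \<le> n"
    and "\<And>r. a r = b r \<Longrightarrow> cum u r = cum w r"
  shows "cdist u w \<le> (\<Sum>i<n. \<bar>y i - z i\<bar>)"
proof -
  have "{r \<in> {0..2}. cum u r \<noteq> cum w r} \<subseteq> (\<Union>i<n. {min (y i) (z i)..<max (y i) (z i)})"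
  proof
    fix r assume "r \<in> {r \<in> {0..2}. cum u r \<noteq> cum w r}"
    then have "a r \<noteq> b r" using assms(7) by auto
    then show "r \<in> (\<Union>i<n. {min (y i) (z i)..<max (y i) (z i)})"
      using threshold_differ[of n y r "a r" z "b r"] assms(3-6) by auto
  qed
  then have "cdist u w \<le> (\<Sum>i<n. max (y i) (z i) - min (y i) (z i))"
    unfolding cdist_def using assms(1,2) by (intro measure_le_cover cdist_set_borel) auto
  also have "\<dots> = (\<Sum>i<n. \<bar>y i - z i\<bar>)" by (intro sum.cong) auto
  finally show ?thesis .
qed

lemma threshold_diff_le_cdist:
  fixes y z :: real
  assumes "labelling u" "labelling w" "\<And>r. y \<le> r \<longleftrightarrow> P (cum u r)" "\<And>r. z \<le> r \<longleftrightarrow> P (cum w r)"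
    and "0 \<le> y" "y \<le> 2" "0 \<le> z" "z \<le> 2"
  shows "\<bar>y - z\<bar> \<le> cdist u w"
proof -
  have "max y z - min y z \<le> cdist u w"
  proof (rule cdist_ge)
    fix r assume r: "min y z \<le> r" "r < max y z"
    then have "(y \<le> r) \<noteq> (z \<le> r)" by auto
    then show "cum u r \<noteq> cum w r" using assms(3,4)[of r] by auto
  qed (use assms in auto)
  then show ?thesis by linarith
qed

text \<open>The coordinates are the times at which the length of the partial product grows: entry
  \<open>i\<close>, counted from 0, is the first \<open>r\<close> with
  \<open>len (cum u r) > i\<close>.\<close>

lemma ocoord_thresholds:
  assumes "efficient u"
  shows "length (ocoord G X u) = len (rho G u)"
    and "i < len (rho G u) \<Longrightarrow> ocoord G X u ! i \<le> r \<longleftrightarrow> i < len (cum u r)"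
proof -
  note labelling = efficient_labelling[OF assms]
  let ?S = "{0, 1} \<union> supp G u"
  let ?xs = "sorted_list_of_set ?S"
  note S = nontriv_supp[OF labelling]
  have oc: "ocoord G X u = concat (map (\<lambda>r. replicate (len (u r)) r) ?xs)"
    unfolding ocoord_def sorted_list_of_supp[OF S(2)] ..
  have sum: "sum_list (map (\<lambda>s. len (u s)) (filter P ?xs)) = (\<Sum>s\<in>nontriv u \<inter> Collect P. len (u s))" for P
  proof -
    have "sum_list (map (\<lambda>s. len (u s)) (filter P ?xs)) = (\<Sum>s\<in>set (filter P ?xs). len (u s))"
      by (intro sum.distinct_set_conv_list[symmetric] distinct_filter distinct_sorted_list_of_set)
    also have "set (filter P ?xs) = ?S \<inter> Collect P"
      using set_sorted_list_of_set[OF S(3)] by (auto simp only: set_filter)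
    also have "(\<Sum>s\<in>?S \<inter> Collect P. len (u s)) = (\<Sum>s\<in>nontriv u \<inter> Collect P. len (u s))"
      using S by (intro sum.mono_neutral_right) (auto simp: nontriv_def)
    finally show ?thesis .
  qed
  show l: "length (ocoord G X u) = len (rho G u)"
    using sum[of "\<lambda>_. True"] assms unfolding oc length_concat_replicate efficient_def by simp
  show "ocoord G X u ! i \<le> r \<longleftrightarrow> i < len (cum u r)" if "i < len (rho G u)"
    using nth_concat_replicate_le_iff[of ?xs i "\<lambda>r. len (u r)" r] that l
    unfolding oc[symmetric] sum len_cum[OF assms] by (simp add: atMost_def sorted_sorted_list_of_set)
qed

lemma ocoord_bounds:
  assumes "efficient u" "i < len (rho G u)"
  shows "0 \<le> ocoord G X u ! i" "ocoord G X u ! i \<le> 1"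
proof -
  show "ocoord G X u ! i \<le> 1"
    using ocoord_thresholds(2)[OF assms] assms cum_ge_one[of u 1] efficient_labelling by auto
  show "0 \<le> ocoord G X u ! i"
  proof (rule ccontr)
    assume "\<not> 0 \<le> ocoord G X u ! i"
    \<comment> \<open>The threshold property is applied to the entry compared with itself.\<close>
    then have "len (cum u (ocoord G X u ! i)) = 0"
      using cum_neg[OF efficient_labelling[OF assms(1)], of "ocoord G X u ! i"] by simp
    then show False
      using ocoord_thresholds(2)[OF assms, of "ocoord G X u ! i"] by simp
  qed
qed

text \<open>Between the two entries with index \<open>i\<close>, exactly one of the partial products
  has length above \<open>i\<close>, so they differ there. Each of the \<open>len x\<close> entries
  therefore contributes at most \<open>cdist u w\<close>.\<close>

lemma ldist_ocoord_le_cdist: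
  assumes "efficient u" "efficient w" "rho G u = x" "rho G w = x"
  shows "ldist (ocoord G X u) (ocoord G X w) \<le> len x * cdist u w"
proof -
  have "ldist (ocoord G X u) (ocoord G X w) \<le> (\<Sum>i<len x. \<bar>ocoord G X u ! i - ocoord G X w ! i\<bar>)"
    using assms by (intro ldist_le_sum) (auto simp: ocoord_thresholds)
  also have "\<dots> \<le> (\<Sum>i<len x. cdist u w)"
  proof (rule sum_mono)
    fix i assume "i \<in> {..<len x}"
    then have i: "i < len (rho G u)" "i < len (rho G w)" using assms by auto
    show "\<bar>ocoord G X u ! i - ocoord G X w ! i\<bar> \<le> cdist u w"
    proof (rule threshold_diff_le_cdist)
      show "ocoord G X u ! i \<le> r \<longleftrightarrow> i < len (cum u r)"
        "ocoord G X w ! i \<le> r \<longleftrightarrow> i < len (cum w r)" for r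
        using ocoord_thresholds(2) assms i by auto
    qed (use ocoord_bounds[OF assms(1) i(1)] ocoord_bounds[OF assms(2) i(2)] assms in \<open>simp_all add: efficient_labelling\<close>)
  qed
  finally show ?thesis by simp
qed

text \<open>The last premise holds within a closed cell, where all partial products belong to one
  chain and are determined by their lengths. They then differ only between corresponding
  coordinates.\<close>

lemma cdist_le_ldist_ocoord:
  assumes "efficient u" "efficient w" "rho G u = x" "rho G w = x"
    and "\<And>r. len (cum u r) = len (cum w r) \<Longrightarrow> cum u r = cum w r"
  shows "cdist u w \<le> len x * ldist (ocoord G X u) (ocoord G X w)"
proof -
  have "cdist u w \<le> (\<Sum>i<len x. \<bar>ocoord G X u ! i - ocoord G X w ! i\<bar>)"
    using assms pref_len[OF cum_pref_rho[OF assms(1)]] pref_len[OF cum_pref_rho[OF assms(2)]]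
    by (intro cdist_le_thresholds[where a = "\<lambda>r. len (cum u r)" and b = "\<lambda>r. len (cum w r)"])
      (auto simp: efficient_labelling ocoord_thresholds)
  also have "\<dots> \<le> (\<Sum>i<len x. ldist (ocoord G X u) (ocoord G X w))"
    using assms by (intro sum_mono abs_nth_diff_le_ldist) (auto simp: ocoord_thresholds)
  finally show ?thesis by simp
qed

end

subsection \<open>Cells and flags\<close>

lemma sorted_filter_le_eq_take:
  fixes r :: "'l::linorder"
  assumes "sorted (map fst ps)"
  shows "filter (\<lambda>p. fst p \<le> r) ps = take (length (filter (\<lambda>p. fst p \<le> r) ps)) ps"
  using assms
proof (induction ps)
  case (Cons p ps)
  show ?case
  proof (cases "fst p \<le> r")
    case False
    then have "filter (\<lambda>p. fst p \<le> r) (p # ps) = []" using Cons.prems by (force simp: filter_empty_conv)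
    then show ?thesis by simp
  qed (use Cons in auto)
qed simp

lemma map_filter_concat:
  "concat (map (\<lambda>i. if P i then [f i] else []) xs) = map f (filter P xs)"
  by (induction xs) auto

context conj_closed_group
begin

text \<open>A form of \<open>charpt\<close> on lists of positioned factors, which admits induction
  over the list.\<close>

definition merge_at :: "(real \<times> 'a) list \<Rightarrow> real \<Rightarrow> 'a" where
  "merge_at ps r = lprod G (map snd (filter (\<lambda>p. fst p = r) ps))"

lemma merge_at_Nil: "merge_at [] r = \<one>"
  by (simp add: merge_at_def)

lemma merge_at_Cons: "merge_at ((a, x) # ps) r = (if r = a then x \<otimes> merge_at ps r else merge_at ps r)"
  by (simp add: merge_at_def)

lemma merge_at_M: "snd ` set ps \<subseteq> M \<Longrightarrow> merge_at ps r \<in> M"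
  unfolding merge_at_def by (intro M_lprod) auto

lemma merge_at_trivial: "r \<notin> fst ` set ps \<Longrightarrow> merge_at ps r = \<one>"
proof -
  assume "r \<notin> fst ` set ps"
  then have "filter (\<lambda>p. fst p = r) ps = []" by (auto simp: filter_empty_conv)
  then show ?thesis by (simp add: merge_at_def)
qed

text \<open>By sortedness the first entry sits at the smallest position \<open>a\<close>, so its
  factor comes first in the merged factor at \<open>a\<close> and in the whole product.\<close>

lemma oprod_merge_at:
  assumes "sorted (map fst ps)" "snd ` set ps \<subseteq> M" "finite S" "fst ` set ps \<subseteq> S"
  shows "oprod (merge_at ps) S = lprod G (map snd ps)"
  using assms(1,2,4)
proof (induction ps)
  case Nil
  have "oprod (merge_at []) {} = oprod (merge_at []) S"
    using assms(3) by (intro oprod_neutral) (auto simp: merge_at_Nil)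
  then show ?case by simp
next
  case (Cons p ps)
  obtain a x where p: "p = (a, x)" by (cases p)
  define T where "T = S \<inter> {a<..}"
  have a: "a \<in> S" and x: "x \<in> carrier G" using Cons.prems p M_carrier by auto
  have cl: "merge_at qs r \<in> carrier G" if "snd ` set qs \<subseteq> M" for qs r
    using merge_at_M[OF that] M_carrier by blast
  \<comment> \<open>The position \<open>a\<close>, not the entry \<open>p\<close>, is split off,
    since later entries may also sit at \<open>a\<close>. This is used for \<open>p # ps\<close> and
    for \<open>ps\<close>.\<close>
  have split: "oprod (merge_at qs) S = merge_at qs a \<otimes> oprod (merge_at qs) T"
    if qs: "snd ` set qs \<subseteq> M" "\<And>r. r < a \<Longrightarrow> merge_at qs r = \<one>" for qs
  proof -
    have "oprod (merge_at qs) S = oprod (merge_at qs) ({a} \<union> T)"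
      using assms(3) a cl[OF qs(1)] qs(2) by (intro oprod_neutral[symmetric]) (auto simp: T_def)
    also have "\<dots> = oprod (merge_at qs) {a} \<otimes> oprod (merge_at qs) T"
      using assms(3) cl[OF qs(1)] by (intro oprod_Un) (auto simp: T_def)
    also have "oprod (merge_at qs) {a} = merge_at qs a" using cl[OF qs(1)] by (intro oprod_singleton)
    finally show ?thesis .
  qed
  have ge: "a \<le> b" if "b \<in> fst ` set ps" for b using that Cons.prems(1) p by auto
  have triv: "merge_at ps r = \<one>" "merge_at (p # ps) r = \<one>" if "r < a" for r
  proof -
    have "r \<notin> fst ` set ps" "r \<notin> fst ` set (p # ps)" using that ge[of r] p by auto
    then show "merge_at ps r = \<one>" "merge_at (p # ps) r = \<one>" by (simp_all only: merge_at_trivial not_False_eq_True)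
  qed
  have sub: "snd ` set ps \<subseteq> M" "snd ` set (p # ps) \<subseteq> M" using Cons.prems by auto
  have "oprod (merge_at (p # ps)) S = merge_at (p # ps) a \<otimes> oprod (merge_at (p # ps)) T"
    using split[OF sub(2) triv(2)] .
  also have "oprod (merge_at (p # ps)) T = oprod (merge_at ps) T"
    by (intro oprod_cong) (auto simp: p merge_at_Cons T_def)
  also have "merge_at (p # ps) a = x \<otimes> merge_at ps a" by (simp add: p merge_at_Cons)
  also have "x \<otimes> merge_at ps a \<otimes> oprod (merge_at ps) T = x \<otimes> oprod (merge_at ps) S"
    using split[OF sub(1) triv(1)] x cl[OF sub(1)] by (simp add: m_assoc)
  also have "oprod (merge_at ps) S = lprod G (map snd ps)"
    using Cons by auto
  finally show ?case by (simp add: p)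
qed

lemma sum_len_merge_at:
  assumes "snd ` set ps \<subseteq> M" "finite S"
  shows "(\<Sum>r\<in>S. len (merge_at ps r)) \<le> sum_list (map len (map snd ps))"
  using assms(1)
proof (induction ps)
  case Nil then show ?case by (simp add: merge_at_Nil)
next
  case (Cons p ps)
  obtain a x where p: "p = (a, x)" by (cases p)
  have x: "x \<in> M" "merge_at ps r \<in> M" for r using Cons.prems p merge_at_M by auto
  have "(\<Sum>r\<in>S. len (merge_at (p # ps) r)) \<le> (\<Sum>r\<in>S. (if r = a then len x else 0) + len (merge_at ps r))"
    using len_mult_le[OF x] by (intro sum_mono) (auto simp: p merge_at_Cons)
  also have "\<dots> \<le> len x + (\<Sum>r\<in>S. len (merge_at ps r))"
    using assms(2) by (simp add: sum.distrib)
  finally show ?case using Cons p by simp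
qed

lemma merge_at_properties:
  assumes "sorted (map fst ps)" "snd ` set ps \<subseteq> M" "fst ` set ps \<subseteq> {0..1}"
    and "sum_list (map len (map snd ps)) = len (lprod G (map snd ps))"
  shows "efficient (merge_at ps)" "rho G (merge_at ps) = lprod G (map snd ps)"
    and "cum (merge_at ps) r = lprod G (map snd (filter (\<lambda>p. fst p \<le> r) ps))"
proof -
  let ?S = "fst ` set ps"
  have nontriv: "nontriv (merge_at ps) \<subseteq> ?S" using merge_at_trivial by (auto simp: nontriv_def)
  then have labelling: "labelling (merge_at ps)"
    using assms merge_at_M unfolding labelling_def by (blast intro: finite_subset)
  show rho: "rho G (merge_at ps) = lprod G (map snd ps)"
  proof -
    have "oprod (merge_at ps) (nontriv (merge_at ps)) = oprod (merge_at ps) ?S"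
      using labelling nontriv by (intro oprod_neutral) (auto simp: labellingD nontriv_def)
    then show ?thesis
      using oprod_merge_at[OF assms(1,2), of ?S] rho_eq_oprod[OF labelling] by simp
  qed
  \<comment> \<open>Merging can only lower the sum of lengths, and the sum cannot fall below the
    length of the product, which the unmerged list already attains.\<close>
  have "len (rho G (merge_at ps)) \<le> (\<Sum>r\<in>nontriv (merge_at ps). len (merge_at ps r))"
    unfolding rho_eq_oprod[OF labelling] using labelling by (intro len_oprod_le) (auto simp: labellingD)
  with labelling sum_len_merge_at[OF assms(2) labellingD(3)[OF labelling]] rho assms(4) show "efficient (merge_at ps)"
    unfolding efficient_def by simp
  let ?qs = "filter (\<lambda>p. fst p \<le> r) ps"
  have "cum (merge_at ps) r = oprod (merge_at ps) (?S \<inter> {..r})"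
    using labelling nontriv by (intro cum_eq_oprod) auto
  also have "\<dots> = oprod (merge_at ?qs) (?S \<inter> {..r})"
  proof (rule oprod_cong)
    fix s assume "s \<in> ?S \<inter> {..r}"
    then have "filter (\<lambda>p. fst p = s) ps = filter (\<lambda>p. fst p = s) ?qs"
      by (auto intro!: filter_cong)
    then show "merge_at ps s = merge_at ?qs s" by (simp add: merge_at_def)
  qed
  also have "\<dots> = lprod G (map snd ?qs)"
    using assms(1,2) by (intro oprod_merge_at sorted_filter) auto
  finally show "cum (merge_at ps) r = lprod G (map snd ?qs)" .
qed

text \<open>The end factors become ordinary entries pinned at 0 and 1, so that \<open>charpt\<close>
  is an instance of \<open>merge_at\<close>.\<close>

definition positioned :: "'a \<Rightarrow> 'a list \<Rightarrow> 'a \<Rightarrow> (nat \<Rightarrow> real) \<Rightarrow> (real \<times> 'a) list" where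
  "positioned xL xs xR t = (0, xL) # map (\<lambda>i. (t i, xs ! i)) [0..<length xs] @ [(1, xR)]"

lemma positioned_props:
  assumes "simplex_param (length xs) t"
  shows "sorted (map fst (positioned xL xs xR t))" "fst ` set (positioned xL xs xR t) \<subseteq> {0..1}"
    "map snd (positioned xL xs xR t) = xL # xs @ [xR]"
proof -
  have "map snd (map (\<lambda>i. (t i, xs ! i)) [0..<length xs]) = xs"
    by (simp add: o_def map_nth)
  then show "map snd (positioned xL xs xR t) = xL # xs @ [xR]"
    unfolding positioned_def by simp
  have "sorted (map t [0..<length xs])"
    using assms unfolding simplex_param_def sorted_iff_nth_mono by auto
  then show "sorted (map fst (positioned xL xs xR t))"
    using assms unfolding positioned_def simplex_param_def by (auto simp: sorted_append o_def)
  show "fst ` set (positioned xL xs xR t) \<subseteq> {0..1}"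
    using assms unfolding positioned_def simplex_param_def by auto
qed

lemma charpt_eq_merge_at:
  assumes "simplex_param (length xs) t"
  shows "charpt G xL xs xR t = merge_at (positioned xL xs xR t)"
proof
  fix r
  show "charpt G xL xs xR t r = merge_at (positioned xL xs xR t) r"
  proof (cases "r \<in> {0..1}")
    case True
    have "concat (map (\<lambda>i. if t i = r then [xs ! i] else []) [0..<length xs]) =
        map snd (filter (\<lambda>p. fst p = r) (map (\<lambda>i. (t i, xs ! i)) [0..<length xs]))"
      unfolding map_filter_concat by (simp add: filter_map o_def)
    with True show ?thesis
      unfolding charpt_def merge_at_def positioned_def by simp
  next
    case False
    then have "r \<notin> fst ` set (positioned xL xs xR t)"
      using positioned_props(2)[OF assms, of xL xR] by blast
    with False show ?thesis
      by (simp only: merge_at_trivial charpt_def if_False not_False_eq_True)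
  qed
qed

lemma charpt_properties:
  assumes "is_linfact G X x xL xs xR" "simplex_param (length xs) t"
  shows "efficient (charpt G xL xs xR t)" "rho G (charpt G xL xs xR t) = x"
    and "cum (charpt G xL xs xR t) r =
      lprod G (map snd (filter (\<lambda>p. fst p \<le> r) (positioned xL xs xR t)))"
proof -
  let ?ps = "positioned xL xs xR t"
  note P = positioned_props[OF assms(2), of xL xR]
  have zs: "set (xL # xs @ [xR]) \<subseteq> M" using assms(1) by (auto simp: is_linfact_def)
  then have c: "set xs \<subseteq> carrier G" "xL \<in> carrier G" "xR \<in> carrier G" using M_carrier by auto
  have x: "lprod G (xL # xs @ [xR]) = x"
    using assms(1) c unfolding is_linfact_def by (simp add: lprod_append m_assoc)
  have "snd ` set ?ps \<subseteq> M" using zs P(3) by (metis list.set_map)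
  moreover have "sum_list (map len (map snd ?ps)) = len (lprod G (map snd ?ps))"
    unfolding P(3) x using assms(1) by (simp add: is_linfact_def)
  ultimately show "efficient (charpt G xL xs xR t)" "rho G (charpt G xL xs xR t) = x"
    "cum (charpt G xL xs xR t) r = lprod G (map snd (filter (\<lambda>p. fst p \<le> r) ?ps))"
    using merge_at_properties[OF P(1) _ P(2)] unfolding charpt_eq_merge_at[OF assms(2)] P(3) x by auto
qed

lemma len_lprod_le: "set zs \<subseteq> M \<Longrightarrow> len (lprod G zs) \<le> sum_list (map len zs)"
proof (induction zs)
  case (Cons z zs)
  then show ?case using len_mult_le[of z "lprod G zs"] by (simp, force)
qed simp

text \<open>If the lengths add up for the whole list, they do for every prefix. The segment between
  two prefixes of equal length then has length 0 and product \<open>\<one>\<close>.\<close>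

lemma lprod_take_eq:
  assumes "set zs \<subseteq> M" "sum_list (map len zs) = len (lprod G zs)"
    and "len (lprod G (take j zs)) = len (lprod G (take k zs))"
  shows "lprod G (take j zs) = lprod G (take k zs)"
proof -
  have take_M: "set (take j zs) \<subseteq> M" and drop_M: "set (drop j zs) \<subseteq> M" for j
    using assms(1) set_take_subset[of j zs] set_drop_subset[of j zs] by auto
  have tight: "len (lprod G (take j zs)) = sum_list (map len (take j zs))" for j
  proof -
    have "lprod G zs = lprod G (take j zs) \<otimes> lprod G (drop j zs)"
      using lprod_append[of "take j zs" "drop j zs"] take_M drop_M M_carrier by (simp add: subset_eq)
    then have "len (lprod G zs) \<le> len (lprod G (take j zs)) + len (lprod G (drop j zs))"
      using take_M drop_M by (simp add: len_mult_le M_lprod)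
    moreover have "sum_list (map len zs) = sum_list (map len (take j zs)) + sum_list (map len (drop j zs))"
      by (metis append_take_drop_id map_append sum_list_append)
    ultimately show ?thesis
      using len_lprod_le[OF take_M[of j]] len_lprod_le[OF drop_M[of j]] assms(2) by linarith
  qed
  have "lprod G (take j zs) = lprod G (take k zs)"
    if "j \<le> k" "len (lprod G (take j zs)) = len (lprod G (take k zs))" for j k
  proof -
    let ?d = "drop j (take k zs)"
    have eq: "take k zs = take j zs @ ?d" using that(1) by (metis append_take_drop_id min_absorb1 take_take)
    have d: "set ?d \<subseteq> M" using take_M[of k] set_drop_subset[of j "take k zs"] by auto
    have "sum_list (map len (take k zs)) = sum_list (map len (take j zs)) + sum_list (map len ?d)"
      by (metis eq map_append sum_list_append)
    then have "len (lprod G ?d) = 0"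
      using that(2) len_lprod_le[OF d] unfolding tight by linarith
    then have "lprod G ?d = \<one>" using len_eq_0_iff[of "lprod G ?d"] d by blast
    moreover have "lprod G (take k zs) = lprod G (take j zs) \<otimes> lprod G ?d"
      using lprod_append[of "take j zs" ?d] eq take_M[of j] d M_subset by auto
    ultimately show ?thesis using take_M[of j] M_subset by auto
  qed
  then show ?thesis using assms(3) by (metis nat_le_linear)
qed

lemma common_cellD:
  assumes "common_cell G X x u w"
  shows "efficient u" "efficient w" "rho G u = x" "rho G w = x"
    and "len (cum u r) = len (cum w r) \<Longrightarrow> cum u r = cum w r"
proof -
  obtain xL xs xR t t' where lf: "is_linfact G X x xL xs xR"
    and t: "simplex_param (length xs) t" "simplex_param (length xs) t'"
    and u: "u = charpt G xL xs xR t" and w: "w = charpt G xL xs xR t'"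
    using assms unfolding common_cell_def by blast
  show "efficient u" "efficient w" "rho G u = x" "rho G w = x"
    using charpt_properties[OF lf] t u w by auto
  let ?zs = "xL # xs @ [xR]"
  \<comment> \<open>Positions are sorted, so the factors placed up to \<open>r\<close> form a prefix
    of \<open>?zs\<close>, the same list for both parameters.\<close>
  have "\<exists>k. cum (charpt G xL xs xR s) r = lprod G (take k ?zs)" if s: "simplex_param (length xs) s" for s
  proof -
    have "cum (charpt G xL xs xR s) r = lprod G (map snd (take (length (filter (\<lambda>p. fst p \<le> r)
        (positioned xL xs xR s))) (positioned xL xs xR s)))"
      unfolding charpt_properties(3)[OF lf s]
      by (subst sorted_filter_le_eq_take[OF positioned_props(1)[OF s]]) (rule refl)
    then show ?thesis unfolding take_map[symmetric] positioned_props(3)[OF s] by blast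
  qed
  then obtain j k where jk: "cum u r = lprod G (take j ?zs)" "cum w r = lprod G (take k ?zs)"
    using t u w by blast
  have zs: "set ?zs \<subseteq> M" using lf by (auto simp: is_linfact_def)
  then have c: "set xs \<subseteq> carrier G" "xL \<in> carrier G" "xR \<in> carrier G" using M_carrier by auto
  have "sum_list (map len ?zs) = len (lprod G ?zs)"
    using lf c unfolding is_linfact_def by (simp add: lprod_append m_assoc)
  then show "len (cum u r) = len (cum w r) \<Longrightarrow> cum u r = cum w r"
    unfolding jk by (rule lprod_take_eq[OF zs])
qed

section \<open>Closed cells described by chains from the identity to the factored element\<close>

definition flag :: "'a \<Rightarrow> 'a list \<Rightarrow> bool" where
  "flag x c \<longleftrightarrow> c \<noteq> [] \<and> sorted_wrt (\<lambda>a b. a \<preceq> b \<and> a \<noteq> b) c \<and>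
     c ! 0 = \<one> \<and> c ! (length c - 1) = x \<and> x \<in> M"

definition quots :: "'a list \<Rightarrow> 'a list" where
  "quots c = map (\<lambda>i. inv (c ! i) \<otimes> c ! Suc i) [0..<length c - 1]"

lemma length_quots [simp]: "length (quots c) = length c - 1"
  by (simp add: quots_def)

lemma flag_less:
  assumes "flag x c" "i < j" "j < length c"
  shows "c ! i \<preceq> c ! j" "c ! i \<noteq> c ! j" "len (c ! i) < len (c ! j)"
proof -
  show le: "c ! i \<preceq> c ! j" and ne: "c ! i \<noteq> c ! j"
    using assms sorted_wrt_nth_less unfolding flag_def by fastforce+
  show "len (c ! i) < len (c ! j)" using pref_len_eq[OF le] ne by force
qed

lemma flag_M: "flag x c \<Longrightarrow> i < length c \<Longrightarrow> c ! i \<in> M"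
  using flag_less(1)[of x c i "length c - 1", THEN prefD_M(1)]
  by (cases "i = length c - 1") (auto simp: flag_def)

lemma flag_quots:
  assumes "flag x c" "k < length c"
  shows "lprod G (take k (quots c)) = c ! k" "sum_list (map len (take k (quots c))) = len (c ! k)"
    "set (take k (quots c)) \<subseteq> M"
proof -
  have "lprod G (take k (quots c)) = c ! k \<and> sum_list (map len (take k (quots c))) = len (c ! k) \<and>
      set (take k (quots c)) \<subseteq> M"
    using assms(2)
  proof (induction k)
    case 0 then show ?case using assms(1) by (simp add: flag_def)
  next
    case (Suc k)
    let ?q = "inv (c ! k) \<otimes> c ! Suc k"
    have t: "take (Suc k) (quots c) = take k (quots c) @ [?q]"
      using Suc.prems by (subst take_Suc_conv_app_nth) (auto simp: quots_def)
    have q: "?q \<in> M" "len (c ! k) + len ?q = len (c ! Suc k)"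
      using flag_less(1)[OF assms(1), of k "Suc k"] Suc.prems unfolding pref_iff by auto
    have c: "c ! k \<in> carrier G" "c ! Suc k \<in> carrier G"
      using flag_M[OF assms(1)] M_carrier Suc.prems by auto
    have IH: "lprod G (take k (quots c)) = c ! k" "sum_list (map len (take k (quots c))) = len (c ! k)"
      "set (take k (quots c)) \<subseteq> M"
      using Suc by auto
    have "set (take k (quots c)) \<subseteq> carrier G" using IH(3) M_subset by blast
    then have "lprod G (take k (quots c) @ [?q]) = c ! Suc k"
      using c IH by (subst lprod_append) auto
    then show ?case unfolding t using q IH by simp
  qed
  then show "lprod G (take k (quots c)) = c ! k" "sum_list (map len (take k (quots c))) = len (c ! k)"
    "set (take k (quots c)) \<subseteq> M" by auto
qed

text \<open>Trivial end factors suffice to describe all factorizations: nontrivial values at 0 or 1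
  arise from positions \<open>t i = 0\<close> or \<open>t i = 1\<close>.\<close>

lemma flag_linfact:
  assumes "flag x c" shows "is_linfact G X x \<one> (quots c) \<one>"
proof -
  have c: "c \<noteq> []" "c ! (length c - 1) = x" "x \<in> M" using assms by (auto simp: flag_def)
  then have Q: "lprod G (quots c) = x" "sum_list (map len (quots c)) = len x" "set (quots c) \<subseteq> M"
    using flag_quots[OF assms, of "length c - 1"] by auto
  have "q \<noteq> \<one>" if q: "q \<in> set (quots c)" for q
  proof -
    obtain i where i: "i < length c - 1" "q = inv (c ! i) \<otimes> c ! Suc i"
      using q unfolding quots_def by auto
    then have "c ! i \<noteq> c ! Suc i" "c ! i \<in> carrier G" "c ! Suc i \<in> carrier G"
      using flag_less(2)[OF assms, of i "Suc i"] flag_M[OF assms] M_carrier by auto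
    then show ?thesis using i by (metis inv_equality inv_inv inv_closed)
  qed
  with Q c show ?thesis unfolding is_linfact_def by (auto simp: M_carrier)
qed

text \<open>The quotients placed up to \<open>r\<close> are the first ones of the chain, and their
  product telescopes to a member of \<open>c\<close>.\<close>

lemma flag_cell:
  assumes "flag x c" "simplex_param (length c - 1) t"
  shows "efficient (charpt G \<one> (quots c) \<one> t)" "rho G (charpt G \<one> (quots c) \<one> t) = x"
    and "cum (charpt G \<one> (quots c) \<one> t) r = c ! card {i. i < length c - 1 \<and> t i \<le> r}"
proof -
  have t: "simplex_param (length (quots c)) t" using assms(2) by simp
  note P = charpt_properties[OF flag_linfact[OF assms(1)] t]
  show "efficient (charpt G \<one> (quots c) \<one> t)" "rho G (charpt G \<one> (quots c) \<one> t) = x"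
    using P by auto
  let ?n = "length c - 1"
  let ?ps = "map (\<lambda>i. (t i, quots c ! i)) [0..<?n]"
  let ?k = "card {i. i < ?n \<and> t i \<le> r}"
  have k: "?k \<le> ?n" using card_mono[of "{..<?n}" "{i. i < ?n \<and> t i \<le> r}"] by auto
  have snd: "map snd ?ps = quots c" using map_nth[of "quots c"] by (simp add: o_def)
  have "sorted (map fst ?ps)"
    using assms(2) unfolding simplex_param_def sorted_iff_nth_mono by auto
  then have "filter (\<lambda>p. fst p \<le> r) ?ps = take (length (filter (\<lambda>p. fst p \<le> r) ?ps)) ?ps"
    by (rule sorted_filter_le_eq_take)
  also have "length (filter (\<lambda>p. fst p \<le> r) ?ps) = ?k"
    by (simp add: length_filter_conv_card cong: conj_cong)
  finally have "map snd (filter (\<lambda>p. fst p \<le> r) ?ps) = map snd (take ?k ?ps)"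
    by (rule arg_cong)
  also have "map snd (take ?k ?ps) = take ?k (quots c)" unfolding take_map[symmetric] snd ..
  finally have mid: "map snd (filter (\<lambda>p. fst p \<le> r) ?ps) = take ?k (quots c)" .
  have l: "lprod G (map snd (filter (\<lambda>p. fst p \<le> r) ?ps)) = c ! ?k"
    "set (map snd (filter (\<lambda>p. fst p \<le> r) ?ps)) \<subseteq> carrier G"
  proof -
    have "c \<noteq> []" using assms(1) by (simp add: flag_def)
    then have k: "?k < length c" using k by (cases c) auto
    show "lprod G (map snd (filter (\<lambda>p. fst p \<le> r) ?ps)) = c ! ?k"
      "set (map snd (filter (\<lambda>p. fst p \<le> r) ?ps)) \<subseteq> carrier G"
      using mid flag_quots[OF assms(1) k] M_subset by auto
  qed
  define L where "L = filter (\<lambda>p. fst p \<le> r) ?ps"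
  note l = l[folded L_def]
  have c: "c ! ?k \<in> carrier G" using lprod_closed[OF l(2)] unfolding l(1) .
  have "filter (\<lambda>p. fst p \<le> r) (positioned \<one> (quots c) \<one> t) =
      (if 0 \<le> r then [(0, \<one>)] else []) @ L @ (if 1 \<le> r then [(1, \<one>)] else [])"
    by (simp add: positioned_def L_def)
  moreover have "lprod G (map snd ((if 0 \<le> r then [(0, \<one>)] else []) @ L @ (if 1 \<le> r then [(1, \<one>)] else []))) = c ! ?k"
    using lprod_append[OF l(2), of "[\<one>]"] c unfolding l(1) by (simp add: l(1))
  ultimately show "cum (charpt G \<one> (quots c) \<one> t) r = c ! ?k"
    unfolding P(3) by simp
qed

text \<open>A step function with values in the chain is determined by the times at which it reaches
  the successive members; these times are the parameters in the closed cell of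
  \<open>c\<close>.\<close>

lemma flag_coordinates:
  assumes u: "efficient u" "rho G u = x" and c: "flag x c" and sub: "range (cum u) \<subseteq> set c"
  obtains t where "simplex_param (length c - 1) t" "u = charpt G \<one> (quots c) \<one> t"
proof
  let ?n = "length c - 1"
  \<comment> \<open>\<open>c ! Suc i\<close> is reached or passed when the length becomes at least
    \<open>len (c ! Suc i)\<close>; as coordinates are counted from 0, this is the time recorded at
    that length minus 1.\<close>
  define t where "t i = ocoord G X u ! (len (c ! Suc i) - 1)" for i
  have x: "c ! ?n = x" "c \<noteq> []" using c by (auto simp: flag_def)
  have len_less: "len (c ! i) < len (c ! j) \<longleftrightarrow> i < j" if "i < length c" "j < length c" for i j
    using flag_less(3)[OF c, of i j] flag_less(3)[OF c, of j i] that
    by (metis less_asym less_irrefl linorder_neqE_nat)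
  have pos: "0 < len (c ! Suc i)" "len (c ! Suc i) - 1 < len x" if "i < ?n" for i
  proof -
    show p: "0 < len (c ! Suc i)" using flag_less(3)[OF c, of i "Suc i"] that by linarith
    show "len (c ! Suc i) - 1 < len x"
      using p flag_less(3)[OF c, of "Suc i" ?n] that x by (cases "Suc i = ?n") auto
  qed
  have idx: "\<exists>k<length c. cum u r = c ! k" for r
  proof -
    have "cum u r \<in> set c" using sub by blast
    then show ?thesis by (auto simp: in_set_conv_nth)
  qed
  have t_le: "t i \<le> r \<longleftrightarrow> i < k" if "i < ?n" "k < length c" "cum u r = c ! k" for i k r
  proof -
    have "t i \<le> r \<longleftrightarrow> len (c ! Suc i) - 1 < len (cum u r)"
      unfolding t_def using pos[OF that(1)] u by (intro ocoord_thresholds(2)) auto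
    also have "\<dots> \<longleftrightarrow> \<not> len (c ! k) < len (c ! Suc i)"
      using pos[OF that(1)] that(3) by auto
    also have "\<dots> \<longleftrightarrow> i < k" using len_less[of k "Suc i"] that by auto
    finally show ?thesis .
  qed
  show t: "simplex_param ?n t"
    unfolding simplex_param_def
  proof (intro conjI allI impI)
    fix i assume "i < ?n"
    then show "0 \<le> t i" "t i \<le> 1" unfolding t_def using pos[of i] u ocoord_bounds by auto
  next
    fix i j assume ij: "i \<le> j \<and> j < ?n"
    \<comment> \<open>At time \<open>t j\<close> the index \<open>k\<close> of the current value
      exceeds \<open>j\<close>, hence also \<open>i\<close>, so the jump \<open>i\<close> has
      already happened.\<close>
    obtain k where "k < length c" "cum u (t j) = c ! k" using idx by blast
    then show "t i \<le> t j" using t_le[of j k "t j"] t_le[of i k "t j"] ij by auto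
  qed
  show "u = charpt G \<one> (quots c) \<one> t"
  proof (rule cum_inject)
    show "labelling u" "labelling (charpt G \<one> (quots c) \<one> t)"
      using u flag_cell(1)[OF c t] efficient_labelling by auto
    fix r
    obtain k where k: "k < length c" "cum u r = c ! k" using idx by blast
    then have "{i. i < ?n \<and> t i \<le> r} = {..<k}" using t_le[of _ k r] by auto
    then show "cum u r = cum (charpt G \<one> (quots c) \<one> t) r"
      unfolding flag_cell(3)[OF c t] using k by simp
  qed
qed

end

subsection \<open>The topology of weighted factorizations\<close>

context conj_closed_group
begin

text \<open>Neighbours in the string share a closed cell, where \<open>cdist\<close> is bounded by
  the coordinate distance with the same factor \<open>len x\<close>; the triangle inequality adds
  these bounds up.\<close>

lemma cdist_le_of_wf_near:
  fixes e :: real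
  assumes "efficient u" "rho G u = x" "wf_near G X x u w e"
  shows "efficient w" "rho G w = x" "cdist u w \<le> len x * e"
proof -
  obtain ws where ws: "ws \<noteq> []" "hd ws = u" "last ws = w"
    and cc: "\<And>i. Suc i < length ws \<Longrightarrow> common_cell G X x (ws ! i) (ws ! Suc i)"
    and sum: "(\<Sum>i<length ws - 1. ldist (ocoord G X (ws ! i)) (ocoord G X (ws ! Suc i))) < e"
    using assms(3) unfolding wf_near_def by blast
  let ?l = "\<lambda>i. ldist (ocoord G X (ws ! i)) (ocoord G X (ws ! Suc i))"
  have *: "efficient (ws ! k) \<and> rho G (ws ! k) = x \<and> cdist u (ws ! k) \<le> len x * (\<Sum>i<k. ?l i)"
    if "k < length ws" for k
    using that
  proof (induction k)
    case 0 then show ?case using assms ws by (simp add: hd_conv_nth[symmetric])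
  next
    case (Suc k)
    then have IH: "efficient (ws ! k)" "rho G (ws ! k) = x" "cdist u (ws ! k) \<le> len x * (\<Sum>i<k. ?l i)" by auto
    note C = common_cellD[OF cc[OF Suc.prems]]
    have "cdist u (ws ! Suc k) \<le> cdist u (ws ! k) + cdist (ws ! k) (ws ! Suc k)"
      using assms(1) C efficient_labelling by (intro cdist_triangle) auto
    moreover have "cdist (ws ! k) (ws ! Suc k) \<le> len x * ?l k"
      using C by (intro cdist_le_ldist_ocoord) auto
    ultimately show ?case using C IH by (simp add: distrib_left)
  qed
  have last: "ws ! (length ws - 1) = w" "length ws - 1 < length ws"
    using ws by (auto simp: last_conv_nth)
  then show "efficient w" "rho G w = x" using *[of "length ws - 1"] by auto
  have "cdist u w \<le> len x * (\<Sum>i<length ws - 1. ?l i)" using *[of "length ws - 1"] last by auto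
  also have "\<dots> \<le> len x * e" using sum by (intro mult_left_mono) auto
  finally show "cdist u w \<le> len x * e" .
qed

lemma finite_range_cum: "labelling u \<Longrightarrow> finite (range (cum u))"
proof -
  assume labelling: "labelling u"
  have "range (cum u) \<subseteq> oprod u ` Pow (nontriv u)" unfolding cum_def by auto
  then show ?thesis using labellingD(3)[OF labelling] by (meson finite_Pow_iff finite_imageI finite_subset)
qed

text \<open>Each value of \<open>cum u\<close> is attained on an interval of positive length, on which a step
  function at a smaller distance cannot differ from it throughout.\<close>
lemma range_cum_subset_of_near:
  assumes u: "efficient u"
  obtains d where "0 < d" "\<And>w. efficient w \<Longrightarrow> cdist u w < d \<Longrightarrow> range (cum u) \<subseteq> range (cum w)"
proof -
  note labelling = efficient_labelling[OF u]
  \<comment> \<open>Stated with a filter so that the radii for the finitely many values can be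
    combined.\<close>
  have "\<forall>\<^sub>F d in at_right 0. \<forall>w. efficient w \<longrightarrow> cdist u w < d \<longrightarrow> z \<in> range (cum w)"
    if z: "z \<in> range (cum u)" for z
  proof -
    obtain r where r: "z = cum u r" using z by blast
    show ?thesis
    proof (cases "r < 0")
      case True
      then have "z = cum w r" if "efficient w" for w using r labelling that efficient_labelling cum_neg by metis
      then show ?thesis by (intro always_eventually) blast
    next
      case False
      \<comment> \<open>Replacing \<open>r\<close> by at most 1 leaves the value unchanged and keeps
        an interval of positive length to the right of \<open>s\<close> inside the window that ends
        at 2.\<close>
      define s where "s = min r 1"
      have s: "0 \<le> s" "s \<le> 1" "z = cum u s"
        using False r cum_ge_one[OF labelling, of r] cum_ge_one[OF labelling, of 1] by (auto simp: s_def min_def)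
      obtain q where q: "s < q" "\<And>p. s \<le> p \<Longrightarrow> p < q \<Longrightarrow> cum u p = cum u s"
        using cum_right[OF labelling] by blast
      have "z \<in> range (cum w)" if w: "efficient w" "cdist u w < min q 2 - s" for w
      proof (rule ccontr)
        assume "z \<notin> range (cum w)"
        then have "cum u p \<noteq> cum w p" if "s \<le> p" "p < min q 2" for p
          using q(2)[of p] that s(3) by (metis min_less_iff_conj rangeI)
        then have "min q 2 - s \<le> cdist u w"
          by (intro cdist_ge labelling efficient_labelling[OF w(1)] s(1)) simp_all
        with w show False by simp
      qed
      moreover have "\<forall>\<^sub>F d in at_right 0. d < min q 2 - s"
        using q(1) s(2) by (intro order_tendstoD(2)[OF tendsto_ident_at]) simp
      ultimately show ?thesis
        by (elim eventually_mono) (meson order_less_trans)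
    qed
  qed
  then have "\<forall>\<^sub>F d in at_right 0. \<forall>z\<in>range (cum u). \<forall>w. efficient w \<longrightarrow> cdist u w < d \<longrightarrow> z \<in> range (cum w)"
    by (intro eventually_ball_finite finite_range_cum[OF labelling] ballI)
  moreover have "\<forall>\<^sub>F d :: real in at_right 0. 0 < d" by (simp add: eventually_at_right_less)
  ultimately have "\<forall>\<^sub>F d in at_right 0. 0 < d \<and> (\<forall>z\<in>range (cum u). \<forall>w. efficient w \<longrightarrow> cdist u w < d \<longrightarrow> z \<in> range (cum w))"
    by eventually_elim blast
  then obtain d where "0 < d \<and> (\<forall>z\<in>range (cum u). \<forall>w. efficient w \<longrightarrow> cdist u w < d \<longrightarrow> z \<in> range (cum w))"
    using eventually_happens'[of "at_right (0::real)"] by fastforce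
  then show thesis by (intro that[of d]) auto
qed

text \<open>The induction appends an element of greatest length: it lies above all others, since
  comparable elements of equal length coincide.\<close>

lemma chain_sorted_list:
  assumes "finite C" "\<And>a b. a \<in> C \<Longrightarrow> b \<in> C \<Longrightarrow> a \<preceq> b \<or> b \<preceq> a"
  obtains c where "set c = C" "sorted_wrt (\<lambda>a b. a \<preceq> b \<and> a \<noteq> b) c"
proof -
  have "\<exists>c. set c = C \<and> sorted_wrt (\<lambda>a b. a \<preceq> b \<and> a \<noteq> b) c"
    using assms
  proof (induction C rule: finite_ranking_induct[where f = len])
    case empty then show ?case by simp
  next
    case (insert a C)
    then obtain c where c: "set c = C" "sorted_wrt (\<lambda>a b. a \<preceq> b \<and> a \<noteq> b) c" by blast
    show ?case
    proof (cases "a \<in> C")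
      case True
      then show ?thesis using c by (intro exI[of _ c]) (simp add: insert_absorb)
    next
      case False
      have "b \<preceq> a" if b: "b \<in> C" for b
      proof (rule ccontr)
        assume nb: "\<not> b \<preceq> a"
        then have "a \<preceq> b" using insert.prems[of a b] b by blast
        then have "a = b" using insert.hyps(2)[OF b] pref_len_eq by blast
        then show False using b False by blast
      qed
      then show ?thesis using c False by (intro exI[of _ "c @ [a]"]) (auto simp: sorted_wrt_append)
    qed
  qed
  then show thesis using that by blast
qed

lemma flagI:
  assumes "sorted_wrt (\<lambda>a b. a \<preceq> b \<and> a \<noteq> b) c" "\<one> \<in> set c" "x \<in> set c" "\<And>z. z \<in> set c \<Longrightarrow> z \<preceq> x"
  shows "flag x c"
proof -
  have less: "c ! i \<preceq> c ! j" "c ! i \<noteq> c ! j" if "i < j" "j < length c" for i j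
    using sorted_wrt_nth_less[OF assms(1) that] by auto
  obtain i where i: "i < length c" "c ! i = \<one>" using assms(2) by (auto simp: in_set_conv_nth)
  obtain j where j: "j < length c" "c ! j = x" using assms(3) by (auto simp: in_set_conv_nth)
  have "c ! 0 = \<one>"
  proof (cases "i = 0")
    case False
    then have "c ! 0 \<preceq> \<one>" "c ! 0 \<noteq> \<one>" using less[of 0 i] i by auto
    then show ?thesis using pref_len_eq[of "c ! 0" \<one>] by simp
  qed (use i in simp)
  moreover have "c ! (length c - 1) = x"
  proof (cases "j = length c - 1")
    case False
    then have "x \<preceq> c ! (length c - 1)" using less[of j "length c - 1"] j by auto
    moreover have "c ! (length c - 1) \<preceq> x" using assms(4) j by (intro assms(4) nth_mem) auto
    ultimately show ?thesis using pref_len[of "c ! (length c - 1)" x] pref_len_eq by metis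
  qed (use j in simp)
  ultimately show ?thesis
    using assms prefD_M unfolding flag_def by auto
qed

lemma cum_comparable: "efficient u \<Longrightarrow> cum u r \<preceq> cum u s \<or> cum u s \<preceq> cum u r"
  using cum_mono[of u r s] cum_mono[of u s r] by fastforce

lemma one_rho_in_range_cum:
  assumes "labelling u" shows "\<one> \<in> range (cum u)" "rho G u \<in> range (cum u)"
  using cum_neg[OF assms, of "-1"] cum_ge_one[OF assms, of 1] by (metis rangeI neg_less_0_iff_less zero_less_one order_refl)+

lemma range_cum_flag:
  assumes "efficient u"
  obtains c where "flag (rho G u) c" "set c = range (cum u)"
proof -
  note labelling = efficient_labelling[OF assms]
  obtain c where c: "set c = range (cum u)" "sorted_wrt (\<lambda>a b. a \<preceq> b \<and> a \<noteq> b) c"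
  proof (rule chain_sorted_list[OF finite_range_cum[OF labelling]])
    show "a \<preceq> b \<or> b \<preceq> a" if "a \<in> range (cum u)" "b \<in> range (cum u)" for a b
      using that cum_comparable[OF assms] by auto
  qed
  have "flag (rho G u) c"
    using c cum_pref_rho[OF assms] one_rho_in_range_cum[OF labelling] by (intro flagI) auto
  then show thesis using that c by blast
qed

text \<open>The values of \<open>cum w\<close> form a flag; its closed cell contains
  \<open>w\<close> and, as all values of \<open>cum u\<close> occur in it, also
  \<open>u\<close>.\<close>

lemma common_cell_of_range_subset:
  assumes "efficient u" "efficient w" "rho G u = x" "rho G w = x" "range (cum u) \<subseteq> range (cum w)"
  shows "common_cell G X x u w"
proof -
  obtain c where f: "flag x c" and c: "set c = range (cum w)"
    using range_cum_flag[OF assms(2)] assms(4) by auto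
  obtain t where t: "simplex_param (length c - 1) t" "u = charpt G \<one> (quots c) \<one> t"
    using flag_coordinates[OF assms(1,3) f] assms(5) c by auto
  obtain t' where t': "simplex_param (length c - 1) t'" "w = charpt G \<one> (quots c) \<one> t'"
    using flag_coordinates[OF assms(2,4) f] c by auto
  show ?thesis
    unfolding common_cell_def using t t' flag_linfact[OF f] by (metis length_quots)
qed

lemma Fset_iff: "u \<in> Fset G X g \<longleftrightarrow> efficient u \<and> rho G u \<preceq> g"
  unfolding Fset_def intv_def by (auto simp: wfact_iff)

text \<open>\<open>id\<close> is a homeomorphism between the two topologies. Strings bound
  \<open>cdist\<close> globally; conversely, near \<open>a\<close> a string of one step is
  enough.\<close>

lemma Ftop_eq: "Ftop G X g = nbhd_topology (Fset G X g) (\<lambda>u w e. cdist u w < e)"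
proof -
  have "homeomorphic_map (Ftop G X g) (nbhd_topology (Fset G X g) (\<lambda>u w e. cdist u w < e)) id"
    unfolding Ftop_def
  proof (rule homeomorphic_map_nbhd_topology)
    fix a b d e assume "wf_near G X (rho G a) a b d" "d \<le> e"
    then show "wf_near G X (rho G a) a b e" unfolding wf_near_def by force
  next
    fix a and e :: real assume a: "a \<in> Fset G X g" and e: "0 < e"
    let ?n = "len (rho G a)"
    \<comment> \<open>Dividing by \<open>?n + 1\<close> also covers \<open>rho G a = \<one>\<close>,
      where \<open>?n\<close> is 0.\<close>
    have "cdist a b < e" if "wf_near G X (rho G a) a b (e / (?n + 1))" for b
    proof -
      have "cdist a b \<le> ?n * (e / (?n + 1))" using cdist_le_of_wf_near(3)[OF _ _ that] a by (auto simp: Fset_iff)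
      also have "\<dots> < e" using e by (simp add: field_simps)
      finally show ?thesis .
    qed
    then show "\<exists>d>0. \<forall>b\<in>Fset G X g. wf_near G X (rho G a) a b d \<longrightarrow> cdist (id a) (id b) < e"
      using e by (intro exI[of _ "e / (?n + 1)"]) auto
  next
    fix a and e :: real assume a: "a \<in> Fset G X g" and e: "0 < e"
    let ?n = "len (rho G a)"
    have ea: "efficient a" using a by (simp add: Fset_iff)
    obtain d where d: "0 < d" "\<And>w. efficient w \<Longrightarrow> cdist a w < d \<Longrightarrow> range (cum a) \<subseteq> range (cum w)"
      using range_cum_subset_of_near[OF ea] by blast
    \<comment> \<open>\<open>d\<close> yields a common cell, 1 the equality of the products, and the
      last term a coordinate distance below \<open>e\<close>.\<close>
    let ?d = "min (min d 1) (e / (?n + 1))"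
    have "wf_near G X (rho G a) a b e" if b: "b \<in> Fset G X g" "cdist a b < ?d" for b
    proof -
      have eb: "efficient b" using b by (simp add: Fset_iff)
      have rho: "rho G b = rho G a" using rho_eq_of_cdist_less[of a b] ea eb b efficient_labelling by auto
      have "common_cell G X (rho G a) a b"
        using d(2)[OF eb] b rho ea eb by (intro common_cell_of_range_subset) auto
      moreover have "ldist (ocoord G X a) (ocoord G X b) < e"
      proof -
        have "ldist (ocoord G X a) (ocoord G X b) \<le> ?n * cdist a b"
          using ea eb rho by (intro ldist_ocoord_le_cdist) auto
        also have "\<dots> \<le> ?n * (e / (?n + 1))" using b by (intro mult_left_mono) auto
        also have "\<dots> < e" using e by (simp add: field_simps)
        finally show ?thesis .
      qed
      ultimately show ?thesis
        unfolding wf_near_def by (intro exI[of _ "[a, b]"]) auto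
    qed
    then show "\<exists>da>0. \<forall>b\<in>Fset G X g. cdist (id a) (id b) < da \<longrightarrow> wf_near G X (rho G a) a b e"
      using e d(1) by (intro exI[of _ ?d]) auto
  qed auto
  then show ?thesis by (simp add: homeomorphic_map_id)
qed

end

subsection \<open>The upper set of a factorization\<close>

context conj_closed_group
begin

lemma mult_inv_cancel2 [simp]:
  assumes "a \<in> carrier G" "x \<in> carrier G"
  shows "x \<otimes> inv a \<otimes> a = x" "x \<otimes> a \<otimes> inv a = x"
  using assms by (simp_all add: m_assoc)

text \<open>Both pairs have the complement \<open>inv a \<otimes> b\<close>, and both lengths drop
  by \<open>len v\<close>.\<close>

lemma pref_cancel_left:
  assumes "v \<preceq> a" "v \<preceq> b"
  shows "inv v \<otimes> a \<preceq> inv v \<otimes> b \<longleftrightarrow> a \<preceq> b"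
proof -
  have c: "v \<in> carrier G" "a \<in> carrier G" "b \<in> carrier G" using assms prefD_M M_carrier by blast+
  have "inv (inv v \<otimes> a) \<otimes> (inv v \<otimes> b) = inv a \<otimes> b"
    using c by (simp add: inv_mult_group m_assoc)
  then show ?thesis using assms unfolding pref_iff by auto
qed

text \<open>The conjugating element is the inverse of the product of the \<open>v(s)\<close> with \<open>s > r\<close>, past
  which the factor at \<open>r\<close> is moved.\<close>
definition shift :: "(real \<Rightarrow> 'a) \<Rightarrow> (real \<Rightarrow> 'a) \<Rightarrow> real \<Rightarrow> 'a" where
  "shift v u r = (inv (rho G v) \<otimes> cum v r) \<otimes> (inv (v r) \<otimes> u r) \<otimes> inv (inv (rho G v) \<otimes> cum v r)"

definition unshift :: "(real \<Rightarrow> 'a) \<Rightarrow> (real \<Rightarrow> 'a) \<Rightarrow> real \<Rightarrow> 'a" where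
  "unshift v w r = v r \<otimes> (inv (inv (rho G v) \<otimes> cum v r) \<otimes> w r \<otimes> (inv (rho G v) \<otimes> cum v r))"

lemma rho_M: "labelling u \<Longrightarrow> rho G u \<in> M"
  by (simp add: rho_eq_oprod oprod_M labellingD)

lemma rho_closed [simp]: "labelling u \<Longrightarrow> rho G u \<in> carrier G"
  using rho_M M_carrier by blast

lemma labelling_closed [simp]: "labelling u \<Longrightarrow> u r \<in> carrier G"
  by (rule labellingD)

lemma shift_unshift:
  assumes "labelling v" "labelling w" shows "shift v (unshift v w) = w"
proof
  fix r
  define a where "a = inv (rho G v) \<otimes> cum v r"
  have "a \<in> carrier G" using assms by (simp add: a_def)
  then show "shift v (unshift v w) r = w r"
    unfolding shift_def unshift_def a_def[symmetric] using assms by (simp add: m_assoc)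
qed

lemma shift_inject:
  assumes "labelling v" "labelling u" "labelling w" "shift v u = shift v w" shows "u = w"
proof
  fix r
  define a where "a = inv (rho G v) \<otimes> cum v r"
  have a: "a \<in> carrier G" using assms by (simp add: a_def)
  have "a \<otimes> (inv (v r) \<otimes> u r) \<otimes> inv a = a \<otimes> (inv (v r) \<otimes> w r) \<otimes> inv a"
    using fun_cong[OF assms(4), of r] unfolding shift_def a_def .
  then show "u r = w r" using a assms by simp
qed

lemma nontriv_shift:
  assumes "labelling v" "labelling u" shows "nontriv (shift v u) \<subseteq> nontriv u \<union> nontriv v"
proof
  fix r assume r: "r \<in> nontriv (shift v u)"
  have "shift v u r = \<one>" if "u r = \<one>" "v r = \<one>"
    unfolding shift_def using that assms by (simp add: m_assoc inv_mult_group)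
  then show "r \<in> nontriv u \<union> nontriv v" using r by (auto simp: nontriv_def)
qed

text \<open>The premise says that \<open>S\<close> misses no factor of \<open>v\<close> before any
  of its points. Let A and B be the products of \<open>u\<close> and \<open>v\<close> over the
  points below \<open>b\<close>. The factor at \<open>b\<close> is h^-1 B u(b) v(b)^-1 B^-1 h, and
  multiplying h^-1 A B^-1 h by it gives h^-1 (A u(b)) (B v(b))^-1 h.\<close>

lemma oprod_shift:
  assumes "labelling v" "labelling u" "finite S" "\<And>s. s \<in> S \<Longrightarrow> cum v s = oprod v (S \<inter> {..s})"
  shows "oprod (shift v u) S = inv (rho G v) \<otimes> oprod u S \<otimes> inv (oprod v S) \<otimes> rho G v"
  using assms(3,4)
proof (induction S rule: finite_linorder_max_induct)
  case empty then show ?case using assms by simp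
next
  case (insert b S)
  let ?h = "rho G v"
  have c: "shift v u r \<in> carrier G" for r using assms by (simp add: shift_def)
  have o: "oprod u S \<in> carrier G" "oprod v S \<in> carrier G" using assms by auto
  have ins: "oprod w (insert b S) = oprod w S \<otimes> w b" if "\<And>r. w r \<in> carrier G" for w
    using insert that by (intro oprod_insert_max) auto
  have IH: "oprod (shift v u) S = inv ?h \<otimes> oprod u S \<otimes> inv (oprod v S) \<otimes> ?h"
  proof (rule insert.IH)
    fix s assume s: "s \<in> S"
    then have "insert b S \<inter> {..s} = S \<inter> {..s}" using insert.hyps by auto
    then show "cum v s = oprod v (S \<inter> {..s})" using insert.prems[of s] s by simp
  qed
  have "insert b S \<inter> {..b} = insert b S" using insert.hyps by (auto intro: less_imp_le)
  then have cb: "cum v b = oprod v S \<otimes> v b" using insert.prems[of b] ins[of v] assms by simp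
  have "oprod (shift v u) (insert b S) = oprod (shift v u) S \<otimes> shift v u b"
    "oprod v (insert b S) = oprod v S \<otimes> v b" "oprod u (insert b S) = oprod u S \<otimes> u b"
    by (intro ins c labelling_closed assms)+
  moreover have "shift v u b = (inv ?h \<otimes> (oprod v S \<otimes> v b)) \<otimes> (inv (v b) \<otimes> u b) \<otimes>
      inv (inv ?h \<otimes> (oprod v S \<otimes> v b))"
    unfolding shift_def cb ..
  ultimately show ?case
    unfolding IH using o assms by (simp add: m_assoc inv_mult_group)
qed

lemma cum_shift:
  assumes "labelling v" "labelling u" "labelling (shift v u)"
  shows "cum (shift v u) r = inv (rho G v) \<otimes> cum u r \<otimes> inv (cum v r) \<otimes> rho G v"
proof -
  let ?T = "nontriv u \<union> nontriv v"
  have T: "finite ?T" using assms by (simp add: labellingD)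
  have "cum (shift v u) r = oprod (shift v u) (?T \<inter> {..r})"
    by (rule cum_eq_oprod[OF assms(3) T nontriv_shift[OF assms(1,2)]])
  also have "\<dots> = inv (rho G v) \<otimes> oprod u (?T \<inter> {..r}) \<otimes> inv (oprod v (?T \<inter> {..r})) \<otimes> rho G v"
  proof (rule oprod_shift[OF assms(1,2)])
    fix s assume "s \<in> ?T \<inter> {..r}"
    then have "?T \<inter> {..r} \<inter> {..s} = ?T \<inter> {..s}" by auto
    then show "cum v s = oprod v (?T \<inter> {..r} \<inter> {..s})"
      using cum_eq_oprod[OF assms(1) T] by simp
  qed (use T in auto)
  also have "oprod u (?T \<inter> {..r}) = cum u r"
    using cum_eq_oprod[OF assms(2) T] by simp
  also have "oprod v (?T \<inter> {..r}) = cum v r"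
    using cum_eq_oprod[OF assms(1) T] by simp
  finally show ?thesis .
qed

lemma rho_shift:
  assumes "labelling v" "labelling u" "labelling (shift v u)"
  shows "rho G (shift v u) = inv (rho G v) \<otimes> rho G u" "rho G v \<otimes> rho G (shift v u) = rho G u"
proof -
  show *: "rho G (shift v u) = inv (rho G v) \<otimes> rho G u"
    using cum_shift[OF assms, of 1] assms by (simp add: cum_ge_one)
  show "rho G v \<otimes> rho G (shift v u) = rho G u"
    unfolding * using assms by simp
qed

lemma cdist_shift:
  assumes "labelling v" "labelling u" "labelling w" "labelling (shift v u)" "labelling (shift v w)"
  shows "cdist (shift v u) (shift v w) = cdist u w"
proof -
  have "cum (shift v u) r = cum (shift v w) r \<longleftrightarrow> cum u r = cum w r" for r
    using assms by (simp add: cum_shift)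
  then show ?thesis by (simp add: cdist_def)
qed

lemma subwf_iff:
  assumes "labelling v" "labelling u" shows "subwf G X v u \<longleftrightarrow> (\<forall>r. v r \<preceq> u r)"
proof -
  have "v r \<preceq> u r" if "r \<notin> {0..1}" for r
  proof -
    have "v r = \<one>" "u r = \<one>" using that labellingD(4)[OF assms(1)] labellingD(4)[OF assms(2)] unfolding nontriv_def by blast+
    then show ?thesis by (simp add: pref_refl)
  qed
  then show ?thesis unfolding subwf_def by blast
qed

lemma labelling_shift:
  assumes "labelling v" "labelling u" "\<And>r. v r \<preceq> u r"
  shows "labelling (shift v u)" "len (v r) + len (shift v u r) = len (u r)"
proof -
  have a: "inv (rho G v) \<otimes> cum v r \<in> carrier G" for r using assms by simp
  have "inv (v r) \<otimes> u r \<in> M" "len (v r) + len (inv (v r) \<otimes> u r) = len (u r)" for r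
    using assms(3)[of r] by (auto simp: pref_iff)
  then have s: "shift v u r \<in> M" "len (v r) + len (shift v u r) = len (u r)" for r
    unfolding shift_def using M_conj[OF a] len_conj[OF a] by auto
  show "len (v r) + len (shift v u r) = len (u r)" by (rule s)
  show "labelling (shift v u)"
    using s nontriv_shift[OF assms(1,2)] labellingD[OF assms(1)] labellingD[OF assms(2)] unfolding labelling_def
    by (metis Un_least finite_Un finite_subset order_trans)
qed

lemma sum_len_nontriv:
  assumes "labelling u" "finite T" "nontriv u \<subseteq> T"
  shows "(\<Sum>r\<in>T. len (u r)) = (\<Sum>r\<in>nontriv u. len (u r))"
  using assms by (intro sum.mono_neutral_right) (auto simp: nontriv_def)

text \<open>Pointwise the lengths of \<open>v\<close> and of the shift add up to that of
  \<open>u\<close>. Summation yields \<open>len (rho G u)\<close>, which by subadditivity is at most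
  the sum of the lengths of the two products, so no length is lost.\<close>

lemma efficient_shift:
  assumes "efficient v" "efficient u" "\<And>r. v r \<preceq> u r"
  shows "efficient (shift v u)" "len (rho G v) + len (rho G (shift v u)) = len (rho G u)"
proof -
  note v = efficient_labelling[OF assms(1)] and u = efficient_labelling[OF assms(2)]
  note s = labelling_shift[OF v u assms(3)]
  let ?T = "nontriv u \<union> nontriv v"
  have T: "finite ?T" using u v by (simp add: labellingD)
  have "(\<Sum>r\<in>?T. len (v r)) + (\<Sum>r\<in>?T. len (shift v u r)) = (\<Sum>r\<in>?T. len (u r))"
    unfolding sum.distrib[symmetric] s(2) ..
  then have sum: "len (rho G v) + (\<Sum>r\<in>nontriv (shift v u). len (shift v u r)) = len (rho G u)"
    using assms(1,2) sum_len_nontriv[OF v T] sum_len_nontriv[OF u T] sum_len_nontriv[OF s(1) T nontriv_shift[OF v u]]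
    by (simp add: efficient_def)
  have "len (rho G u) \<le> len (rho G v) + len (rho G (shift v u))"
    using len_mult_le[of "rho G v" "rho G (shift v u)"] rho_shift(2)[OF v u s(1)] rho_M u v s(1) by simp
  moreover have "len (rho G (shift v u)) \<le> (\<Sum>r\<in>nontriv (shift v u). len (shift v u r))"
    unfolding rho_eq_oprod[OF s(1)] using s(1) by (intro len_oprod_le) (auto simp: labellingD)
  ultimately show "efficient (shift v u)" "len (rho G v) + len (rho G (shift v u)) = len (rho G u)"
    using sum s(1) unfolding efficient_def by auto
qed

text \<open>The third premise makes lengths additive on \<open>rho G v \<otimes> rho G w\<close>,
  which is the product of the new function; so the sum of its factor lengths, bounded by those of
  \<open>v\<close> and \<open>w\<close>, cannot be smaller.\<close>

lemma efficient_unshift: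
  assumes "efficient v" "efficient w" "rho G v \<preceq> rho G v \<otimes> rho G w"
  shows "efficient (unshift v w)" "v r \<preceq> unshift v w r" "rho G (unshift v w) = rho G v \<otimes> rho G w"
proof -
  note v = efficient_labelling[OF assms(1)] and w = efficient_labelling[OF assms(2)]
  let ?u = "unshift v w" and ?T = "nontriv w \<union> nontriv v"
  have T: "finite ?T" "?T \<subseteq> {0..1}" using w v by (simp_all add: labellingD)
  define b where "b r = inv (inv (rho G v) \<otimes> cum v r)" for r
  have b: "b r \<in> carrier G" for r using v by (simp add: b_def)
  define w' where "w' r = b r \<otimes> w r \<otimes> inv (b r)" for r
  have w': "w' r \<in> M" "len (w' r) = len (w r)" for r
    unfolding w'_def using M_conj[OF b] len_conj[OF b] labellingD(1)[OF w] by auto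
  have u: "?u r = v r \<otimes> w' r" for r
    using v unfolding unshift_def w'_def b_def by simp
  have "nontriv ?u \<subseteq> ?T"
    using v w b by (auto simp: nontriv_def u w'_def)
  then have fsu: "labelling ?u"
    using T labellingD(1)[OF v] w' unfolding labelling_def u by (auto simp: u intro: finite_subset)
  \<comment> \<open>\<open>labelling_shift\<close> would presuppose
    \<open>v r \<preceq> ?u r\<close>, which is known only at the end; instead the shift is
    recognized as \<open>w\<close>.\<close>
  have fss: "labelling (shift v ?u)" using shift_unshift[OF v w] w by simp
  show rho: "rho G ?u = rho G v \<otimes> rho G w"
    using rho_shift(2)[OF v fsu fss] shift_unshift[OF v w] by simp
  have "inv (rho G v) \<otimes> (rho G v \<otimes> rho G w) = rho G w" using v w by simp
  then have len: "len (rho G v \<otimes> rho G w) = len (rho G v) + len (rho G w)"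
    using assms(3) unfolding pref_iff by simp
  have "(\<Sum>r\<in>?T. len (?u r)) \<le> (\<Sum>r\<in>?T. len (v r) + len (w r))"
    using len_mult_le[OF labellingD(1)[OF v] w'(1)] w'(2) u by (intro sum_mono) auto
  also have sum2: "(\<Sum>r\<in>?T. len (v r) + len (w r)) = len (rho G v) + len (rho G w)"
    using assms sum_len_nontriv[OF v T(1)] sum_len_nontriv[OF w T(1)] by (simp add: sum.distrib efficient_def)
  finally have up: "(\<Sum>r\<in>?T. len (?u r)) \<le> len (rho G ?u)" using rho len by simp
  have "len (rho G ?u) \<le> (\<Sum>r\<in>nontriv ?u. len (?u r))"
    unfolding rho_eq_oprod[OF fsu] using fsu by (intro len_oprod_le) (auto simp: labellingD)
  then have sum: "(\<Sum>r\<in>?T. len (?u r)) = len (rho G ?u)"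
    using up sum_len_nontriv[OF fsu T(1) \<open>nontriv ?u \<subseteq> ?T\<close>] by simp
  then show "efficient ?u"
    using sum_len_nontriv[OF fsu T(1) \<open>nontriv ?u \<subseteq> ?T\<close>] fsu by (simp add: efficient_def)
  \<comment> \<open>Termwise inequality with equal sums forces equality at every point, which is
    what the prefix relation demands.\<close>
  have eq: "len (?u r) = len (v r) + len (w r)"
  proof (cases "r \<in> ?T")
    case True
    show ?thesis
    proof (rule sum_mono_inv[OF _ _ True T(1)])
      show "(\<Sum>r\<in>?T. len (?u r)) = (\<Sum>r\<in>?T. len (v r) + len (w r))"
        using sum rho len sum2 by simp
      show "len (?u r) \<le> len (v r) + len (w r)" for r
        using len_mult_le[OF labellingD(1)[OF v] w'(1), of r r] w'(2) u by simp
    qed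
  next
    case False
    then show ?thesis using u[of r] b[of r] by (simp add: nontriv_def w'_def)
  qed
  show "v r \<preceq> ?u r"
    unfolding u using eq u w' labellingD(1)[OF v] by (intro prefI) auto
qed

lemma pref_shift_iff:
  assumes "labelling v" "v r \<preceq> u r" "v r \<preceq> w r"
  shows "shift v u r \<preceq> shift v w r \<longleftrightarrow> u r \<preceq> w r"
proof -
  have "u r \<in> carrier G" "w r \<in> carrier G" using assms prefD_M M_carrier by blast+
  then show ?thesis
    unfolding shift_def using assms by (subst pref_conj_iff) (auto simp: pref_cancel_left)
qed

lemma upset_iff: "efficient v \<Longrightarrow> u \<in> upset G X g v \<longleftrightarrow> efficient u \<and> rho G u \<preceq> g \<and> (\<forall>r. v r \<preceq> u r)"
  unfolding upset_def Fset_iff by (auto simp: subwf_iff efficient_labelling)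

lemma shift_bij:
  assumes v: "efficient v" "rho G v \<preceq> g" and h': "h' \<in> M" "rho G v \<otimes> h' = g"
  shows "bij_betw (shift v) (upset G X g v) (Fset G X h')"
proof -
  let ?h = "rho G v"
  note fv = efficient_labelling[OF v(1)]
  have c: "?h \<in> carrier G" "h' \<in> carrier G" using fv h' M_carrier by auto
  have h'_eq: "inv ?h \<otimes> g = h'" using c h'(2) by auto
  have lg: "len ?h + len h' = len g" using v(2) h'_eq unfolding pref_iff by auto
  show ?thesis
    unfolding bij_betw_def
  proof
    show "inj_on (shift v) (upset G X g v)"
    proof (rule inj_onI)
      fix x y assume "x \<in> upset G X g v" "y \<in> upset G X g v" and eq: "shift v x = shift v y"
      then have "labelling x" "labelling y" unfolding upset_iff[OF v(1)] by (blast intro: efficient_labelling)+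
      then show "x = y" using eq by (rule shift_inject[OF fv])
    qed
    show "shift v ` upset G X g v = Fset G X h'"
    proof (intro equalityI subsetI)
      fix w assume "w \<in> shift v ` upset G X g v"
      then obtain u where "u \<in> upset G X g v" "w = shift v u" by blast
      then have u: "efficient u" "rho G u \<preceq> g" "\<And>r. v r \<preceq> u r" "w = shift v u"
        by (simp_all add: upset_iff[OF v(1)])
      note s = efficient_shift[OF v(1) u(1,3)]
      have "?h \<preceq> rho G u"
        using prefI[OF rho_M[OF fv] rho_M[OF efficient_labelling[OF s(1)]]] s(2)
        unfolding rho_shift(2)[OF fv efficient_labelling[OF u(1)] efficient_labelling[OF s(1)]] by simp
      then have "inv ?h \<otimes> rho G u \<preceq> inv ?h \<otimes> g"
        using pref_cancel_left[of ?h "rho G u" g] v(2) u(2) by simp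
      then show "w \<in> Fset G X h'"
        using s(1) u fv rho_shift(1)[OF fv efficient_labelling[OF u(1)] efficient_labelling[OF s(1)]]
        unfolding Fset_iff h'_eq by simp
    next
      fix w assume "w \<in> Fset G X h'"
      then have w: "efficient w" "rho G w \<preceq> h'" by (auto simp: Fset_iff)
      note fw = efficient_labelling[OF w(1)]
      have "len h' \<le> len (rho G w) + len (inv (rho G w) \<otimes> h')" "inv (rho G w) \<otimes> h' \<in> M"
        "len (rho G w) + len (inv (rho G w) \<otimes> h') = len h'"
        using w(2) unfolding pref_iff by auto
      moreover have "?h \<otimes> rho G w \<otimes> (inv (rho G w) \<otimes> h') = g"
        using c fw h'(2) by (simp add: m_assoc)
      moreover have hw: "?h \<otimes> rho G w \<in> M" using fv fw rho_M by blast
      ultimately have l: "len ?h + len (rho G w) \<le> len (?h \<otimes> rho G w)"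
        and l2: "len (?h \<otimes> rho G w) + len (inv (rho G w) \<otimes> h') \<le> len g"
        using len_mult_le[of "?h \<otimes> rho G w" "inv (rho G w) \<otimes> h'"] lg len_mult_le[of ?h "rho G w"] rho_M fv fw
        by auto
      have le: "?h \<preceq> ?h \<otimes> rho G w" using l fv fw rho_M by (intro prefI) auto
      have le2: "?h \<otimes> rho G w \<preceq> g"
        using prefI[OF hw \<open>inv (rho G w) \<otimes> h' \<in> M\<close>] l2
        unfolding \<open>?h \<otimes> rho G w \<otimes> (inv (rho G w) \<otimes> h') = g\<close> by blast
      note U = efficient_unshift[OF v(1) w(1) le]
      have "unshift v w \<in> upset G X g v"
        using U le2 unfolding upset_iff[OF v(1)] by simp
      then show "w \<in> shift v ` upset G X g v"
        using shift_unshift[OF fv fw] by (metis imageI)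
    qed
  qed
qed

lemma subtopology_Ftop:
  assumes "A \<subseteq> Fset G X g"
  shows "subtopology (Ftop G X g) A = nbhd_topology A (\<lambda>u w e. cdist u w < e)"
  unfolding Ftop_eq
  by (rule subtopology_nbhd_topology_metric[OF assms]) (auto simp: Fset_iff efficient_labelling intro!: cdist_triangle)

text \<open>Stated for a subset \<open>A\<close> so that it serves the whole upper set as well as
  its maximal elements.\<close>

lemma homeomorphic_map_shift:
  assumes v: "efficient v" and A: "A \<subseteq> upset G X g v" "bij_betw (shift v) A B"
  shows "homeomorphic_map (nbhd_topology A (\<lambda>u w e. cdist u w < e)) (nbhd_topology B (\<lambda>u w e. cdist u w < e)) (shift v)"
proof (rule homeomorphic_map_nbhd_topology[OF A(2)])
  have cdist: "cdist (shift v a) (shift v b) = cdist a b" if "a \<in> A" "b \<in> A" for a b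
  proof -
    have "efficient a" "efficient b" "\<And>r. v r \<preceq> a r" "\<And>r. v r \<preceq> b r"
      using that A(1) unfolding subset_iff upset_iff[OF v] by blast+
    then show ?thesis using v by (intro cdist_shift) (auto intro: efficient_labelling labelling_shift)
  qed
  show "\<exists>d>0. \<forall>b\<in>A. cdist a b < d \<longrightarrow> cdist (shift v a) (shift v b) < e"
    "\<exists>d>0. \<forall>b\<in>A. cdist (shift v a) (shift v b) < d \<longrightarrow> cdist a b < e" if "a \<in> A" "0 < e" for a and e :: real
    using that cdist by auto
qed auto

lemma subwf_shift_iff:
  assumes v: "efficient v" and "a \<in> upset G X g v" "b \<in> upset G X g v"
  shows "subwf G X (shift v a) (shift v b) \<longleftrightarrow> subwf G X a b"
proof -
  have ab: "efficient a" "efficient b" "\<And>r. v r \<preceq> a r" "\<And>r. v r \<preceq> b r"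
    using assms(2,3) unfolding upset_iff[OF v] by blast+
  show ?thesis
    using ab v efficient_shift[OF v ab(1,3)] efficient_shift[OF v ab(2,4)]
    by (simp add: subwf_iff efficient_labelling pref_shift_iff)
qed

lemma shift_iso:
  assumes v: "efficient v" "rho G v \<preceq> g" and h': "h' \<in> M" "rho G v \<otimes> h' = g"
  shows "topposet_iso (subtopology (Ftop G X g) (upset G X g v)) (subwf G X)
                           (Ftop G X h') (subwf G X) (shift v)"
proof -
  have sub: "upset G X g v \<subseteq> Fset G X g" by (auto simp: upset_def)
  have "homeomorphic_map (subtopology (Ftop G X g) (upset G X g v)) (Ftop G X h') (shift v)"
    unfolding subtopology_Ftop[OF sub] Ftop_eq[of h']
    by (rule homeomorphic_map_shift[OF v(1) subset_refl shift_bij[OF v h']])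
  then show ?thesis
    unfolding topposet_iso_def subtopology_Ftop[OF sub]
    by (simp add: subwf_shift_iff[OF v(1)])
qed

section \<open>Maximal elements\<close>

lemma maximals_Fset:
  assumes "h' \<in> M" shows "maximals G X (Fset G X h') = {u. wfact G X h' u}"
proof (intro equalityI subsetI)
  fix u assume u: "u \<in> {u. wfact G X h' u}"
  then have eu: "efficient u" "rho G u = h'" by (auto simp: wfact_iff)
  have "w = u" if w: "w \<in> Fset G X h'" "subwf G X u w" for w
  proof
    fix r
    have ew: "efficient w" "rho G w \<preceq> h'" using w by (auto simp: Fset_iff)
    note labelling = efficient_labelling[OF eu(1)] efficient_labelling[OF ew(1)]
    have le: "u r \<preceq> w r" for r using w(2) labelling by (simp add: subwf_iff)
    let ?T = "nontriv u \<union> nontriv w"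
    have T: "finite ?T" using labelling by (simp add: labellingD)
    have "(\<Sum>r\<in>?T. len (w r)) = len (rho G w)" "(\<Sum>r\<in>?T. len (u r)) = len (rho G u)"
      using sum_len_nontriv[OF _ T] labelling eu ew by (auto simp: efficient_def)
    moreover have "(\<Sum>r\<in>?T. len (u r)) \<le> (\<Sum>r\<in>?T. len (w r))" using pref_len[OF le] by (rule sum_mono)
    \<comment> \<open>Lengths can only grow from \<open>u\<close> to \<open>w\<close>, but the total
      for \<open>w\<close> is at most \<open>len h'\<close>, which \<open>u\<close> attains.\<close>
    ultimately have eq: "(\<Sum>r\<in>?T. len (u r)) = (\<Sum>r\<in>?T. len (w r))"
      using pref_len[OF ew(2)] eu by simp
    show "w r = u r"
    proof (cases "r \<in> ?T")
      case True
      then have "len (u r) = len (w r)" by (rule sum_mono_inv[OF eq pref_len[OF le] _ T])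
      then show ?thesis using pref_len_eq[OF le[of r]] by simp
    qed (simp add: nontriv_def)
  qed
  then show "u \<in> maximals G X (Fset G X h')"
    using eu assms unfolding maximals_def by (auto simp: Fset_iff pref_refl)
next
  fix u assume "u \<in> maximals G X (Fset G X h')"
  then have u: "efficient u" "rho G u \<preceq> h'" and max: "\<And>w. w \<in> Fset G X h' \<Longrightarrow> subwf G X u w \<Longrightarrow> w = u"
    unfolding maximals_def by (auto simp: Fset_iff)
  note labelling = efficient_labelling[OF u(1)]
  define z where "z = inv (rho G u) \<otimes> h'"
  have z: "z \<in> M" "len (rho G u) + len z = len h'" using u(2) unfolding pref_iff z_def by auto
  have rz: "rho G u \<otimes> z = h'" using labelling M_carrier[OF assms] unfolding z_def by simp
  \<comment> \<open>The missing factor \<open>z\<close> is added at the last point 1, where it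
    enters the product from the right without conjugation.\<close>
  define w where "w = u(1 := u 1 \<otimes> z)"
  have w: "w r = (if r = 1 then u 1 \<otimes> z else u r)" for r by (simp add: w_def)
  have fw: "labelling w"
  proof -
    have "nontriv w \<subseteq> insert 1 (nontriv u)" by (auto simp: nontriv_def w)
    then show ?thesis using labellingD[OF labelling] z unfolding labelling_def w
      by (auto simp: w M_mult intro: finite_subset)
  qed
  \<comment> \<open>Removing 1 makes it the maximum of \<open>insert 1 S\<close>, whether or not
    \<open>u 1\<close> is trivial.\<close>
  define S where "S = nontriv u - {1}"
  have S: "finite S" "\<And>s. s \<in> S \<Longrightarrow> s < 1" "1 \<notin> S" using labellingD[OF labelling] unfolding S_def by force+
  have nS: "nontriv u \<subseteq> insert 1 S" "nontriv w \<subseteq> insert 1 S"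
    by (auto simp: S_def nontriv_def w split: if_splits)
  have "oprod u (nontriv u) = oprod u (insert 1 S)" "oprod w (nontriv w) = oprod w (insert 1 S)"
    using labelling fw S(1) nS by (intro oprod_neutral; auto simp: nontriv_def)+
  moreover have "oprod u (insert 1 S) = oprod u S \<otimes> u 1" "oprod w (insert 1 S) = oprod w S \<otimes> w 1"
    using labelling fw by (intro oprod_insert_max S; simp)+
  moreover have "oprod w S = oprod u S" by (rule oprod_cong) (auto simp: w S_def)
  ultimately have rw: "rho G w = h'"
    using rz labelling fw z(1) M_carrier by (simp add: rho_eq_oprod w m_assoc[symmetric] oprod_closed)
  have "(\<Sum>r\<in>insert 1 S. len (w r)) \<le> (\<Sum>r\<in>insert 1 S. len (u r)) + len z"
  proof -
    have "(\<Sum>r\<in>S. len (w r)) = (\<Sum>r\<in>S. len (u r))" using S(3) by (intro sum.cong) (auto simp: w)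
    then show ?thesis using S(1,3) len_mult_le[OF labellingD(1)[OF labelling] z(1), of 1] w[of 1] by simp
  qed
  moreover have "(\<Sum>r\<in>insert 1 S. len (u r)) = (\<Sum>r\<in>nontriv u. len (u r))"
    using labelling S nS by (intro sum_len_nontriv) auto
  moreover have "(\<Sum>r\<in>insert 1 S. len (w r)) = (\<Sum>r\<in>nontriv w. len (w r))"
    using fw S nS by (intro sum_len_nontriv) auto
  moreover have "len (rho G w) \<le> (\<Sum>r\<in>nontriv w. len (w r))"
    unfolding rho_eq_oprod[OF fw] using fw by (intro len_oprod_le) (auto simp: labellingD)
  moreover have eu: "(\<Sum>r\<in>nontriv u. len (u r)) = len (rho G u)" using u(1) by (simp add: efficient_def)
  ultimately have sw: "(\<Sum>r\<in>nontriv w. len (w r)) = len (rho G w)"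
    and lw: "(\<Sum>r\<in>insert 1 S. len (w r)) = (\<Sum>r\<in>insert 1 S. len (u r)) + len z"
    using z(2) rw by auto
  have "len (u 1 \<otimes> z) = len (u 1) + len z"
  proof -
    have "(\<Sum>r\<in>S. len (w r)) = (\<Sum>r\<in>S. len (u r))" using S(3) by (intro sum.cong) (auto simp: w)
    then show ?thesis using lw S(1,3) w[of 1] by simp
  qed
  then have "u 1 \<preceq> u 1 \<otimes> z" using labellingD(1)[OF labelling] z by (intro prefI) auto
  then have "subwf G X u w"
    using labelling fw by (simp add: subwf_iff w pref_refl labellingD)
  moreover have "w \<in> Fset G X h'" using fw sw rw assms by (simp add: Fset_iff efficient_def pref_refl)
  ultimately have "w = u" using max by blast
  then show "u \<in> {u. wfact G X h' u}" using rw u by (simp add: wfact_iff)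
qed

lemma shift_bij_maximals:
  assumes v: "efficient v" "rho G v \<preceq> g" and h': "h' \<in> M" "rho G v \<otimes> h' = g"
  shows "bij_betw (shift v) (maximals G X (upset G X g v)) {u. wfact G X h' u}"
proof -
  let ?U = "upset G X g v"
  have inj: "inj_on (shift v) ?U" and im: "shift v ` ?U = Fset G X h'"
    using shift_bij[OF v h'] by (simp_all add: bij_betw_def)
  have "shift v ` maximals G X ?U = maximals G X (shift v ` ?U)"
  proof (intro equalityI subsetI)
    fix w assume "w \<in> shift v ` maximals G X ?U"
    then obtain u where u: "u \<in> ?U" "\<And>w. w \<in> ?U \<Longrightarrow> subwf G X u w \<Longrightarrow> w = u" "w = shift v u"
      unfolding maximals_def by blast
    then show "w \<in> maximals G X (shift v ` ?U)"
      unfolding maximals_def by (auto simp: subwf_shift_iff[OF v(1)])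
  next
    fix w assume w: "w \<in> maximals G X (shift v ` ?U)"
    then obtain u where u: "u \<in> ?U" "w = shift v u" unfolding maximals_def by blast
    have "x = u" if x: "x \<in> ?U" "subwf G X u x" for x
    proof -
      have "shift v x = shift v u"
        using w x(1) subwf_shift_iff[OF v(1) u(1) x(1), THEN iffD2, OF x(2)]
        unfolding maximals_def u(2) by simp
      then show ?thesis using inj x u by (auto dest: inj_onD)
    qed
    then show "w \<in> shift v ` maximals G X ?U" using u unfolding maximals_def by blast
  qed
  moreover have "inj_on (shift v) (maximals G X ?U)"
    using inj by (rule inj_on_subset) (auto simp: maximals_def)
  ultimately show ?thesis
    unfolding bij_betw_def im using maximals_Fset[OF h'(1)] by simp
qed

end

subsection \<open>The order complex\<close>

lemma card_threshold_iff:
  assumes "simplex_param n t" "i < n"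
  shows "t i \<le> r \<longleftrightarrow> i < card {j. j < n \<and> t j \<le> r}"
proof -
  let ?A = "{j. j < n \<and> t j \<le> r}"
  have mono: "t j \<le> t k" if "j \<le> k" "k < n" for j k
    using assms(1) that unfolding simplex_param_def by blast
  show ?thesis
  proof
    assume "t i \<le> r"
    then have "{..i} \<subseteq> ?A" using mono[of _ i] assms(2) by fastforce
    from card_mono[OF _ this] show "i < card ?A" by simp
  next
    assume i: "i < card ?A"
    show "t i \<le> r"
    proof (rule ccontr)
      assume "\<not> t i \<le> r"
      then have "\<not> i \<le> j" if "j \<in> ?A" for j using mono[of i j] that by auto
      then have "?A \<subseteq> {..<i}" by (auto simp: not_le)
      from card_mono[OF _ this] i show False by simp
    qed
  qed
qed

lemma card_threshold_le: "card {j. j < n \<and> t j \<le> r} \<le> n" for t :: "nat \<Rightarrow> real"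
  using card_mono[of "{..<n}" "{j. j < n \<and> t j \<le> r}"] by auto

text \<open>The jump times of a step function with \<open>n\<close> jumps at \<open>t 0, \<dots>, t (n - 1)\<close>, completed by
  \<open>0\<close> at index \<open>0\<close> and \<open>1\<close> at index \<open>n + 1\<close>.\<close>
definition jumps :: "nat \<Rightarrow> (nat \<Rightarrow> real) \<Rightarrow> nat \<Rightarrow> real" where
  "jumps n t k = (if k = 0 then 0 else if k \<le> n then t (k - 1) else 1)"

text \<open>The end values 0 and 1 of \<open>jumps\<close> account for the first and the last
  interval, as \<open>r\<close> ranges over [0, 1).\<close>

lemma card_threshold_eq_iff:
  assumes "simplex_param n t" "k \<le> n" "0 \<le> r" "r < 1"
  shows "card {j. j < n \<and> t j \<le> r} = k \<longleftrightarrow> jumps n t k \<le> r \<and> r < jumps n t (Suc k)"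
proof -
  let ?K = "card {j. j < n \<and> t j \<le> r}"
  have "jumps n t k \<le> r \<longleftrightarrow> k \<le> ?K"
    using card_threshold_iff[OF assms(1), of "k - 1" r] assms by (cases k) (auto simp: jumps_def)
  moreover have "r < jumps n t (Suc k) \<longleftrightarrow> ?K \<le> k"
    using card_threshold_iff[OF assms(1), of k r] card_threshold_le[of n t r] assms
    by (cases "k = n") (auto simp: jumps_def)
  ultimately show ?thesis by auto
qed

lemma jumps_mono:
  assumes "simplex_param n t" "k \<le> n" shows "jumps n t k \<le> jumps n t (Suc k)" "0 \<le> jumps n t k" "jumps n t (Suc k) \<le> 1"
  using assms unfolding jumps_def simplex_param_def by (auto split: if_splits)

context conj_closed_group
begin

text \<open>Unlike that of \<open>cdist\<close>, the window ends at 1, so that the weights sum to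
  1.\<close>

definition bary :: "(real \<Rightarrow> 'a) \<Rightarrow> 'a \<Rightarrow> real" where
  "bary u z = measure lborel {r \<in> {0..<1}. cum u r = z}"

lemma flag_inject: "flag x c \<Longrightarrow> i < length c \<Longrightarrow> j < length c \<Longrightarrow> c ! i = c ! j \<longleftrightarrow> i = j"
  using flag_less(2)[of x c i j] flag_less(2)[of x c j i] by (metis linorder_neqE_nat)

lemma flag_length: "flag x c \<Longrightarrow> length c = Suc (length c - 1)"
  by (auto simp: flag_def)

lemma bary_flag:
  assumes c: "flag x c" and t: "simplex_param (length c - 1) t"
    and u: "u = charpt G \<one> (quots c) \<one> t" and k: "k \<le> length c - 1"
  shows "bary u (c ! k) = jumps (length c - 1) t (Suc k) - jumps (length c - 1) t k"
proof -
  let ?n = "length c - 1"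
  have "{r \<in> {0..<1}. cum u r = c ! k} = {jumps ?n t k..<jumps ?n t (Suc k)}"
  proof (rule Set.set_eqI)
    fix r
    have len: "card {j. j < ?n \<and> t j \<le> r} < length c" "k < length c"
      using card_threshold_le[of ?n t r] k flag_length[OF c] by auto
    show "r \<in> {r \<in> {0..<1}. cum u r = c ! k} \<longleftrightarrow> r \<in> {jumps ?n t k..<jumps ?n t (Suc k)}"
    proof (cases "0 \<le> r \<and> r < 1")
      case True
      then show ?thesis
        unfolding u using card_threshold_eq_iff[OF t k, of r] flag_inject[OF c len]
        by (simp add: flag_cell(3)[OF c t])
    next
      case False
      then show ?thesis using jumps_mono[OF t k] by auto
    qed
  qed
  then show ?thesis using jumps_mono(1)[OF t k] by (simp add: bary_def)
qed

lemma bary_outside: "z \<notin> range (cum u) \<Longrightarrow> bary u z = 0"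
proof -
  assume "z \<notin> range (cum u)"
  then have "{r \<in> {0..<1}. cum u r = z} = {}" by blast
  then show ?thesis unfolding bary_def by (simp only: measure_empty)
qed

text \<open>The interval lengths telescope. Tail sums are what \<open>orth_coord\<close> consists
  of, and they return the jump times.\<close>

lemma bary_tail:
  assumes c: "flag x c" and t: "simplex_param (length c - 1) t"
    and u: "u = charpt G \<one> (quots c) \<one> t" and m: "m \<le> length c - 1"
  shows "(\<Sum>k\<in>{m..length c - 1}. bary u (c ! k)) = 1 - jumps (length c - 1) t m"
proof -
  let ?n = "length c - 1"
  have "(\<Sum>k\<in>{m..?n}. bary u (c ! k)) = (\<Sum>k\<in>{m..?n}. jumps ?n t (Suc k) - jumps ?n t k)"
    by (intro sum.cong) (auto simp: bary_flag[OF c t u])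
  also have "\<dots> = jumps ?n t (Suc ?n) - jumps ?n t m" using m by (intro sum_Suc_diff) simp
  finally show ?thesis by (simp add: jumps_def)
qed

lemma length_orth_coord [simp]: "length (orth_coord c p) = length c - 1"
  unfolding orth_coord_def Let_def length_map length_upt by (rule diff_add_inverse2)

lemma orth_coord_nth:
  "j < length c - 1 \<Longrightarrow> orth_coord c p ! j = (\<Sum>i\<in>{length c - 1 - j..length c - 1}. p (c ! i))"
  unfolding orth_coord_def Let_def by (subst nth_map) (auto simp del: upt_Suc)

text \<open>The coordinates are reflected because \<open>orth_coord\<close> sums the weights from the top of the chain.\<close>
lemma orth_coord_bary:
  assumes "flag x c" "simplex_param (length c - 1) t" "u = charpt G \<one> (quots c) \<one> t" "j < length c - 1"
  shows "orth_coord c (bary u) ! j = 1 - t (length c - 2 - j)"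
proof -
  have "length c - 1 - j = Suc (length c - 2 - j)" "length c - 1 - j \<le> length c - 1"
    using assms(4) by linarith+
  then show ?thesis
    unfolding orth_coord_nth[OF assms(4)]
    using bary_tail[OF assms(1-3), of "length c - 1 - j"] by (simp add: jumps_def)
qed

lemma bary_pos:
  assumes "labelling u" "0 \<le> r" "r < 1" shows "bary u (cum u r) \<noteq> 0"
proof -
  obtain q where q: "r < q" "\<And>s. r \<le> s \<Longrightarrow> s < q \<Longrightarrow> cum u s = cum u r"
    using cum_right[OF assms(1)] by blast
  have "{r' \<in> {0..<1}. cum u r' = cum u r} \<in> fmeasurable lborel"
  proof (rule fmeasurableI2)
    show "{0..2::real} \<in> fmeasurable lborel"
      using emeasure_bounded_finite[of "{0..2::real}"] by (intro fmeasurableI) auto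
    have "{0..<1} \<inter> {r'. cum u r' = cum u r} \<in> sets borel"
      using cum_sets_borel[OF assms(1,1), of "\<lambda>a b. a = cum u r"] by (intro sets.Int) auto
    moreover have "{0..<1} \<inter> {r'. cum u r' = cum u r} = {r' \<in> {0..<1}. cum u r' = cum u r}" by blast
    ultimately show "{r' \<in> {0..<1}. cum u r' = cum u r} \<in> sets lborel" by simp
  qed auto
  moreover have "{r..<min q 1} \<subseteq> {r' \<in> {0..<1}. cum u r' = cum u r}"
  proof
    fix s assume "s \<in> {r..<min q 1}"
    then show "s \<in> {r' \<in> {0..<1}. cum u r' = cum u r}" using q(2)[of s] assms(2) by simp
  qed
  ultimately have "measure lborel {r..<min q 1} \<le> bary u (cum u r)"
    unfolding bary_def by (intro measure_mono_fmeasurable) simp_all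
  moreover have "measure lborel {r..<min q 1} = min q 1 - r" using q(1) assms(3) by (intro measure_lborel_Ico) simp
  ultimately show ?thesis using q(1) assms(3) by auto
qed

text \<open>A value taken in [0, 1) is held for a positive time. Values taken only outside,
  \<open>\<one>\<close> and \<open>rho G u\<close>, may have weight 0 and are therefore asked for
  separately.\<close>

lemma range_cum_subset_of_bary:
  assumes "labelling u" "\<one> \<in> C" "rho G u \<in> C" "{z. bary u z \<noteq> 0} \<subseteq> C"
  shows "range (cum u) \<subseteq> C"
proof
  fix z assume "z \<in> range (cum u)"
  then obtain r where z: "z = cum u r" by blast
  consider "r < 0" | "0 \<le> r" "r < 1" | "1 \<le> r" by linarith
  then show "z \<in> C"
    using cum_neg[OF assms(1), of r] cum_ge_one[OF assms(1), of r] bary_pos[OF assms(1), of r] assms z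
    by cases auto
qed

lemma is_chain_iff: "is_chain G X x C \<longleftrightarrow> (\<forall>a\<in>C. a \<preceq> x) \<and> (\<forall>a\<in>C. \<forall>b\<in>C. a \<preceq> b \<or> b \<preceq> a)"
  by (auto simp: is_chain_def intv_def)

lemma is_chain_subset: "is_chain G X x C \<Longrightarrow> B \<subseteq> C \<Longrightarrow> is_chain G X x B"
  unfolding is_chain_iff by blast

text \<open>On a chain \<open>len\<close> is injective with values up to \<open>len x\<close>; this
  bounds chains even in an infinite interval.\<close>

lemma is_chain_finite:
  assumes "is_chain G X x C" shows "finite C" "card C \<le> Suc (len x)"
proof -
  have inj: "inj_on len C"
    using assms pref_len_eq unfolding is_chain_iff inj_on_def by (metis order_refl)
  have sub: "len ` C \<subseteq> {..len x}" using assms pref_len unfolding is_chain_iff by auto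
  show "finite C" using inj_on_finite[OF inj sub] by simp
  show "card C \<le> Suc (len x)" using card_inj_on_le[OF inj sub] by simp
qed

lemma maxchain_extend:
  assumes "is_chain G X x C" obtains c where "maxchain G X x c" "C \<subseteq> set c"
proof -
  let ?P = "\<lambda>B. is_chain G X x B \<and> C \<subseteq> B"
  have "\<exists>B. ?P B \<and> (\<forall>B'. ?P B' \<longrightarrow> card B' \<le> card B)"
    using assms is_chain_finite(2) by (intro ex_has_greatest_nat[of ?P C card "Suc (Suc (len x))"]) (auto simp: less_Suc_eq_le)
  then obtain B where B: "is_chain G X x B" "C \<subseteq> B" "\<And>B'. ?P B' \<Longrightarrow> card B' \<le> card B" by blast
  obtain c where c: "set c = B" "sorted_wrt (\<lambda>a b. a \<preceq> b \<and> a \<noteq> b) c"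
    using chain_sorted_list[OF is_chain_finite(1)[OF B(1)]] B(1) unfolding is_chain_iff by metis
  have "B' = B" if "is_chain G X x B'" "B \<subseteq> B'" for B'
    using card_seteq[OF is_chain_finite(1)[OF that(1)] that(2)] B(2,3) that by blast
  then have "maxchain G X x c" using c B(1) unfolding maxchain_def by auto
  then show thesis using that c B by blast
qed

text \<open>Adding \<open>\<one>\<close> and \<open>x\<close> to a chain below \<open>x\<close>
  keeps it a chain, so a maximal one already contains them.\<close>

lemma maxchain_flag:
  assumes "x \<in> M" "maxchain G X x c" shows "flag x c" "length c - 1 \<le> len x"
proof -
  have ch: "is_chain G X x (set c)" using assms(2) by (simp add: maxchain_def)
  have "is_chain G X x (insert \<one> (insert x (set c)))"
    using ch assms(1) prefD_M one_pref pref_refl unfolding is_chain_iff by auto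
  then have eq: "insert \<one> (insert x (set c)) = set c"
    using assms(2) unfolding maxchain_def by blast
  then have "\<one> \<in> set c" "x \<in> set c" by blast+
  then show f: "flag x c"
    using assms(2) ch unfolding maxchain_def is_chain_iff by (intro flagI) auto
  have "card (set c) = length c"
    using flag_inject[OF f] by (intro distinct_card) (simp add: distinct_conv_nth)
  then show "length c - 1 \<le> len x" using is_chain_finite(2)[OF ch] by simp
qed

lemma is_chain_range_cum: "efficient u \<Longrightarrow> is_chain G X (rho G u) (range (cum u))"
  unfolding is_chain_iff using cum_pref_rho cum_comparable by auto

lemma bary_opoints:
  assumes "efficient u" shows "bary u \<in> opoints G X (rho G u)"
proof -
  obtain c where c: "flag (rho G u) c" "set c = range (cum u)" using range_cum_flag[OF assms] by blast
  obtain t where t: "simplex_param (length c - 1) t" "u = charpt G \<one> (quots c) \<one> t"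
    using flag_coordinates[OF assms refl c(1)] c(2) by auto
  have sub: "{z. bary u z \<noteq> 0} \<subseteq> set c" using bary_outside c(2) by blast
  have "sum (bary u) {z. bary u z \<noteq> 0} = sum (bary u) (set c)"
    using sub by (intro sum.mono_neutral_left) auto
  also have "set c = (!) c ` {0..length c - 1}"
    using flag_length[OF c(1)] by (auto simp: set_conv_nth image_iff less_Suc_eq_le)
  also have "sum (bary u) ((!) c ` {0..length c - 1}) = (\<Sum>k\<in>{0..length c - 1}. bary u (c ! k))"
    using flag_inject[OF c(1)] flag_length[OF c(1)]
    by (subst sum.reindex) (auto simp: inj_on_def less_Suc_eq_le)
  also have "\<dots> = 1" by (subst bary_tail[OF c(1) t]) (auto simp: jumps_def)
  finally have sum: "sum (bary u) {z. bary u z \<noteq> 0} = 1" .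
  have "is_chain G X (rho G u) {z. bary u z \<noteq> 0}"
    using is_chain_subset[OF is_chain_range_cum[OF assms]] sub c(2) by simp
  moreover have "finite {z. bary u z \<noteq> 0}" using sub finite_subset by blast
  ultimately show ?thesis
    unfolding opoints_def using sum by (simp add: bary_def)
qed

section \<open>Comparison of \<open>cdist\<close> with the orthoscheme metric\<close>

lemma cdist_le_flag:
  assumes c: "flag x c" and t: "simplex_param (length c - 1) t" "simplex_param (length c - 1) t'"
    and u: "u = charpt G \<one> (quots c) \<one> t" and w: "w = charpt G \<one> (quots c) \<one> t'"
  shows "cdist u w \<le> (\<Sum>i<length c - 1. \<bar>t i - t' i\<bar>)"
proof (rule cdist_le_thresholds)
  show "labelling u" "labelling w" unfolding u w using flag_cell(1)[OF c] t efficient_labelling by auto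
  show "t i \<le> r \<longleftrightarrow> i < card {i. i < length c - 1 \<and> t i \<le> r}"
    "t' i \<le> r \<longleftrightarrow> i < card {i. i < length c - 1 \<and> t' i \<le> r}" if "i < length c - 1" for i r
    using that card_threshold_iff t by blast+
  show "card {i. i < length c - 1 \<and> t i \<le> r} \<le> length c - 1"
    "card {i. i < length c - 1 \<and> t' i \<le> r} \<le> length c - 1" for r
    by (rule card_threshold_le)+
  show "card {i. i < length c - 1 \<and> t i \<le> r} = card {i. i < length c - 1 \<and> t' i \<le> r} \<Longrightarrow> cum u r = cum w r" for r
    unfolding u w by (simp only: flag_cell(3)[OF c t(1)] flag_cell(3)[OF c t(2)])
qed

lemma coordinate_diff_le_cdist:
  assumes c: "flag x c" and t: "simplex_param (length c - 1) t" "simplex_param (length c - 1) t'"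
    and u: "u = charpt G \<one> (quots c) \<one> t" and w: "w = charpt G \<one> (quots c) \<one> t'"
    and i: "i < length c - 1"
  shows "\<bar>t i - t' i\<bar> \<le> cdist u w"
\<comment> \<open>Lengths increase strictly along the flag, so this predicate detects the values
  beyond \<open>c ! i\<close>, that is, whether jump \<open>i\<close> has happened.\<close>
proof (rule threshold_diff_le_cdist[where P = "\<lambda>z. len (c ! i) < len z"])
  show "labelling u" "labelling w" unfolding u w using flag_cell(1)[OF c] t efficient_labelling by auto
  have less: "len (c ! i) < len (c ! k) \<longleftrightarrow> i < k" if "k \<le> length c - 1" for k
  proof -
    have "i < length c" "k < length c" using i that flag_length[OF c] by auto
    then show ?thesis
      using flag_less(3)[OF c, of i k] flag_less(3)[OF c, of k i] by (metis less_asym less_irrefl linorder_neqE_nat)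
  qed
  show "t i \<le> r \<longleftrightarrow> len (c ! i) < len (cum u r)" "t' i \<le> r \<longleftrightarrow> len (c ! i) < len (cum w r)" for r
    unfolding u w flag_cell(3)[OF c t(1)] flag_cell(3)[OF c t(2)]
    by (simp_all only: less[OF card_threshold_le] card_threshold_iff[OF t(1) i] card_threshold_iff[OF t(2) i])
  have "t i \<le> 1" "t' i \<le> 1" using t i unfolding simplex_param_def by auto
  then show "t i \<le> 2" "t' i \<le> 2" by simp_all
  show "0 \<le> t i" "0 \<le> t' i" using t i unfolding simplex_param_def by auto
qed

text \<open>Close to \<open>u\<close>, \<open>cum w\<close> still takes every value of
  \<open>cum u\<close>, so one maximal chain contains both supports and a string of one step
  suffices.\<close>

lemma o_near_of_cdist_less:
  assumes u: "efficient u" "rho G u = x" and e: "0 < e"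
  obtains d where "0 < d"
    "\<And>w. efficient w \<Longrightarrow> rho G w = x \<Longrightarrow> cdist u w < d \<Longrightarrow> o_near G X x (bary u) (bary w) e"
proof -
  have x: "x \<in> M" using u cum_M[of u 1] cum_ge_one[of u 1] efficient_labelling by auto
  obtain d where d: "0 < d" "\<And>w. efficient w \<Longrightarrow> cdist u w < d \<Longrightarrow> range (cum u) \<subseteq> range (cum w)"
    using range_cum_subset_of_near[OF u(1)] by blast
  let ?d = "min d (e / (len x + 1))"
  have "o_near G X x (bary u) (bary w) e" if w: "efficient w" "rho G w = x" "cdist u w < ?d" for w
  proof -
    have "range (cum u) \<subseteq> range (cum w)" using d(2)[OF w(1)] w(3) by simp
    obtain c where c: "maxchain G X x c" "range (cum w) \<subseteq> set c"
      using maxchain_extend[OF is_chain_range_cum[OF w(1)]] w(2) by auto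
    note f = maxchain_flag[OF x c(1)]
    have cu: "range (cum u) \<subseteq> set c" using c \<open>range (cum u) \<subseteq> range (cum w)\<close> by blast
    obtain t where t: "simplex_param (length c - 1) t" "u = charpt G \<one> (quots c) \<one> t"
      using flag_coordinates[OF u f(1) cu] by blast
    obtain t' where t': "simplex_param (length c - 1) t'" "w = charpt G \<one> (quots c) \<one> t'"
      using flag_coordinates[OF w(1,2) f(1) c(2)] by blast
    let ?l = "ldist (orth_coord c (bary u)) (orth_coord c (bary w))"
    have "{z. bary u z \<noteq> 0} \<subseteq> set c" "{z. bary w z \<noteq> 0} \<subseteq> set c"
      using bary_outside cu c(2) by blast+
    then have step: "ostep G X x (bary u) (bary w) ?l"
      unfolding ostep_def using c(1) by blast
    have "?l \<le> (\<Sum>j<length c - 1. \<bar>orth_coord c (bary u) ! j - orth_coord c (bary w) ! j\<bar>)"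
      by (intro ldist_le_sum) simp_all
    also have "\<dots> \<le> (\<Sum>j<length c - 1. cdist u w)"
    proof (rule sum_mono)
      fix j assume j: "j \<in> {..<length c - 1}"
      then have "orth_coord c (bary u) ! j - orth_coord c (bary w) ! j = t' (length c - 2 - j) - t (length c - 2 - j)"
        using orth_coord_bary[OF f(1) t] orth_coord_bary[OF f(1) t'] by simp
      moreover have "\<bar>t (length c - 2 - j) - t' (length c - 2 - j)\<bar> \<le> cdist u w"
        using j by (intro coordinate_diff_le_cdist[OF f(1) t(1) t'(1) t(2) t'(2)]) auto
      ultimately show "\<bar>orth_coord c (bary u) ! j - orth_coord c (bary w) ! j\<bar> \<le> cdist u w" by simp
    qed
    also have "\<dots> \<le> len x * cdist u w"
      using f(2) by (simp add: mult_right_mono cdist_def)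
    also have "\<dots> \<le> len x * (e / (len x + 1))" using w(3) by (intro mult_left_mono) auto
    also have "\<dots> < e" using e by (simp add: field_simps)
    finally have "?l < e" .
    then show ?thesis
      unfolding o_near_def using step by (intro exI[of _ "[bary u, bary w]"] exI[of _ "[?l]"]) auto
  qed
  then show thesis using d(1) e by (intro that[of ?d]) auto
qed

text \<open>The intermediate points of a string in \<open>o_near\<close> need not have nonnegative weights of sum 1,
  and their weight at \<open>\<one>\<close> does not enter the coordinates. Distances are therefore controlled
  weight by weight, away from \<open>\<one>\<close>.\<close>
lemma ostep_pointwise:
  assumes x: "x \<in> M" and step: "ostep G X x p q d" and z: "z \<noteq> \<one>"
  shows "\<bar>p z - q z\<bar> \<le> 2 * d"
proof -
  obtain c where c: "maxchain G X x c" "{z. p z \<noteq> 0} \<subseteq> set c" "{z. q z \<noteq> 0} \<subseteq> set c"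
    and d: "d = ldist (orth_coord c p) (orth_coord c q)"
    using step unfolding ostep_def by blast
  note f = maxchain_flag(1)[OF x c(1)]
  let ?n = "length c - 1"
  show ?thesis
  proof (cases "z \<in> set c")
    case False
    then have "p z = 0" "q z = 0" using c by blast+
    then show ?thesis using ldist_nonneg d by simp
  next
    case True
    then obtain i where i: "i < length c" "z = c ! i" by (auto simp: in_set_conv_nth)
    have i0: "0 < i" using i z f by (cases i) (auto simp: flag_def)
    \<comment> \<open>The coordinates are the tail sums from the indices 1 to \<open>?n\<close>; the
      full sum from index 0 is not among them.\<close>
    have tail: "\<bar>(\<Sum>k\<in>{m..?n}. p (c ! k)) - (\<Sum>k\<in>{m..?n}. q (c ! k))\<bar> \<le> d" if m: "0 < m" for m
    proof (cases "m \<le> ?n")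
      case True
      then have j: "?n - m < ?n" "?n - (?n - m) = m" using m by auto
      show ?thesis
        using abs_nth_diff_le_ldist[of "orth_coord c p" ?n "orth_coord c q" "?n - m"] j
        unfolding d by (simp add: orth_coord_nth)
    qed (simp add: d ldist_nonneg)
    have "(\<Sum>k\<in>{i..?n}. s (c ! k)) = s z + (\<Sum>k\<in>{Suc i..?n}. s (c ! k))" for s :: "'a \<Rightarrow> real"
      using i by (subst sum.atLeast_Suc_atMost) auto
    \<comment> \<open>A weight is the difference of two consecutive tail sums, hence the factor
      2.\<close>
    then have "p z - q z = ((\<Sum>k\<in>{i..?n}. p (c ! k)) - (\<Sum>k\<in>{i..?n}. q (c ! k))) -
        ((\<Sum>k\<in>{Suc i..?n}. p (c ! k)) - (\<Sum>k\<in>{Suc i..?n}. q (c ! k)))"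
      by simp
    then show ?thesis using tail[OF i0] tail[OF zero_less_Suc[of i]] by linarith
  qed
qed

lemma o_near_pointwise:
  assumes x: "x \<in> M" and near: "o_near G X x p q e" and z: "z \<noteq> \<one>"
  shows "\<bar>p z - q z\<bar> \<le> 2 * e"
proof -
  obtain ps ds where ps: "ps \<noteq> []" "hd ps = p" "last ps = q" "length ds = length ps - 1"
    and step: "\<And>i. i < length ds \<Longrightarrow> ostep G X x (ps ! i) (ps ! Suc i) (ds ! i)" and sum: "sum_list ds < e"
    using near unfolding o_near_def by blast
  have "\<bar>p z - (ps ! k) z\<bar> \<le> 2 * (\<Sum>i<k. ds ! i)" if "k \<le> length ds" for k
    using that
  proof (induction k)
    case 0 then show ?case using ps by (simp add: hd_conv_nth[symmetric])
  next
    case (Suc k)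
    then show ?case using ostep_pointwise[OF x step[of k] z] by simp
  qed
  from this[of "length ds"] have "\<bar>p z - q z\<bar> \<le> 2 * (\<Sum>i<length ds. ds ! i)"
    using ps by (simp add: last_conv_nth)
  also have "(\<Sum>i<length ds. ds ! i) = sum_list ds" by (simp add: sum_list_sum_nth atLeast0LessThan)
  finally show ?thesis using sum by simp
qed

text \<open>A string may run through many simplices, but weights away from \<open>\<one>\<close>
  change little along it. So none of those positive at \<open>u\<close> vanishes at
  \<open>w\<close>, both points lie in one closed simplex, and their jump times can be compared
  there.\<close>

lemma cdist_less_of_o_near:
  assumes u: "efficient u" "rho G u = x" and e: "0 < e"
  obtains d where "0 < d"
    "\<And>w. efficient w \<Longrightarrow> rho G w = x \<Longrightarrow> o_near G X x (bary u) (bary w) d \<Longrightarrow> cdist u w < e"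
proof -
  have x: "x \<in> M" using u cum_M[of u 1] cum_ge_one[of u 1] efficient_labelling by auto
  let ?S = "{z. bary u z \<noteq> 0}"
  have fin: "finite ?S" using bary_opoints[OF u(1)] by (simp add: opoints_def)
  define m where "m = Min (insert 1 (bary u ` ?S))"
  have "0 < bary u z" if "z \<in> ?S" for z
    using that unfolding bary_def mem_Collect_eq by (subst zero_less_measure_iff)
  then have m: "0 < m" unfolding m_def using fin by (subst Min_gr_iff) auto
  have m_le: "m \<le> bary u z" if "z \<in> ?S" for z
    unfolding m_def using that fin by (intro Min_le) auto
  let ?N = "real (len x)"
  \<comment> \<open>\<open>m / 4\<close> keeps the change \<open>2 * ?d\<close> of a weight below
    the least positive weight. The other bound serves at most \<open>?N\<close> jump times, each a
    sum of at most \<open>?N\<close> weights; the summand 1 covers \<open>?N = 0\<close>.\<close>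
  let ?d = "min (m / 4) (e / (2 * ?N * ?N + 1))"
  have "cdist u w < e" if w: "efficient w" "rho G w = x" "o_near G X x (bary u) (bary w) ?d" for w
  proof -
    have close: "\<bar>bary u z - bary w z\<bar> \<le> 2 * ?d" if "z \<noteq> \<one>" for z
      using o_near_pointwise[OF x w(3) that] .
    have one: "\<one> \<in> range (cum w)" "x \<in> range (cum w)"
      using one_rho_in_range_cum[OF efficient_labelling[OF w(1)]] w(2) by auto
    have "?S \<subseteq> range (cum w)"
    proof
      fix z assume z: "z \<in> ?S"
      show "z \<in> range (cum w)"
      proof (rule ccontr)
        assume nz: "z \<notin> range (cum w)"
        \<comment> \<open>The uncontrolled weight at \<open>\<one>\<close> does no harm, since
          \<open>\<one>\<close> is always a value of \<open>cum w\<close>.\<close>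
        then have "z \<noteq> \<one>" "bary w z = 0" using one bary_outside by auto
        then show False using close[of z] m_le[OF z] m by auto
      qed
    qed
    then have sub: "range (cum u) \<subseteq> range (cum w)"
      using one u by (intro range_cum_subset_of_bary) (auto simp: efficient_labelling)
    obtain c where c: "maxchain G X x c" "range (cum w) \<subseteq> set c"
      using maxchain_extend[OF is_chain_range_cum[OF w(1)]] w(2) by auto
    note f = maxchain_flag[OF x c(1)]
    let ?n = "length c - 1"
    obtain t where t: "simplex_param ?n t" "u = charpt G \<one> (quots c) \<one> t"
      using flag_coordinates[OF u f(1) order_trans[OF sub c(2)]] by blast
    obtain t' where t': "simplex_param ?n t'" "w = charpt G \<one> (quots c) \<one> t'"
      using flag_coordinates[OF w(1,2) f(1) c(2)] by blast
    have "cdist u w \<le> (\<Sum>i<?n. \<bar>t i - t' i\<bar>)"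
      by (rule cdist_le_flag[OF f(1) t(1) t'(1) t(2) t'(2)])
    also have "\<dots> \<le> (\<Sum>i<?n. ?N * (2 * ?d))"
    proof (rule sum_mono)
      fix i assume "i \<in> {..<?n}"
      then have i: "Suc i \<le> ?n" by simp
      have "t' i - t i = (\<Sum>k\<in>{Suc i..?n}. bary u (c ! k)) - (\<Sum>k\<in>{Suc i..?n}. bary w (c ! k))"
        using i bary_tail[OF f(1) t i] bary_tail[OF f(1) t' i] by (simp add: jumps_def)
      also have "\<dots> = (\<Sum>k\<in>{Suc i..?n}. bary u (c ! k) - bary w (c ! k))" by (simp add: sum_subtractf)
      finally have "\<bar>t i - t' i\<bar> = \<bar>\<Sum>k\<in>{Suc i..?n}. bary u (c ! k) - bary w (c ! k)\<bar>" by simp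
      also have "\<dots> \<le> (\<Sum>k\<in>{Suc i..?n}. \<bar>bary u (c ! k) - bary w (c ! k)\<bar>)" by (rule sum_abs)
      also have "\<dots> \<le> (\<Sum>k\<in>{Suc i..?n}. 2 * ?d)"
      proof (intro sum_mono close)
        fix k assume "k \<in> {Suc i..?n}"
        then have "0 < k" "k < length c" using flag_length[OF f(1)] by auto
        then show "c ! k \<noteq> \<one>" using flag_less(2)[OF f(1), of 0 k] f(1) by (auto simp: flag_def)
      qed
      also have "\<dots> = real (?n - i) * (2 * ?d)" using i by simp
      also have "\<dots> \<le> ?N * (2 * ?d)"
        using f(2) m e by (intro mult_right_mono) (auto simp: min_def)
      finally show "\<bar>t i - t' i\<bar> \<le> ?N * (2 * ?d)" .
    qed
    also have "\<dots> = real ?n * (?N * (2 * ?d))" by simp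
    also have "\<dots> \<le> ?N * (?N * (2 * ?d))"
      using f(2) m e by (intro mult_right_mono) (auto simp: min_def)
    also have "\<dots> \<le> ?N * (?N * (2 * (e / (2 * ?N * ?N + 1))))"
      by (intro mult_left_mono) auto
    also have "\<dots> < e"
    proof -
      have "0 < 2 * ?N * ?N + 1" by (simp add: add_nonneg_pos)
      then show ?thesis using e by (simp add: field_simps)
    qed
    finally show ?thesis .
  qed
  moreover have "0 < ?d" using m e by (simp add: add_nonneg_pos)
  ultimately show thesis by (intro that[of ?d]) auto
qed

text \<open>\<open>w\<close> has the same support of weights as \<open>u\<close>, so both lie in the
  closed cell of the flag of \<open>u\<close>, where the tail sums determine the jump times.\<close>

lemma bary_inject:
  assumes u: "efficient u" "rho G u = x" and w: "efficient w" "rho G w = x" and eq: "bary u = bary w"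
  shows "u = w"
proof -
  obtain c where f: "flag x c" and c: "set c = range (cum u)" using range_cum_flag[OF u(1)] u(2) by auto
  have sub: "range (cum w) \<subseteq> set c"
  proof (rule range_cum_subset_of_bary)
    show "\<one> \<in> set c" "rho G w \<in> set c"
      using one_rho_in_range_cum[OF efficient_labelling[OF u(1)]] u w c by auto
    show "{z. bary w z \<noteq> 0} \<subseteq> set c" using bary_outside[of _ u] c eq by auto
  qed (use w efficient_labelling in auto)
  let ?n = "length c - 1"
  obtain t where t: "simplex_param ?n t" "u = charpt G \<one> (quots c) \<one> t"
    using flag_coordinates[OF u f] c by auto
  obtain t' where t': "simplex_param ?n t'" "w = charpt G \<one> (quots c) \<one> t'"
    using flag_coordinates[OF w f sub] by blast
  have "t i = t' i" if "i < ?n" for i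
  proof -
    have i: "Suc i \<le> ?n" using that by simp
    show ?thesis
      using bary_tail[OF f t i] bary_tail[OF f t' i] eq i by (simp add: jumps_def)
  qed
  then have "{i. i < ?n \<and> t i \<le> r} = {i. i < ?n \<and> t' i \<le> r}" for r by auto
  then have "cum u r = cum w r" for r
    unfolding t(2) t'(2) flag_cell(3)[OF f t(1)] flag_cell(3)[OF f t'(1)] by simp
  then show ?thesis using u w efficient_labelling by (intro cum_inject) auto
qed

lemma bary_surj:
  assumes x: "x \<in> M" and p: "p \<in> opoints G X x"
  obtains u where "efficient u" "rho G u = x" "bary u = p"
proof -
  have pn: "0 \<le> p z" for z using p by (simp add: opoints_def)
  obtain c where c: "maxchain G X x c" "{z. p z \<noteq> 0} \<subseteq> set c"
    using maxchain_extend[of x "{z. p z \<noteq> 0}"] p by (auto simp: opoints_def)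
  note f = maxchain_flag(1)[OF x c(1)]
  let ?n = "length c - 1"
  have "1 = sum p {z. p z \<noteq> 0}" using p by (simp add: opoints_def)
  also have "\<dots> = sum p (set c)" using c(2) by (intro sum.mono_neutral_left) auto
  also have "set c = (!) c ` {..<Suc ?n}"
    using flag_length[OF f] by (auto simp: set_conv_nth image_iff)
  also have "sum p ((!) c ` {..<Suc ?n}) = (\<Sum>k<Suc ?n. p (c ! k))"
    using flag_inject[OF f] flag_length[OF f] by (subst sum.reindex) (auto simp: inj_on_def)
  finally have one: "(\<Sum>k<Suc ?n. p (c ! k)) = 1" by simp
  \<comment> \<open>The step function stays at \<open>c ! k\<close> for time
    \<open>p (c ! k)\<close>, so it leaves \<open>c ! i\<close> once the weights up to index
    \<open>i\<close> are used up.\<close>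
  define t where "t i = (\<Sum>k<Suc i. p (c ! k))" for i
  have mono: "(\<Sum>k<i. p (c ! k)) \<le> (\<Sum>k<j. p (c ! k))" if "i \<le> j" for i j
    using that pn by (intro sum_mono2) auto
  have t: "simplex_param ?n t"
    unfolding simplex_param_def t_def
  proof (intro conjI allI impI)
    show "(\<Sum>k<Suc i. p (c ! k)) \<le> 1" if "i < ?n" for i
      using mono[of "Suc i" "Suc ?n"] that unfolding one by simp
  qed (use mono pn in \<open>simp_all add: sum_nonneg del: sum.lessThan_Suc\<close>)
  have jumps: "jumps ?n t k = (\<Sum>j<k. p (c ! j))" if "k \<le> Suc ?n" for k
    using that one by (cases k) (auto simp: jumps_def t_def le_Suc_eq simp del: sum.lessThan_Suc)
  let ?u = "charpt G \<one> (quots c) \<one> t"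
  have "bary ?u z = p z" for z
  proof (cases "z \<in> set c")
    case True
    then obtain k where k: "k \<le> ?n" "z = c ! k"
      using flag_length[OF f] by (metis in_set_conv_nth less_Suc_eq_le)
    then show ?thesis
      unfolding k(2) bary_flag[OF f t refl k(1)] using k(1) by (simp add: jumps del: One_nat_def)
  next
    case False
    have "cum ?u r \<in> set c" for r
      unfolding flag_cell(3)[OF f t] using card_threshold_le[of ?n t r] flag_length[OF f] by (intro nth_mem) simp
    then have "bary ?u z = 0" using False by (intro bary_outside) auto
    then show ?thesis using False c by auto
  qed
  then show thesis using flag_cell(1,2)[OF f t] by (intro that[of ?u]) auto
qed

lemma bary_homeomorphic_map:
  assumes "x \<in> M"
  shows "homeomorphic_map (nbhd_topology {u. wfact G X x u} (\<lambda>u w e. cdist u w < e)) (Otop G X x) bary"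
  unfolding Otop_def
proof (rule homeomorphic_map_nbhd_topology)
  show "bij_betw bary {u. wfact G X x u} (opoints G X x)"
  proof (intro bij_betw_imageI inj_onI equalityI subsetI)
    fix u w assume "u \<in> {u. wfact G X x u}" "w \<in> {u. wfact G X x u}" "bary u = bary w"
    then show "u = w" by (intro bary_inject[of u x w]) (simp_all add: wfact_iff)
  next
    fix p assume "p \<in> bary ` {u. wfact G X x u}"
    then show "p \<in> opoints G X x" using bary_opoints by (auto simp: wfact_iff)
  next
    fix p assume "p \<in> opoints G X x"
    then obtain u where "efficient u" "rho G u = x" "bary u = p" using bary_surj[OF assms] by blast
    then show "p \<in> bary ` {u. wfact G X x u}" by (auto simp: wfact_iff)
  qed
  fix a and e :: real assume a: "a \<in> {u. wfact G X x u}" and e: "0 < e"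
  have ea: "efficient a" "rho G a = x" using a by (auto simp: wfact_iff)
  obtain d where "0 < d" "\<And>w. efficient w \<Longrightarrow> rho G w = x \<Longrightarrow> cdist a w < d \<Longrightarrow> o_near G X x (bary a) (bary w) e"
    using o_near_of_cdist_less[OF ea e] by blast
  then show "\<exists>d>0. \<forall>b\<in>{u. wfact G X x u}. cdist a b < d \<longrightarrow> o_near G X x (bary a) (bary b) e"
    by (intro exI[of _ d]) (auto simp: wfact_iff)
  obtain d where "0 < d" "\<And>w. efficient w \<Longrightarrow> rho G w = x \<Longrightarrow> o_near G X x (bary a) (bary w) d \<Longrightarrow> cdist a w < e"
    using cdist_less_of_o_near[OF ea e] by blast
  then show "\<exists>d>0. \<forall>b\<in>{u. wfact G X x u}. o_near G X x (bary a) (bary b) d \<longrightarrow> cdist a b < e"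
    by (intro exI[of _ d]) (auto simp: wfact_iff)
next
  fix p q d e assume near: "o_near G X x p q d" and de: "d \<le> e"
  obtain ps ds where "ps \<noteq> [] \<and> hd ps = p \<and> last ps = q \<and> length ds = length ps - 1 \<and>
      (\<forall>i < length ds. ostep G X x (ps ! i) (ps ! Suc i) (ds ! i)) \<and> sum_list ds < d"
    using near unfolding o_near_def by blast
  then show "o_near G X x p q e"
    unfolding o_near_def using de by (intro exI[of _ ps] exI[of _ ds]) simp
qed auto

end

theorem theorem5p8:
  fixes G :: "('a, 'b) monoid_scheme" and X :: "'a set" and g h h' :: 'a and v :: "real \<Rightarrow> 'a"
  assumes "group G"
    and "X \<subseteq> carrier G"
    and "generate G X = carrier G"
    and "\<forall>x \<in> X. \<forall>a \<in> carrier G. a \<otimes>\<^bsub>G\<^esub> x \<otimes>\<^bsub>G\<^esub> inv\<^bsub>G\<^esub> a \<in> X"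
    and "g \<in> Mon G X"
    and "v \<in> Fset G X g"
    and "rho G v = h"
    and "h' \<in> intv G X g"
    and "h \<otimes>\<^bsub>G\<^esub> h' = g"
  shows "(\<exists>f. topposet_iso (subtopology (Ftop G X g) (upset G X g v)) (subwf G X)
                           (Ftop G X h') (subwf G X) f)
    \<and> (subtopology (Ftop G X g) (maximals G X (upset G X g v))) homeomorphic_space (Otop G X h')"
proof -
  interpret conj_closed_group G X
    using assms(1,2,4) by (intro conj_closed_group.intro conj_closed_group_axioms.intro) auto
  have v: "efficient v" "rho G v \<preceq> g" using assms(6) by (auto simp: Fset_iff)
  have h': "h' \<in> M" "rho G v \<otimes>\<^bsub>G\<^esub> h' = g"
    using assms(7-9) prefD_M(1) by (auto simp: intv_def)
  let ?A = "maximals G X (upset G X g v)"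
  have up: "?A \<subseteq> upset G X g v" by (auto simp: maximals_def)
  then have "?A \<subseteq> Fset G X g" by (auto simp: upset_def)
  moreover have "homeomorphic_map (nbhd_topology ?A (\<lambda>u w e. cdist u w < e)) (Otop G X h') (bary \<circ> shift v)"
    using homeomorphic_map_shift[OF v(1) up shift_bij_maximals[OF v h']] bary_homeomorphic_map[OF h'(1)]
    by (rule homeomorphic_map_compose)
  ultimately have "subtopology (Ftop G X g) ?A homeomorphic_space Otop G X h'"
    using subtopology_Ftop homeomorphic_map_imp_homeomorphic_space by metis
  then show ?thesis using shift_iso[OF v h'] by blast
qed

end
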